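(* Let $(M,L)$ be a Finsler manifold with Finsler metric $g$, let $D^\circ$ be its Berwald connection with hv-curvature $P^\circ$, and let $T$ and $\widehat P$ be the (h)hv-torsion and the (v)hv-torsion of the Cartan connection. Then for all $\pi$-vector fields $X,Y,Z,W$: (a) $\widehat{P^\circ}(X,Y)=0$; (b) $P^\circ(X,Y,Z,W)+P^\circ(X,Y,W,Z)=2(D^\circ_{\beta X}T)(Y,Z,W)+2(D^\circ_{\gamma Y}\widehat P)(X,Z,W)$; (c) $P^\circ(X,Y)Z=P^\circ(Z,Y)X$; (d) $(D^\circ_{\gamma X}P^\circ)(Y,Z,W)=(D^\circ_{\gamma Z}P^\circ)(Y,X,W)$; (e) $P^\circ$ is totally symmetric, i.e. $P^\circ(X,Y)Z$ is invariant under all permutations of $X,Y,Z$; (f) $(D^\circ_{\gamma\eta}P^\circ)(X,Y,Z)=-P^\circ(X,Y)Z$.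
   Context: $M$ is a real paracompact $C^\infty$ manifold of finite dimension, $\mathcal TM\subset TM$ is the set of nonzero tangent vectors, $\pi:\mathcal TM\to M$ the projection, $\pi^{-1}(TM)\to\mathcal TM$ the pullback of $TM$ by $\pi$; everything is $C^\infty$. Sections of $\pi^{-1}(TM)$ are called $\pi$-vector fields. $\eta$ is the $\pi$-vector field $\eta(u)=(u,u)$. $\rho:T(\mathcal TM)\to\pi^{-1}(TM)$ is $\rho(A)=(u,d\pi(A))$ for $A\in T_u(\mathcal TM)$, and $\gamma:\pi^{-1}(TM)\to T(\mathcal TM)$ is the vertical lift $\gamma(u,v)=\frac{d}{dt}|_{t=0}(u+tv)$; $V=\ker\rho=\operatorname{im}\gamma$. $(M,L)$ is a Finsler manifold: $L:TM\to[0,\infty)$ is smooth and positive on $\mathcal TM$, positively homogeneous of degree 1 on fibres, and the fibrewise Hessian of $E=\frac12L^2$ is positive definite on $\mathcal TM$; this Hessian (in coordinates $g_{ij}=\frac12\partial^2L^2/\partial y^i\partial y^j$) is the Finsler metric $g$ on $\pi^{-1}(TM)$. For a linear connection $D$ on $\pi^{-1}(TM)$, put $K(A)=D_A\eta$ and $H=\ker K$. $D$ is regular if $T(\mathcal TM)=V\oplus H$; then $\beta:=(\rho|_H)^{-1}:\pi^{-1}(TM)\to H$. Torsion: $\mathbf T(A,B)=D_A\rho B-D_B\rho A-\rho[A,B]$; curvature (note the sign): $\mathbf K(A,B)\rho C=-D_AD_B\rho C+D_BD_A\rho C+D_{[A,B]}\rho C$. $Q(X,Y)=\mathbf T(\beta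 X,\beta Y)$, $T(X,Y)=\mathbf T(\gamma X,\beta Y)$; h-, hv-, v-curvatures $R(X,Y)Z=\mathbf K(\beta X,\beta Y)Z$, $P(X,Y)Z=\mathbf K(\beta X,\gamma Y)Z$, $S(X,Y)Z=\mathbf K(\gamma X,\gamma Y)Z$; a hat denotes contraction with $\eta$: $\widehat P(X,Y)=P(X,Y)\eta$, etc. The Cartan connection $\nabla$ is the unique regular connection on $\pi^{-1}(TM)$ with $\nabla g=0$, $Q=0$, and $g(T(X,Y),Z)=g(T(X,Z),Y)$; unadorned $T,P,\widehat P,K,\beta$ refer to $\nabla$. The Berwald connection $D^\circ$ is the unique regular connection on $\pi^{-1}(TM)$ such that $D^\circ_{h^\circ A}L=0$ for all $A$ (where $h^\circ=\beta^\circ\circ\rho$), $\mathbf T^\circ=0$, and $\widehat{P^\circ}=0$; objects with $^\circ$ are those of $D^\circ$. Known facts: $\beta^\circ=\beta$, $K^\circ=K$, and $D^\circ_AY=\nabla_AY+\widehat P(\rho A,Y)-T(KA,Y)$. Notation: $P^\circ(X,Y,Z,W):=g(P^\circ(X,Y)Z,W)$, $T(X,Y,Z):=g(T(X,Y),Z)$, $\widehat P(X,Y,Z):=g(\widehat P(X,Y),Z)$. In (b), $(D^\circ_AT)(X,Y,Z)$ and $(D^\circ_A\widehat P)(X,Y,Z)$ are covariant derivatives of these scalar-valued trilinear forms. $(D^\circ_AP^\circ)(X,Y,Z)=D^\circ_A(P^\circ(X,Y)Z)-P^\circ(D^\circ_AX,Y)Z-P^\circ(X,D^\circ_AY)Z-P^\circ(X,Y)D^\circ_AZ$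 (vector-valued). *)

theory Defs
  imports "HOL-Analysis.Analysis" "HOL-Library.Function_Algebras"
begin

section \<open>Functions as a real vector space\<close>

text \<open>Tangent vectors and sections are functions; they are added and scaled pointwise.\<close>

instantiation "fun" :: (type, real_vector) real_vector
begin

definition scaleR_fun :: "real \<Rightarrow> ('a \<Rightarrow> 'b) \<Rightarrow> 'a \<Rightarrow> 'b" where
  "scaleR_fun r f = (\<lambda>x. r *\<^sub>R f x)"

instance
  by standard (auto simp: scaleR_fun_def fun_eq_iff scaleR_add_right scaleR_add_left)

end

section \<open>Smooth manifolds\<close>

text \<open>\<open>Ck_on k S f\<close> is meant for open \<open>S\<close>: all iterated directional derivatives of \<open>f\<close> up to
  order \<open>k\<close> exist as Frechet derivatives and are continuous on \<open>S\<close>.\<close>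

fun Ck_on :: "nat \<Rightarrow> 'a::real_normed_vector set \<Rightarrow> ('a \<Rightarrow> 'b::real_normed_vector) \<Rightarrow> bool" where
  "Ck_on 0 S f \<longleftrightarrow> continuous_on S f"
| "Ck_on (Suc k) S f \<longleftrightarrow>
     (\<forall>x\<in>S. f differentiable (at x)) \<and> (\<forall>v. Ck_on k S (\<lambda>x. frechet_derivative f (at x) v))"

definition smooth_on :: "'a::real_normed_vector set \<Rightarrow> ('a \<Rightarrow> 'b::real_normed_vector) \<Rightarrow> bool" where
  "smooth_on S f \<longleftrightarrow> (\<forall>k. Ck_on k S f)"

text \<open>A chart is a pair \<open>(U, \<phi>)\<close>; the values of \<open>\<phi>\<close> outside \<open>U\<close> are irrelevant. A manifold is
  given by its atlas, which determines both the underlying set and the topology.\<close>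

type_synonym ('p, 'e) chart = "'p set \<times> ('p \<Rightarrow> 'e)"
type_synonym ('p, 'e) atlas = "('p, 'e) chart set"

abbreviation dom_of :: "('p, 'e) chart \<Rightarrow> 'p set" where "dom_of c \<equiv> fst c"
abbreviation coord :: "('p, 'e) chart \<Rightarrow> 'p \<Rightarrow> 'e" where "coord c \<equiv> snd c"
abbreviation param :: "('p, 'e) chart \<Rightarrow> 'e \<Rightarrow> 'p" where "param c \<equiv> inv_into (fst c) (snd c)"

definition points :: "('p, 'e) atlas \<Rightarrow> 'p set" where
  "points N = (\<Union>c\<in>N. dom_of c)"

definition smooth_atlas :: "('p, 'e::euclidean_space) atlas \<Rightarrow> bool" where
  "smooth_atlas N \<longleftrightarrow>
     (\<forall>c\<in>N. inj_on (coord c) (dom_of c) \<and> open (coord c ` dom_of c)) \<and>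
     (\<forall>c\<in>N. \<forall>d\<in>N. open (coord c ` (dom_of c \<inter> dom_of d)) \<and>
        smooth_on (coord c ` (dom_of c \<inter> dom_of d)) (coord d \<circ> param c))"

definition manifold_topology :: "('p, 'e::euclidean_space) atlas \<Rightarrow> 'p topology" where
  "manifold_topology N =
     topology (\<lambda>W. W \<subseteq> points N \<and> (\<forall>c\<in>N. open (coord c ` (dom_of c \<inter> W))))"

lemma openin_manifold_topology:
  assumes "smooth_atlas N"
  shows "openin (manifold_topology N) W \<longleftrightarrow>
           W \<subseteq> points N \<and> (\<forall>c\<in>N. open (coord c ` (dom_of c \<inter> W)))"
proof -
  have "istopology (\<lambda>W. W \<subseteq> points N \<and> (\<forall>c\<in>N. open (coord c ` (dom_of c \<inter> W))))"
    unfolding istopology_def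
  proof (intro conjI allI impI ballI)
    fix S T c
    assume S: "S \<subseteq> points N \<and> (\<forall>c\<in>N. open (coord c ` (dom_of c \<inter> S)))"
      and T: "T \<subseteq> points N \<and> (\<forall>c\<in>N. open (coord c ` (dom_of c \<inter> T)))"
    show "S \<inter> T \<subseteq> points N" using S by blast
    assume c: "c \<in> N"
    have inj: "inj_on (coord c) (dom_of c)" using assms c by (auto simp: smooth_atlas_def)
    have "coord c ` (dom_of c \<inter> (S \<inter> T)) =
        coord c ` (dom_of c \<inter> S) \<inter> coord c ` (dom_of c \<inter> T)"
      using inj_on_image_Int[OF inj, of "dom_of c \<inter> S" "dom_of c \<inter> T"]
      by (simp add: Int_left_commute Int_assoc)
    then show "open (coord c ` (dom_of c \<inter> (S \<inter> T)))" using S T c by auto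
  next
    fix \<K> assume K: "\<forall>K\<in>\<K>. K \<subseteq> points N \<and> (\<forall>c\<in>N. open (coord c ` (dom_of c \<inter> K)))"
    show "\<Union>\<K> \<subseteq> points N" using K by blast
    fix c assume c: "c \<in> N"
    have "coord c ` (dom_of c \<inter> \<Union>\<K>) = (\<Union>K\<in>\<K>. coord c ` (dom_of c \<inter> K))" by blast
    then show "open (coord c ` (dom_of c \<inter> \<Union>\<K>))" using K c by auto
  qed
  then show ?thesis by (simp add: manifold_topology_def)
qed

definition paracompact_space :: "'p topology \<Rightarrow> bool" where
  "paracompact_space X \<longleftrightarrow>
     (\<forall>\<U>. (\<forall>U\<in>\<U>. openin X U) \<and> \<Union>\<U> = topspace X \<longrightarrow>
        (\<exists>\<V>. (\<forall>V\<in>\<V>. openin X V) \<and> \<Union>\<V> = topspace X \<and>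
             (\<forall>V\<in>\<V>. \<exists>U\<in>\<U>. V \<subseteq> U) \<and> locally_finite_in X \<V>))"

definition smooth_manifold :: "('p, 'e::euclidean_space) atlas \<Rightarrow> bool" where
  "smooth_manifold N \<longleftrightarrow> smooth_atlas N \<and>
     Hausdorff_space (manifold_topology N) \<and> paracompact_space (manifold_topology N)"

definition smooth_in_chart ::
    "('p, 'e::euclidean_space) chart \<Rightarrow> ('p \<Rightarrow> 'b::real_normed_vector) \<Rightarrow> bool" where
  "smooth_in_chart c f \<longleftrightarrow> smooth_on (coord c ` dom_of c) (f \<circ> param c)"

definition smooth_fun :: "('p, 'e::euclidean_space) atlas \<Rightarrow> ('p \<Rightarrow> real) \<Rightarrow> bool" where
  "smooth_fun N f \<longleftrightarrow> (\<forall>c\<in>N. smooth_in_chart c f)"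

section \<open>Tangent vectors and vector fields\<close>

text \<open>A tangent vector at \<open>p\<close> assigns to every chart around \<open>p\<close> a coordinate vector, subject to the
  usual transformation rule. It is set to 0 on all other charts, so that tangent vectors with the
  same coordinates are equal.\<close>

type_synonym ('p, 'e) tvec = "('p, 'e) chart \<Rightarrow> 'e"

definition tangent_space :: "('p, 'e::euclidean_space) atlas \<Rightarrow> 'p \<Rightarrow> ('p, 'e) tvec set" where
  "tangent_space N p = {v.
     (\<forall>c. \<not> (c \<in> N \<and> p \<in> dom_of c) \<longrightarrow> v c = 0) \<and>
     (\<forall>c\<in>N. \<forall>d\<in>N. p \<in> dom_of c \<and> p \<in> dom_of d \<longrightarrow>
        v d = frechet_derivative (coord d \<circ> param c) (at (coord c p)) (v c))}"

definition vector_field :: "('p, 'e::euclidean_space) atlas \<Rightarrow> ('p \<Rightarrow> ('p, 'e) tvec) \<Rightarrow> bool" where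
  "vector_field N A \<longleftrightarrow>
     (\<forall>p\<in>points N. A p \<in> tangent_space N p) \<and> (\<forall>c\<in>N. smooth_in_chart c (\<lambda>p. A p c))"

text \<open>The derivative of \<open>f\<close> at \<open>p\<close> along the tangent vector \<open>a\<close>, computed in the chart \<open>c\<close>.\<close>

definition chart_deriv :: "('p, 'e::euclidean_space) chart \<Rightarrow> ('p \<Rightarrow> 'b::real_normed_vector) \<Rightarrow>
    'p \<Rightarrow> ('p, 'e) tvec \<Rightarrow> 'b" where
  "chart_deriv c f p a = frechet_derivative (f \<circ> param c) (at (coord c p)) (a c)"

text \<open>By the chain rule the choice of chart does not matter.\<close>

definition dir_deriv :: "('p, 'e::euclidean_space) atlas \<Rightarrow> ('p \<Rightarrow> 'b::real_normed_vector) \<Rightarrow>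
    'p \<Rightarrow> ('p, 'e) tvec \<Rightarrow> 'b" where
  "dir_deriv N f p a = chart_deriv (SOME c. c \<in> N \<and> p \<in> dom_of c) f p a"

definition differential :: "('p, 'e::euclidean_space) atlas \<Rightarrow> ('q, 'f::euclidean_space) atlas \<Rightarrow>
    ('p \<Rightarrow> 'q) \<Rightarrow> 'p \<Rightarrow> ('p, 'e) tvec \<Rightarrow> ('q, 'f) tvec" where
  "differential N N' F p a =
     (\<lambda>c. if c \<in> N' \<and> F p \<in> dom_of c then dir_deriv N (coord c \<circ> F) p a else 0)"

definition velocity :: "('p, 'e::euclidean_space) atlas \<Rightarrow> (real \<Rightarrow> 'p) \<Rightarrow> real \<Rightarrow> ('p, 'e) tvec" where
  "velocity N \<kappa> t =
     (\<lambda>c. if c \<in> N \<and> \<kappa> t \<in> dom_of c then vector_derivative (coord c \<circ> \<kappa>) (at t) else 0)"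

text \<open>In coordinates \<open>[A, B]\<^sup>i = A\<^sup>j \<partial>\<^sub>j B\<^sup>i - B\<^sup>j \<partial>\<^sub>j A\<^sup>i\<close>, that is \<open>[A, B] f = A (B f) - B (A f)\<close>.\<close>

definition lie_bracket :: "('p, 'e::euclidean_space) atlas \<Rightarrow> ('p \<Rightarrow> ('p, 'e) tvec) \<Rightarrow>
    ('p \<Rightarrow> ('p, 'e) tvec) \<Rightarrow> 'p \<Rightarrow> ('p, 'e) tvec" where
  "lie_bracket N A B p =
     (\<lambda>c. if c \<in> N \<and> p \<in> dom_of c
          then chart_deriv c (\<lambda>q. B q c) p (A p) - chart_deriv c (\<lambda>q. A q c) p (B p)
          else 0)"

section \<open>The slit tangent bundle\<close>

type_synonym ('m, 'e) tpoint = "'m \<times> ('m, 'e) tvec"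

definition tangent_bundle :: "('m, 'e::euclidean_space) atlas \<Rightarrow> ('m, 'e) tpoint set" where
  "tangent_bundle M = {(p, v). p \<in> points M \<and> v \<in> tangent_space M p}"

definition slit_bundle :: "('m, 'e::euclidean_space) atlas \<Rightarrow> ('m, 'e) tpoint set" where
  "slit_bundle M = {(p, v). (p, v) \<in> tangent_bundle M \<and> v \<noteq> 0}"

definition slit_chart :: "('m, 'e::euclidean_space) atlas \<Rightarrow> ('m, 'e) chart \<Rightarrow>
    (('m, 'e) tpoint, 'e \<times> 'e) chart" where
  "slit_chart M c = ({(p, v) \<in> slit_bundle M. p \<in> dom_of c}, \<lambda>(p, v). (coord c p, v c))"

definition slit_atlas :: "('m, 'e::euclidean_space) atlas \<Rightarrow> (('m, 'e) tpoint, 'e \<times> 'e) atlas" where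
  "slit_atlas M = slit_chart M ` M"

type_synonym ('m, 'e) ttvec = "(('m, 'e) tpoint, 'e \<times> 'e) tvec"

text \<open>The fibre of the pullback of \<open>TM\<close> over \<open>u = (p, v)\<close> is identified with \<open>T\<^sub>p M\<close>, so a
  \<open>\<pi>\<close>-vector field is a function assigning to \<open>u\<close> in the slit tangent bundle an element of
  \<open>T\<^sub>p M\<close>. Its values outside the slit tangent bundle are irrelevant.\<close>

type_synonym ('m, 'e) pifield = "('m, 'e) tpoint \<Rightarrow> ('m, 'e) tvec"

definition pi_vector_field :: "('m, 'e::euclidean_space) atlas \<Rightarrow> ('m, 'e) pifield \<Rightarrow> bool" where
  "pi_vector_field M X \<longleftrightarrow>
     (\<forall>u\<in>slit_bundle M. X u \<in> tangent_space M (fst u)) \<and>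
     (\<forall>c\<in>M. smooth_in_chart (slit_chart M c) (\<lambda>u. X u c))"

definition eta :: "('m, 'e) pifield" where
  "eta u = snd u"

definition rho :: "('m, 'e::euclidean_space) atlas \<Rightarrow> ('m, 'e) tpoint \<Rightarrow> ('m, 'e) ttvec \<Rightarrow>
    ('m, 'e) tvec" where
  "rho M u a = differential (slit_atlas M) M fst u a"

definition vlift :: "('m, 'e::euclidean_space) atlas \<Rightarrow> ('m, 'e) tpoint \<Rightarrow> ('m, 'e) tvec \<Rightarrow>
    ('m, 'e) ttvec" where
  "vlift M u v = velocity (slit_atlas M) (\<lambda>t. (fst u, snd u + t *\<^sub>R v)) 0"

definition vertical :: "('m, 'e::euclidean_space) atlas \<Rightarrow> ('m, 'e) tpoint \<Rightarrow> ('m, 'e) ttvec set" where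
  "vertical M u = {a \<in> tangent_space (slit_atlas M) u. rho M u a = 0}"

section \<open>Linear connections on the pullback bundle\<close>

text \<open>\<open>D u a Y\<close> is the covariant derivative of the \<open>\<pi>\<close>-vector field \<open>Y\<close> along \<open>a \<in> T\<^sub>u(\<T>M)\<close>.\<close>

type_synonym ('m, 'e) pi_conn =
  "('m, 'e) tpoint \<Rightarrow> ('m, 'e) ttvec \<Rightarrow> ('m, 'e) pifield \<Rightarrow> ('m, 'e) tvec"

definition cov :: "('m, 'e) pi_conn \<Rightarrow> (('m, 'e) tpoint \<Rightarrow> ('m, 'e) ttvec) \<Rightarrow>
    ('m, 'e) pifield \<Rightarrow> ('m, 'e) pifield" where
  "cov D A Y = (\<lambda>u. D u (A u) Y)"

definition linear_connection :: "('m, 'e::euclidean_space) atlas \<Rightarrow> ('m, 'e) pi_conn \<Rightarrow> bool" where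
  "linear_connection M D \<longleftrightarrow>
     \<comment> \<open>only the values on the slit tangent bundle matter\<close>
     (\<forall>u\<in>slit_bundle M. \<forall>a\<in>tangent_space (slit_atlas M) u. \<forall>Y Y'.
        pi_vector_field M Y \<and> pi_vector_field M Y' \<and> (\<forall>w\<in>slit_bundle M. Y w = Y' w) \<longrightarrow>
        D u a Y = D u a Y') \<and>
     (\<forall>u\<in>slit_bundle M. \<forall>a\<in>tangent_space (slit_atlas M) u. \<forall>Y.
        pi_vector_field M Y \<longrightarrow> D u a Y \<in> tangent_space M (fst u)) \<and>
     (\<forall>u\<in>slit_bundle M. \<forall>a\<in>tangent_space (slit_atlas M) u.
        \<forall>b\<in>tangent_space (slit_atlas M) u. \<forall>r s Y.
        pi_vector_field M Y \<longrightarrow> D u (r *\<^sub>R a + s *\<^sub>R b) Y = r *\<^sub>R D u a Y + s *\<^sub>R D u b Y) \<and>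
     (\<forall>u\<in>slit_bundle M. \<forall>a\<in>tangent_space (slit_atlas M) u. \<forall>Y Z.
        pi_vector_field M Y \<and> pi_vector_field M Z \<longrightarrow> D u a (Y + Z) = D u a Y + D u a Z) \<and>
     (\<forall>u\<in>slit_bundle M. \<forall>a\<in>tangent_space (slit_atlas M) u. \<forall>f Y.
        smooth_fun (slit_atlas M) f \<and> pi_vector_field M Y \<longrightarrow>
        D u a (\<lambda>w. f w *\<^sub>R Y w) = dir_deriv (slit_atlas M) f u a *\<^sub>R Y u + f u *\<^sub>R D u a Y) \<and>
     (\<forall>A Y. vector_field (slit_atlas M) A \<and> pi_vector_field M Y \<longrightarrow>
        pi_vector_field M (cov D A Y))"

definition conn_map :: "('m, 'e) pi_conn \<Rightarrow> ('m, 'e) tpoint \<Rightarrow> ('m, 'e) ttvec \<Rightarrow> ('m, 'e) tvec" where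
  "conn_map D u a = D u a eta"

definition horizontal :: "('m, 'e::euclidean_space) atlas \<Rightarrow> ('m, 'e) pi_conn \<Rightarrow>
    ('m, 'e) tpoint \<Rightarrow> ('m, 'e) ttvec set" where
  "horizontal M D u = {a \<in> tangent_space (slit_atlas M) u. conn_map D u a = 0}"

definition regular_connection :: "('m, 'e::euclidean_space) atlas \<Rightarrow> ('m, 'e) pi_conn \<Rightarrow> bool" where
  "regular_connection M D \<longleftrightarrow> linear_connection M D \<and>
     (\<forall>u\<in>slit_bundle M.
        vertical M u \<inter> horizontal M D u = {0} \<and>
        (\<forall>a\<in>tangent_space (slit_atlas M) u.
           \<exists>v\<in>vertical M u. \<exists>h\<in>horizontal M D u. a = v + h))"

definition beta :: "('m, 'e::euclidean_space) atlas \<Rightarrow> ('m, 'e) pi_conn \<Rightarrow>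
    ('m, 'e) tpoint \<Rightarrow> ('m, 'e) tvec \<Rightarrow> ('m, 'e) ttvec" where
  "beta M D u v = inv_into (horizontal M D u) (rho M u) v"

definition rho_f :: "('m, 'e::euclidean_space) atlas \<Rightarrow> (('m, 'e) tpoint \<Rightarrow> ('m, 'e) ttvec) \<Rightarrow>
    ('m, 'e) pifield" where
  "rho_f M A = (\<lambda>u. rho M u (A u))"

definition gamma_f :: "('m, 'e::euclidean_space) atlas \<Rightarrow> ('m, 'e) pifield \<Rightarrow>
    ('m, 'e) tpoint \<Rightarrow> ('m, 'e) ttvec" where
  "gamma_f M X = (\<lambda>u. vlift M u (X u))"

definition beta_f :: "('m, 'e::euclidean_space) atlas \<Rightarrow> ('m, 'e) pi_conn \<Rightarrow> ('m, 'e) pifield \<Rightarrow>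
    ('m, 'e) tpoint \<Rightarrow> ('m, 'e) ttvec" where
  "beta_f M D X = (\<lambda>u. beta M D u (X u))"

definition torsion :: "('m, 'e::euclidean_space) atlas \<Rightarrow> ('m, 'e) pi_conn \<Rightarrow>
    (('m, 'e) tpoint \<Rightarrow> ('m, 'e) ttvec) \<Rightarrow> (('m, 'e) tpoint \<Rightarrow> ('m, 'e) ttvec) \<Rightarrow>
    ('m, 'e) pifield" where
  "torsion M D A B =
     cov D A (rho_f M B) - cov D B (rho_f M A) - rho_f M (lie_bracket (slit_atlas M) A B)"

text \<open>This is the negative of the more common sign convention.\<close>

definition curvature :: "('m, 'e::euclidean_space) atlas \<Rightarrow> ('m, 'e) pi_conn \<Rightarrow>
    (('m, 'e) tpoint \<Rightarrow> ('m, 'e) ttvec) \<Rightarrow> (('m, 'e) tpoint \<Rightarrow> ('m, 'e) ttvec) \<Rightarrow>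
    ('m, 'e) pifield \<Rightarrow> ('m, 'e) pifield" where
  "curvature M D A B Z =
     - cov D A (cov D B Z) + cov D B (cov D A Z) + cov D (lie_bracket (slit_atlas M) A B) Z"

definition h_torsion :: "('m, 'e::euclidean_space) atlas \<Rightarrow> ('m, 'e) pi_conn \<Rightarrow>
    ('m, 'e) pifield \<Rightarrow> ('m, 'e) pifield \<Rightarrow> ('m, 'e) pifield" where
  "h_torsion M D X Y = torsion M D (beta_f M D X) (beta_f M D Y)"

definition hv_torsion :: "('m, 'e::euclidean_space) atlas \<Rightarrow> ('m, 'e) pi_conn \<Rightarrow>
    ('m, 'e) pifield \<Rightarrow> ('m, 'e) pifield \<Rightarrow> ('m, 'e) pifield" where
  "hv_torsion M D X Y = torsion M D (gamma_f M X) (beta_f M D Y)"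

definition hv_curv :: "('m, 'e::euclidean_space) atlas \<Rightarrow> ('m, 'e) pi_conn \<Rightarrow>
    ('m, 'e) pifield \<Rightarrow> ('m, 'e) pifield \<Rightarrow> ('m, 'e) pifield \<Rightarrow> ('m, 'e) pifield" where
  "hv_curv M D X Y Z = curvature M D (beta_f M D X) (gamma_f M Y) Z"

definition hv_curv_hat :: "('m, 'e::euclidean_space) atlas \<Rightarrow> ('m, 'e) pi_conn \<Rightarrow>
    ('m, 'e) pifield \<Rightarrow> ('m, 'e) pifield \<Rightarrow> ('m, 'e) pifield" where
  "hv_curv_hat M D X Y = hv_curv M D X Y eta"

definition cov_form3 :: "('m, 'e::euclidean_space) atlas \<Rightarrow> ('m, 'e) pi_conn \<Rightarrow>
    (('m, 'e) tpoint \<Rightarrow> ('m, 'e) ttvec) \<Rightarrow>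
    (('m, 'e) pifield \<Rightarrow> ('m, 'e) pifield \<Rightarrow> ('m, 'e) pifield \<Rightarrow> ('m, 'e) tpoint \<Rightarrow> real) \<Rightarrow>
    ('m, 'e) pifield \<Rightarrow> ('m, 'e) pifield \<Rightarrow> ('m, 'e) pifield \<Rightarrow> ('m, 'e) tpoint \<Rightarrow> real" where
  "cov_form3 M D A \<omega> X Y Z = (\<lambda>u. dir_deriv (slit_atlas M) (\<omega> X Y Z) u (A u)
     - \<omega> (cov D A X) Y Z u - \<omega> X (cov D A Y) Z u - \<omega> X Y (cov D A Z) u)"

definition cov_tensor3 :: "('m, 'e) pi_conn \<Rightarrow> (('m, 'e::euclidean_space) tpoint \<Rightarrow> ('m, 'e) ttvec) \<Rightarrow>
    (('m, 'e) pifield \<Rightarrow> ('m, 'e) pifield \<Rightarrow> ('m, 'e) pifield \<Rightarrow> ('m, 'e) pifield) \<Rightarrow>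
    ('m, 'e) pifield \<Rightarrow> ('m, 'e) pifield \<Rightarrow> ('m, 'e) pifield \<Rightarrow> ('m, 'e) pifield" where
  "cov_tensor3 D A \<Theta> X Y Z =
     cov D A (\<Theta> X Y Z) - \<Theta> (cov D A X) Y Z - \<Theta> X (cov D A Y) Z - \<Theta> X Y (cov D A Z)"

section \<open>Finsler manifolds, the Cartan and the Berwald connection\<close>

text \<open>The Hessian at the point \<open>u\<close> of the restriction of \<open>E = L\<^sup>2 / 2\<close> to the fibre through \<open>u\<close>.\<close>

definition finsler_metric :: "(('m, 'e) tpoint \<Rightarrow> real) \<Rightarrow> ('m, 'e::euclidean_space) tpoint \<Rightarrow>
    ('m, 'e) tvec \<Rightarrow> ('m, 'e) tvec \<Rightarrow> real" where
  "finsler_metric L u v w =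
     deriv (\<lambda>s. deriv (\<lambda>t. (L (fst u, snd u + s *\<^sub>R v + t *\<^sub>R w))\<^sup>2 / 2) 0) 0"

definition metric_f :: "(('m, 'e) tpoint \<Rightarrow> real) \<Rightarrow> ('m, 'e::euclidean_space) pifield \<Rightarrow>
    ('m, 'e) pifield \<Rightarrow> ('m, 'e) tpoint \<Rightarrow> real" where
  "metric_f L X Y = (\<lambda>u. finsler_metric L u (X u) (Y u))"

definition finsler_manifold ::
    "('m, 'e::euclidean_space) atlas \<Rightarrow> (('m, 'e) tpoint \<Rightarrow> real) \<Rightarrow> bool" where
  "finsler_manifold M L \<longleftrightarrow> smooth_manifold M \<and>
     (\<forall>u\<in>tangent_bundle M. 0 \<le> L u) \<and>
     smooth_fun (slit_atlas M) L \<and>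
     (\<forall>u\<in>slit_bundle M. 0 < L u) \<and>
     (\<forall>u\<in>tangent_bundle M. \<forall>r>0. L (fst u, r *\<^sub>R snd u) = r * L u) \<and>
     (\<forall>u\<in>slit_bundle M. \<forall>v\<in>tangent_space M (fst u). v \<noteq> 0 \<longrightarrow> 0 < finsler_metric L u v v)"

definition metrical :: "('m, 'e::euclidean_space) atlas \<Rightarrow> (('m, 'e) tpoint \<Rightarrow> real) \<Rightarrow>
    ('m, 'e) pi_conn \<Rightarrow> bool" where
  "metrical M L D \<longleftrightarrow>
     (\<forall>u\<in>slit_bundle M. \<forall>a\<in>tangent_space (slit_atlas M) u. \<forall>X Y.
        pi_vector_field M X \<and> pi_vector_field M Y \<longrightarrow>
        dir_deriv (slit_atlas M) (metric_f L X Y) u a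
          - finsler_metric L u (D u a X) (Y u) - finsler_metric L u (X u) (D u a Y) = 0)"

definition cartan_connection :: "('m, 'e::euclidean_space) atlas \<Rightarrow> (('m, 'e) tpoint \<Rightarrow> real) \<Rightarrow>
    ('m, 'e) pi_conn \<Rightarrow> bool" where
  "cartan_connection M L D \<longleftrightarrow> regular_connection M D \<and> metrical M L D \<and>
     (\<forall>X Y. pi_vector_field M X \<and> pi_vector_field M Y \<longrightarrow>
        (\<forall>u\<in>slit_bundle M. h_torsion M D X Y u = 0)) \<and>
     (\<forall>X Y Z. pi_vector_field M X \<and> pi_vector_field M Y \<and> pi_vector_field M Z \<longrightarrow>
        (\<forall>u\<in>slit_bundle M.
           metric_f L (hv_torsion M D X Y) Z u = metric_f L (hv_torsion M D X Z) Y u))"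

definition berwald_connection :: "('m, 'e::euclidean_space) atlas \<Rightarrow> (('m, 'e) tpoint \<Rightarrow> real) \<Rightarrow>
    ('m, 'e) pi_conn \<Rightarrow> bool" where
  "berwald_connection M L D \<longleftrightarrow> regular_connection M D \<and>
     (\<forall>u\<in>slit_bundle M. \<forall>a\<in>tangent_space (slit_atlas M) u.
        dir_deriv (slit_atlas M) L u (beta M D u (rho M u a)) = 0) \<and>
     (\<forall>A B. vector_field (slit_atlas M) A \<and> vector_field (slit_atlas M) B \<longrightarrow>
        (\<forall>u\<in>slit_bundle M. torsion M D A B u = 0)) \<and>
     (\<forall>X Y. pi_vector_field M X \<and> pi_vector_field M Y \<longrightarrow>
        (\<forall>u\<in>slit_bundle M. hv_curv_hat M D X Y u = 0))"

definition hv_torsion_form :: "('m, 'e::euclidean_space) atlas \<Rightarrow> (('m, 'e) tpoint \<Rightarrow> real) \<Rightarrow>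
    ('m, 'e) pi_conn \<Rightarrow> ('m, 'e) pifield \<Rightarrow> ('m, 'e) pifield \<Rightarrow> ('m, 'e) pifield \<Rightarrow>
    ('m, 'e) tpoint \<Rightarrow> real" where
  "hv_torsion_form M L D X Y Z = metric_f L (hv_torsion M D X Y) Z"

definition hv_curv_hat_form :: "('m, 'e::euclidean_space) atlas \<Rightarrow> (('m, 'e) tpoint \<Rightarrow> real) \<Rightarrow>
    ('m, 'e) pi_conn \<Rightarrow> ('m, 'e) pifield \<Rightarrow> ('m, 'e) pifield \<Rightarrow> ('m, 'e) pifield \<Rightarrow>
    ('m, 'e) tpoint \<Rightarrow> real" where
  "hv_curv_hat_form M L D X Y Z = metric_f L (hv_curv_hat M D X Y) Z"

definition hv_curv_form :: "('m, 'e::euclidean_space) atlas \<Rightarrow> (('m, 'e) tpoint \<Rightarrow> real) \<Rightarrow>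
    ('m, 'e) pi_conn \<Rightarrow> ('m, 'e) pifield \<Rightarrow> ('m, 'e) pifield \<Rightarrow> ('m, 'e) pifield \<Rightarrow>
    ('m, 'e) pifield \<Rightarrow> ('m, 'e) tpoint \<Rightarrow> real" where
  "hv_curv_form M L D X Y Z W = metric_f L (hv_curv M D X Y Z) W"

end

theory Submission
  imports Defs
begin

text \<open>All objects are expressed in a chart of the slit tangent bundle; cutoff functions on \<open>M\<close> extend
  local fields, so that a connection has coefficients there. Since \<open>D\<close> is torsion free, its coefficients
  \<open>\<Gamma>(X, Y)\<close> are symmetric and vanish in vertical directions. With \<open>N X = \<Gamma>(X, y)\<close> the condition on the contracted
  curvature says that \<open>\<Gamma>(X, Y)\<close> is the vertical derivative \<open>\<partial>\<^sub>Y (N X)\<close>, hence \<open>P\<degree>(X, Y)Z = \<partial>\<^sub>Y \<Gamma>(X, Z)\<close> is a second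
  vertical derivative of \<open>N X\<close> and everything except (b) follows from the symmetry of iterated derivatives.

  For (b), the energy condition determines \<open>N\<close>, and the Koszul formula for the Cartan connection leads to the same
  equations, so both connections have the same horizontal lift. The torsion of the Cartan connection is half
  the vertical derivative of \<open>g\<close>, and the contracted curvature is minus half the Berwald derivative of \<open>g\<close> along
  horizontal lifts, which is totally symmetric because it equals \<open>\<partial>\<^sub>v E\<close> for \<open>v = P\<degree>(X, W)Z\<close>. Differentiating this
  vertically and commuting derivatives gives (b).\<close>

section \<open>Calculus of smooth functions\<close>

text \<open>The definitions constrain global fields point by point, while the argument
  differentiates coordinate expressions; most of the work is this passage. Smoothness is defined
  through derivatives in constant directions, so every tensor is carried as a family of multilinear
  maps that is smooth at fixed arguments, and a basis expansion lets the arguments move. Regularity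
  splits each tangent space of the slit bundle separately and says nothing about smooth dependence.
  The horizontal lift is therefore treated as the solution of a linear system with smooth
  coefficients; only after that do the coordinate formulas for torsion and curvature apply to lifted
  fields. The two lifts are compared first at the radial vector \<open>y\<close>, where Euler's
  relations leave only derivatives of \<open>E\<close> (the geodesic spray), and then at any
  \<open>X\<close>, because the vertical derivative of \<open>N y\<close> in direction
  \<open>X\<close> is \<open>2 N X\<close>. In (b), the identity is the commutation of one vertical
  and one horizontal Berwald derivative of \<open>g\<close>. In (f), differentiating
  \<open>P(X, y, Z) = 0\<close> vertically replaces an appeal to the homogeneity of the
  coefficients.\<close>

abbreviation dd :: "('a::real_normed_vector \<Rightarrow> 'b::real_normed_vector) \<Rightarrow> 'a \<Rightarrow> 'a \<Rightarrow> 'b" where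
  "dd f x v \<equiv> frechet_derivative f (at x) v"

lemma dd_eqI: "(f has_derivative f') (at x) \<Longrightarrow> dd f x v = f' v"
  by (metis frechet_derivative_at)

lemma has_derivative_dd: "f differentiable (at x) \<Longrightarrow> (f has_derivative (\<lambda>v. dd f x v)) (at x)"
  by (simp add: frechet_derivative_works)

lemma dd_cong:
  assumes "open S" "x \<in> S" "\<And>y. y \<in> S \<Longrightarrow> f y = g y"
  shows "dd f x v = dd g x v"
proof -
  have "(f has_derivative f') (at x) \<longleftrightarrow> (g has_derivative f') (at x)" for f'
    using assms has_derivative_transform_within_open[of f f' x UNIV S g]
      has_derivative_transform_within_open[of g f' x UNIV S f] by auto
  then show ?thesis by (simp add: frechet_derivative_def)
qed

lemma differentiable_cong:
  assumes "open S" "x \<in> S" "\<And>y. y \<in> S \<Longrightarrow> f y = g y" "f differentiable (at x)"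
  shows "g differentiable (at x)"
  using assms has_derivative_transform_within_open[of f _ x UNIV S g]
  unfolding differentiable_def by metis

lemma linear_dd: "f differentiable (at x) \<Longrightarrow> linear (\<lambda>v. dd f x v)"
  by (rule linear_frechet_derivative)

lemma linear_euclidean_expand:
  fixes T :: "'a::euclidean_space \<Rightarrow> 'b::real_vector"
  assumes "linear T"
  shows "T w = (\<Sum>b\<in>Basis. (w \<bullet> b) *\<^sub>R T b)"
proof -
  have "T w = T (\<Sum>b\<in>Basis. (w \<bullet> b) *\<^sub>R b)" by (simp add: euclidean_representation)
  also have "\<dots> = (\<Sum>b\<in>Basis. (w \<bullet> b) *\<^sub>R T b)"
    using assms by (simp add: linear_sum linear_scale)
  finally show ?thesis .
qed

section \<open>Closure properties of the classes of finite differentiability\<close>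

lemma Ck_on_cong:
  assumes "open S" "\<And>x. x \<in> S \<Longrightarrow> f x = g x" "Ck_on k S f"
  shows "Ck_on k S g"
  using assms
proof (induction k arbitrary: f g)
  case 0
  then show ?case by (simp cong: continuous_on_cong)
next
  case (Suc k)
  have "Ck_on k S (\<lambda>x. dd g x v)" for v
    by (rule Suc.IH[of "\<lambda>x. dd f x v"]) (use Suc.prems dd_cong[of S _ f g] in auto)
  then show ?case using Suc.prems differentiable_cong[of S _ f g] by auto
qed

lemma Ck_on_continuous: "Ck_on k S f \<Longrightarrow> continuous_on S f"
  by (cases k) (auto intro!: continuous_at_imp_continuous_on differentiable_imp_continuous_within)

lemma Ck_on_SucD: "Ck_on (Suc k) S f \<Longrightarrow> Ck_on k S f"
proof (induction k arbitrary: f)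
  case 0
  have "continuous_on S f" using 0 by (rule Ck_on_continuous)
  then show ?case by simp
next
  case (Suc k)
  then show ?case by (metis Ck_on.simps(2))
qed

lemma Ck_on_subset: "Ck_on k S f \<Longrightarrow> A \<subseteq> S \<Longrightarrow> Ck_on k A f"
  by (induction k arbitrary: f) (auto intro: continuous_on_subset)

lemma Ck_on_local:
  assumes "\<And>x. x \<in> S \<Longrightarrow> \<exists>A. open A \<and> x \<in> A \<and> Ck_on k A f"
  shows "Ck_on k S f"
  using assms
proof (induction k arbitrary: f)
  case 0
  show ?case
    unfolding Ck_on.simps
  proof (rule continuous_at_imp_continuous_on, intro ballI)
    fix x assume "x \<in> S"
    then obtain A where "open A" "x \<in> A" "continuous_on A f" using 0 by (auto simp: Ck_on.simps)
    then show "isCont f x" using continuous_on_eq_continuous_at by blast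
  qed
next
  case (Suc k)
  have "Ck_on k S (\<lambda>x. dd f x v)" for v
    by (rule Suc.IH) (metis Suc.prems Ck_on.simps(2))
  moreover have "f differentiable (at x)" if "x \<in> S" for x
    using Suc.prems[OF that] by auto
  ultimately show ?case by simp
qed

lemma Ck_on_const: "Ck_on k S (\<lambda>x. c)"
  by (induction k arbitrary: c) auto


lemma Ck_on_bounded_linear:
  assumes "bounded_linear h" "open S" "Ck_on k S f"
  shows "Ck_on k S (\<lambda>x. h (f x))"
  using assms(3)
proof (induction k arbitrary: f)
  case 0
  then show ?case using assms(1) by (simp add: bounded_linear.continuous_on)
next
  case (Suc k)
  have *: "((\<lambda>x. h (f x)) has_derivative (\<lambda>v. h (dd f x v))) (at x)" if "x \<in> S" for x
    using Suc.prems that by (auto intro!: bounded_linear.has_derivative[OF assms(1)] has_derivative_dd)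
  have "Ck_on k S (\<lambda>x. dd (\<lambda>x. h (f x)) x v)" for v
  proof (rule Ck_on_cong[OF assms(2)])
    show "h (dd f x v) = dd (\<lambda>x. h (f x)) x v" if "x \<in> S" for x
      using dd_eqI[OF *[OF that]] by simp
    show "Ck_on k S (\<lambda>x. h (dd f x v))" using Suc by simp
  qed
  then show ?case using * by (auto simp: differentiable_def)
qed

lemma Ck_on_linear:
  assumes "bounded_linear h" "open S"
  shows "Ck_on k S h"
proof -
  have "Ck_on k S (\<lambda>x::'a. x)"
    by (cases k) (auto simp: Ck_on_const)
  from Ck_on_bounded_linear[OF assms this] show ?thesis .
qed

lemma Ck_on_bilinear:
  assumes "bounded_bilinear bop" "open S" "Ck_on k S f" "Ck_on k S g"
  shows "Ck_on k S (\<lambda>x. bop (f x) (g x))"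
  using assms(3,4)
proof (induction k arbitrary: f g)
  case 0
  then show ?case using assms(1) by (simp add: bounded_bilinear.continuous_on)
next
  case (Suc k)
  interpret bounded_bilinear bop by fact
  have *: "((\<lambda>x. bop (f x) (g x)) has_derivative (\<lambda>v. bop (f x) (dd g x v) + bop (dd f x v) (g x))) (at x)"
    if "x \<in> S" for x
    using Suc.prems that by (auto intro!: FDERIV has_derivative_dd)
  \<comment> \<open>The product rule turns a product into a sum of two products, so closure under
    sums is already needed at level \<open>k\<close> inside this induction.\<close>
  have add: "Ck_on k S (\<lambda>x. p x + q x)" if "Ck_on k S p" "Ck_on k S q" for p q :: "'d \<Rightarrow> 'c"
    using that
  proof (induction k arbitrary: p q)
    case 0
    then show ?case by (simp add: continuous_on_add)
  next
    case (Suc k)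
    have **: "((\<lambda>x. p x + q x) has_derivative (\<lambda>v. dd p x v + dd q x v)) (at x)" if "x \<in> S" for x
      using Suc.prems that by (auto intro!: has_derivative_add has_derivative_dd)
    have "Ck_on k S (\<lambda>x. dd (\<lambda>x. p x + q x) x v)" for v
    proof (rule Ck_on_cong[OF assms(2)])
      show "dd p x v + dd q x v = dd (\<lambda>x. p x + q x) x v" if "x \<in> S" for x
        using dd_eqI[OF **[OF that]] by simp
      show "Ck_on k S (\<lambda>x. dd p x v + dd q x v)" using Suc by simp
    qed
    then show ?case using ** by (auto simp: differentiable_def)
  qed
  have "Ck_on k S (\<lambda>x. dd (\<lambda>x. bop (f x) (g x)) x v)" for v
  proof (rule Ck_on_cong[OF assms(2)])
    show "bop (f x) (dd g x v) + bop (dd f x v) (g x) = dd (\<lambda>x. bop (f x) (g x)) x v"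
      if "x \<in> S" for x
      using dd_eqI[OF *[OF that]] by simp
    show "Ck_on k S (\<lambda>x. bop (f x) (dd g x v) + bop (dd f x v) (g x))"
      by (intro add Suc.IH) (use Suc.prems Ck_on_SucD in auto)
  qed
  then show ?case using * by (auto simp: differentiable_def)
qed

lemma Ck_on_Pair:
  assumes "open S" "Ck_on k S f" "Ck_on k S g"
  shows "Ck_on k S (\<lambda>x. (f x, g x))"
  using assms(2,3)
proof (induction k arbitrary: f g)
  case 0
  then show ?case by (simp add: continuous_on_Pair)
next
  case (Suc k)
  have *: "((\<lambda>x. (f x, g x)) has_derivative (\<lambda>v. (dd f x v, dd g x v))) (at x)" if "x \<in> S" for x
    using Suc.prems that by (auto intro!: has_derivative_Pair has_derivative_dd)
  have "Ck_on k S (\<lambda>x. dd (\<lambda>x. (f x, g x)) x v)" for v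
  proof (rule Ck_on_cong[OF assms(1)])
    show "(dd f x v, dd g x v) = dd (\<lambda>x. (f x, g x)) x v" if "x \<in> S" for x
      using dd_eqI[OF *[OF that]] by simp
    show "Ck_on k S (\<lambda>x. (dd f x v, dd g x v))" using Suc by simp
  qed
  then show ?case using * by (auto simp: differentiable_def)
qed

lemma Ck_on_add:
  assumes "open S" "Ck_on k S f" "Ck_on k S g"
  shows "Ck_on k S (\<lambda>x. f x + g x)"
proof -
  have "bounded_linear (\<lambda>p::'b \<times> 'b. fst p + snd p)"
    by (intro bounded_linear_add bounded_linear_fst bounded_linear_snd)
  from Ck_on_bounded_linear[OF this assms(1) Ck_on_Pair[OF assms]] show ?thesis by simp
qed

lemma Ck_on_sum:
  assumes "open S" "\<And>i. i \<in> I \<Longrightarrow> Ck_on k S (f i)"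
  shows "Ck_on k S (\<lambda>x. \<Sum>i\<in>I. f i x)"
  using assms(2)
  by (induction I rule: infinite_finite_induct) (auto intro!: Ck_on_add[OF assms(1)] Ck_on_const)

lemma Ck_on_compose:
  fixes f :: "'a::real_normed_vector \<Rightarrow> 'b::euclidean_space" and g :: "'b \<Rightarrow> 'c::real_normed_vector"
  assumes "open S" "\<And>x. x \<in> S \<Longrightarrow> f x \<in> T" "Ck_on k S f" "Ck_on k T g"
  shows "Ck_on k S (\<lambda>x. g (f x))"
  using assms(3,4)
proof (induction k arbitrary: g)
  case 0
  then show ?case using assms(2) by (auto intro!: continuous_on_compose2[of T g S f])
next
  case (Suc k)
  have *: "((\<lambda>x. g (f x)) has_derivative (\<lambda>v. dd g (f x) (dd f x v))) (at x)" if "x \<in> S" for x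
    using Suc.prems that assms(2) by (auto intro!: has_derivative_compose[of f] has_derivative_dd)
  have "Ck_on k S (\<lambda>x. dd (\<lambda>x. g (f x)) x v)" for v
  proof (rule Ck_on_cong[OF assms(1)])
    \<comment> \<open>The chain rule differentiates \<open>g\<close> in the direction
      \<open>dd f x v\<close>, which moves with \<open>x\<close>, whereas \<open>Ck_on\<close>
      controls constant directions only. Expanding the direction in the basis restores constant
      ones.\<close>
    show "(\<Sum>b\<in>Basis. (dd f x v \<bullet> b) *\<^sub>R dd g (f x) b) = dd (\<lambda>x. g (f x)) x v" if "x \<in> S" for x
    proof -
      have "linear (\<lambda>w. dd g (f x) w)" using Suc.prems that assms(2) by (auto intro!: linear_dd)
      then show ?thesis using dd_eqI[OF *[OF that]] linear_euclidean_expand by metis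
    qed
    show "Ck_on k S (\<lambda>x. \<Sum>b\<in>Basis. (dd f x v \<bullet> b) *\<^sub>R dd g (f x) b)"
    proof (intro Ck_on_sum[OF assms(1)] Ck_on_bilinear[OF bounded_bilinear_scaleR assms(1)])
      fix b :: 'b
      have "Ck_on k S (\<lambda>x. dd f x v)" using Suc.prems(1) by simp
      then show "Ck_on k S (\<lambda>x. dd f x v \<bullet> b)"
        by (rule Ck_on_bounded_linear[OF bounded_linear_inner_left assms(1)])
      show "Ck_on k S (\<lambda>x. dd g (f x) b)"
        using Suc.prems Ck_on_SucD by (intro Suc.IH) auto
    qed
  qed
  then show ?case using * by (auto simp: differentiable_def)
qed

section \<open>The same rules for smooth functions\<close>

lemma smooth_on_cong: "open S \<Longrightarrow> (\<And>x. x \<in> S \<Longrightarrow> f x = g x) \<Longrightarrow> smooth_on S f \<Longrightarrow> smooth_on S g"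
  unfolding smooth_on_def using Ck_on_cong by blast

lemma smooth_on_subset: "smooth_on S f \<Longrightarrow> A \<subseteq> S \<Longrightarrow> smooth_on A f"
  unfolding smooth_on_def using Ck_on_subset by blast

lemma smooth_on_local:
  "(\<And>x. x \<in> S \<Longrightarrow> \<exists>A. open A \<and> x \<in> A \<and> smooth_on A f) \<Longrightarrow> smooth_on S f"
  unfolding smooth_on_def by (metis Ck_on_local)

lemma smooth_on_cover:
  "open S \<Longrightarrow> open T \<Longrightarrow> A \<subseteq> S \<union> T \<Longrightarrow> smooth_on S f \<Longrightarrow> smooth_on T f \<Longrightarrow> smooth_on A f"
  by (rule smooth_on_local) auto

lemma smooth_on_differentiable: "smooth_on S f \<Longrightarrow> x \<in> S \<Longrightarrow> f differentiable (at x)"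
  unfolding smooth_on_def by (metis Ck_on.simps(2))

lemma smooth_on_continuous: "smooth_on S f \<Longrightarrow> continuous_on S f"
  unfolding smooth_on_def by (metis Ck_on.simps(1))

lemma smooth_on_has_derivative:
  "smooth_on S f \<Longrightarrow> x \<in> S \<Longrightarrow> (f has_derivative (\<lambda>v. dd f x v)) (at x)"
  by (intro has_derivative_dd smooth_on_differentiable)

lemma smooth_on_dd: "smooth_on S f \<Longrightarrow> smooth_on S (\<lambda>x. dd f x v)"
  unfolding smooth_on_def by (metis Ck_on.simps(2))

lemma smooth_on_linear_dd: "smooth_on S f \<Longrightarrow> x \<in> S \<Longrightarrow> linear (\<lambda>v. dd f x v)"
  by (intro linear_dd smooth_on_differentiable)

lemma smooth_on_const [simp]: "smooth_on S (\<lambda>x. c)"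
  by (simp add: smooth_on_def Ck_on_const)

lemma smooth_on_bounded_linear:
  "bounded_linear h \<Longrightarrow> open S \<Longrightarrow> smooth_on S f \<Longrightarrow> smooth_on S (\<lambda>x. h (f x))"
  by (simp add: smooth_on_def Ck_on_bounded_linear)

lemma smooth_on_linear: "bounded_linear h \<Longrightarrow> open S \<Longrightarrow> smooth_on S h"
  by (simp add: smooth_on_def Ck_on_linear)

lemma smooth_on_bilinear:
  "bounded_bilinear bop \<Longrightarrow> open S \<Longrightarrow> smooth_on S f \<Longrightarrow> smooth_on S g \<Longrightarrow>
    smooth_on S (\<lambda>x. bop (f x) (g x))"
  by (simp add: smooth_on_def Ck_on_bilinear)

lemmas smooth_on_scaleR = smooth_on_bilinear[OF bounded_bilinear_scaleR]
lemmas smooth_on_mult = smooth_on_bilinear[OF bounded_bilinear_mult]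
lemmas smooth_on_inner_left = smooth_on_bounded_linear[OF bounded_linear_inner_left]

lemma smooth_on_Pair:
  "open S \<Longrightarrow> smooth_on S f \<Longrightarrow> smooth_on S g \<Longrightarrow> smooth_on S (\<lambda>x. (f x, g x))"
  by (simp add: smooth_on_def Ck_on_Pair)

lemma smooth_on_add:
  "open S \<Longrightarrow> smooth_on S f \<Longrightarrow> smooth_on S g \<Longrightarrow> smooth_on S (\<lambda>x. f x + g x)"
  by (simp add: smooth_on_def Ck_on_add)

lemma smooth_on_sum:
  "open S \<Longrightarrow> (\<And>i. i \<in> I \<Longrightarrow> smooth_on S (f i)) \<Longrightarrow> smooth_on S (\<lambda>x. \<Sum>i\<in>I. f i x)"
  by (simp add: smooth_on_def Ck_on_sum)

lemma smooth_on_minus: "open S \<Longrightarrow> smooth_on S f \<Longrightarrow> smooth_on S (\<lambda>x. - f x)"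
  by (rule smooth_on_bounded_linear[OF bounded_linear_minus[OF bounded_linear_ident]])

lemma smooth_on_diff:
  "open S \<Longrightarrow> smooth_on S f \<Longrightarrow> smooth_on S g \<Longrightarrow> smooth_on S (\<lambda>x. f x - g x)"
  using smooth_on_add[of S f "\<lambda>x. - g x"] smooth_on_minus[of S g] by simp

lemma smooth_on_fst: "open S \<Longrightarrow> smooth_on S f \<Longrightarrow> smooth_on S (\<lambda>x. fst (f x))"
  by (rule smooth_on_bounded_linear[OF bounded_linear_fst])

lemma smooth_on_ident: "open S \<Longrightarrow> smooth_on S (\<lambda>x. x)"
  by (rule smooth_on_linear[OF bounded_linear_ident])

lemma smooth_on_compose:
  fixes f :: "'a::real_normed_vector \<Rightarrow> 'b::euclidean_space" and g :: "'b \<Rightarrow> 'c::real_normed_vector"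
  shows "smooth_on T g \<Longrightarrow> open S \<Longrightarrow> smooth_on S f \<Longrightarrow> (\<And>x. x \<in> S \<Longrightarrow> f x \<in> T) \<Longrightarrow>
    smooth_on S (\<lambda>x. g (f x))"
  using Ck_on_compose[of S f T _ g] by (simp add: smooth_on_def)

section \<open>Families of linear maps evaluated at moving arguments\<close>

lemma family_has_derivative:
  fixes T :: "'z::real_normed_vector \<Rightarrow> 'a::euclidean_space \<Rightarrow> 'b::real_normed_vector"
  assumes "open S" "z \<in> S" "\<And>x. x \<in> S \<Longrightarrow> linear (T x)" "\<And>a. (\<lambda>x. T x a) differentiable (at z)"
    and "(f has_derivative f') (at z)"
  shows "((\<lambda>x. T x (f x)) has_derivative (\<lambda>v. dd (\<lambda>x. T x (f z)) z v + T z (f' v))) (at z)"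
proof -
  \<comment> \<open>No operator-valued map is differentiated: \<open>T\<close> is known only through
    its values at fixed vectors, and finite dimension reduces the product rule to scalar coordinates
    times \<open>T x b\<close>.\<close>
  have 1: "((\<lambda>x. \<Sum>b\<in>Basis. (f x \<bullet> b) *\<^sub>R T x b) has_derivative
      (\<lambda>v. \<Sum>b\<in>Basis. (f z \<bullet> b) *\<^sub>R dd (\<lambda>x. T x b) z v + (f' v \<bullet> b) *\<^sub>R T z b)) (at z)"
    by (intro has_derivative_sum has_derivative_scaleR has_derivative_dd assms
      has_derivative_inner_left)
  have "((\<lambda>x. \<Sum>b\<in>Basis. (f z \<bullet> b) *\<^sub>R T x b) has_derivative
      (\<lambda>v. \<Sum>b\<in>Basis. (f z \<bullet> b) *\<^sub>R dd (\<lambda>x. T x b) z v)) (at z)"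
    by (intro has_derivative_sum has_derivative_scaleR_right has_derivative_dd assms)
  then have "dd (\<lambda>x. \<Sum>b\<in>Basis. (f z \<bullet> b) *\<^sub>R T x b) z v = (\<Sum>b\<in>Basis. (f z \<bullet> b) *\<^sub>R dd (\<lambda>x. T x b) z v)" for v
    by (rule dd_eqI)
  moreover have "dd (\<lambda>x. T x (f z)) z v = dd (\<lambda>x. \<Sum>b\<in>Basis. (f z \<bullet> b) *\<^sub>R T x b) z v" for v
    by (rule dd_cong[OF assms(1,2)]) (use assms(3) linear_euclidean_expand in metis)
  moreover have "T z (f' v) = (\<Sum>b\<in>Basis. (f' v \<bullet> b) *\<^sub>R T z b)" for v
    using assms(2,3) linear_euclidean_expand by metis
  ultimately have 2: "(\<lambda>v. dd (\<lambda>x. T x (f z)) z v + T z (f' v)) =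
      (\<lambda>v. \<Sum>b\<in>Basis. (f z \<bullet> b) *\<^sub>R dd (\<lambda>x. T x b) z v + (f' v \<bullet> b) *\<^sub>R T z b)"
    by (simp add: sum.distrib fun_eq_iff)
  show ?thesis
    unfolding 2
    by (rule has_derivative_transform_within_open[OF 1 assms(1,2)])
      (use assms(3) linear_euclidean_expand in metis)
qed

lemma smooth_on_family:
  fixes T :: "'z::real_normed_vector \<Rightarrow> 'a::euclidean_space \<Rightarrow> 'b::real_normed_vector"
  assumes "open S" "\<And>x. x \<in> S \<Longrightarrow> linear (T x)" "\<And>a. smooth_on S (\<lambda>x. T x a)" "smooth_on S f"
  shows "smooth_on S (\<lambda>x. T x (f x))"
proof (rule smooth_on_cong[OF assms(1)])
  show "smooth_on S (\<lambda>x. \<Sum>b\<in>Basis. (f x \<bullet> b) *\<^sub>R T x b)"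
    by (intro smooth_on_sum smooth_on_scaleR smooth_on_inner_left assms)
  show "(\<Sum>b\<in>Basis. (f x \<bullet> b) *\<^sub>R T x b) = T x (f x)" if "x \<in> S" for x
    using linear_euclidean_expand[OF assms(2)[OF that]] by metis
qed

lemma smooth_on_dd_moving:
  fixes f :: "'a::euclidean_space \<Rightarrow> 'b::real_normed_vector"
  assumes "open S" "smooth_on S f" "smooth_on S v"
  shows "smooth_on S (\<lambda>x. dd f x (v x))"
  by (rule smooth_on_family[OF assms(1), of "\<lambda>x. dd f x"])
    (use assms smooth_on_linear_dd smooth_on_dd in auto)

lemma dd_family:
  fixes T :: "'z::real_normed_vector \<Rightarrow> 'a::euclidean_space \<Rightarrow> 'b::real_normed_vector"
  assumes "open S" "z \<in> S" "\<And>x. x \<in> S \<Longrightarrow> linear (T x)" "\<And>a. smooth_on S (\<lambda>x. T x a)"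
    and "f differentiable (at z)"
  shows "dd (\<lambda>x. T x (f x)) z v = dd (\<lambda>x. T x (f z)) z v + T z (dd f z v)"
  by (rule dd_eqI, rule family_has_derivative[OF assms(1-3)])
    (use assms(2,5) in \<open>auto intro: has_derivative_dd smooth_on_differentiable[OF assms(4)]\<close>)

lemma linear_dd_family:
  fixes T :: "'z::real_normed_vector \<Rightarrow> 'a::real_vector \<Rightarrow> 'b::real_normed_vector"
  assumes "open S" "z \<in> S" "\<And>x. x \<in> S \<Longrightarrow> linear (T x)" "\<And>a. smooth_on S (\<lambda>x. T x a)"
  shows "linear (\<lambda>a. dd (\<lambda>x. T x a) z v)"
proof (rule linearI)
  have d: "((\<lambda>x. T x a) has_derivative (\<lambda>v. dd (\<lambda>x. T x a) z v)) (at z)" for a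
    using assms smooth_on_has_derivative by blast
  show "dd (\<lambda>x. T x (a + b)) z v = dd (\<lambda>x. T x a) z v + dd (\<lambda>x. T x b) z v" for a b
  proof -
    have "dd (\<lambda>x. T x (a + b)) z v = dd (\<lambda>x. T x a + T x b) z v"
      by (rule dd_cong[OF assms(1,2)]) (use assms(3) linear_add in blast)
    then show ?thesis using dd_eqI[OF has_derivative_add[OF d d]] by simp
  qed
  show "dd (\<lambda>x. T x (r *\<^sub>R a)) z v = r *\<^sub>R dd (\<lambda>x. T x a) z v" for r a
  proof -
    have "dd (\<lambda>x. T x (r *\<^sub>R a)) z v = dd (\<lambda>x. r *\<^sub>R T x a) z v"
      by (rule dd_cong[OF assms(1,2)]) (use assms(3) linear_scale in blast)
    then show ?thesis using dd_eqI[OF has_derivative_scaleR_right[OF d]] by simp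
  qed
qed

section \<open>Smooth dependence of the solution of a linear equation\<close>

lemma has_derivative_zero_scaleR:
  fixes \<phi> :: "'a::real_normed_vector \<Rightarrow> real" and \<psi> :: "'a \<Rightarrow> 'b::real_normed_vector"
  assumes "isCont \<phi> z" "\<phi> z = 0" "(\<psi> has_derivative \<psi>') (at z)" "\<psi> z = 0"
  shows "((\<lambda>x. \<phi> x *\<^sub>R \<psi> x) has_derivative (\<lambda>v. 0)) (at z)"
proof -
  \<comment> \<open>The second factor is of order \<open>norm (y - z)\<close> and the first tends to
    0, so the product is negligible to first order. Since the first factor is merely continuous, the
    lemma applies to a solution whose differentiability is still to be shown.\<close>
  obtain K where K: "K > 0" "\<And>x. norm (\<psi>' x) \<le> norm x * K"
    using bounded_linear.pos_bounded[OF has_derivative_bounded_linear[OF assms(3)]] by auto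
  show ?thesis
    unfolding has_derivative_at_alt
  proof (intro conjI bounded_linear_zero allI impI)
    fix e :: real assume e: "e > 0"
    from assms(3) obtain d1 where d1: "d1 > 0"
      "\<And>y. norm (y - z) < d1 \<Longrightarrow> norm (\<psi> y - \<psi> z - \<psi>' (y - z)) \<le> 1 * norm (y - z)"
      unfolding has_derivative_at_alt by (meson zero_less_one)
    have "e / (1 + K) > 0" using e K by simp
    then obtain d2 where d2: "d2 > 0" "\<And>y. dist y z < d2 \<Longrightarrow> dist (\<phi> y) (\<phi> z) < e / (1 + K)"
      using assms(1) unfolding continuous_at_eps_delta by metis
    show "\<exists>d>0. \<forall>y. norm (y - z) < d \<longrightarrow>
      norm (\<phi> y *\<^sub>R \<psi> y - \<phi> z *\<^sub>R \<psi> z - 0) \<le> e * norm (y - z)"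
    proof (intro exI[of _ "min d1 d2"] conjI allI impI)
      fix y assume y: "norm (y - z) < min d1 d2"
      have "norm (\<psi> y) \<le> norm (\<psi> y - \<psi>' (y - z)) + norm (\<psi>' (y - z))"
        by (metis norm_triangle_sub add.commute)
      also have "\<dots> \<le> norm (y - z) + norm (y - z) * K"
        using d1(2)[of y] y K(2)[of "y - z"] assms(4) by simp
      finally have 1: "norm (\<psi> y) \<le> (1 + K) * norm (y - z)" by (simp add: algebra_simps)
      have 2: "\<bar>\<phi> y\<bar> \<le> e / (1 + K)" using d2(2)[of y] y assms(2) by (simp add: dist_norm)
      have "\<bar>\<phi> y\<bar> * norm (\<psi> y) \<le> e / (1 + K) * ((1 + K) * norm (y - z))"
        by (rule mult_mono[OF 2 1]) (use e K in auto)
      also have "\<dots> = e * norm (y - z)" using K by simp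
      finally show "norm (\<phi> y *\<^sub>R \<psi> y - \<phi> z *\<^sub>R \<psi> z - 0) \<le> e * norm (y - z)"
        using assms by simp
    qed (use d1 d2 in auto)
  qed
qed

lemma linear_inj_left_inverse:
  fixes T :: "'a::euclidean_space \<Rightarrow> 'a"
  assumes "linear T" "inj T"
  shows "\<exists>G. linear G \<and> (\<forall>v. G (T v) = v)"
proof -
  obtain G where G: "linear G" "G \<circ> T = id"
    using linear_injective_left_inverse[OF assms] by blast
  have "G (T v) = v" for v using fun_cong[OF G(2), of v] by simp
  with G(1) show ?thesis by blast
qed

text \<open>Near \<open>z\<close> the map \<open>G (T z - T x)\<close> has norm below 1/2, measured
  by the finite sum \<open>m\<close> over the basis. Hence \<open>s x - s z\<close> is bounded by
  twice \<open>G (r x - T x (s z))\<close>, which tends to 0.\<close>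

lemma linear_solution_continuous:
  fixes T :: "'z::real_normed_vector \<Rightarrow> 'a::euclidean_space \<Rightarrow> 'a"
  assumes "open S" "z \<in> S" "\<And>x. x \<in> S \<Longrightarrow> linear (T x)" "\<And>a. continuous_on S (\<lambda>x. T x a)"
    and "inj (T z)" "continuous_on S r" "\<And>x. x \<in> S \<Longrightarrow> T x (s x) = r x"
  shows "isCont s z"
proof -
  obtain G where G: "linear G" "\<And>v. G (T z v) = v"
    using linear_inj_left_inverse[OF assms(3)[OF assms(2)] assms(5)] by auto
  have cont: "isCont (\<lambda>x. T x a) z" for a
    using continuous_on_interior[OF assms(4)] assms(2) interior_open[OF assms(1)] by simp
  have contG: "isCont G w" for w
    using linear_continuous_at G(1) by (simp add: linear_conv_bounded_linear)
  define m where "m x = (\<Sum>b\<in>Basis. norm (G (T z b - T x b)))" for x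
  have "isCont m z"
    unfolding m_def by (intro continuous_intros isCont_o2[OF _ contG] cont)
  moreover have "m z = 0" by (simp add: m_def linear_0[OF G(1)])
  ultimately have "\<forall>\<^sub>F x in at z. m x < 1/2"
    by (intro order_tendstoD(2)[of m 0]) (simp_all add: isCont_def)
  moreover have inS: "\<forall>\<^sub>F x in at z. x \<in> S"
    using eventually_at_in_open'[OF assms(1,2)] .
  ultimately have bd: "\<forall>\<^sub>F x in at z. norm (s x - s z) \<le> 2 * norm (G (r x - T x (s z)))"
  proof eventually_elim
    case (elim x)
    define v where "v = s x - s z"
    have lin: "linear (\<lambda>v. G (T z v - T x v))"
      using linear_compose[OF linear_compose_sub[OF assms(3)[OF assms(2)] assms(3)[OF elim(2)]] G(1)]
      by (simp add: o_def)
    have "norm (G (T z v - T x v)) \<le> (\<Sum>b\<in>Basis. norm ((v \<bullet> b) *\<^sub>R G (T z b - T x b)))"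
      unfolding linear_euclidean_expand[OF lin, of v] by (rule norm_sum)
    also have "\<dots> \<le> (\<Sum>b\<in>Basis. norm v * norm (G (T z b - T x b)))"
      by (intro sum_mono) (simp add: Basis_le_norm mult_right_mono)
    also have "\<dots> = norm v * m x" by (simp add: m_def sum_distrib_left)
    also have "\<dots> \<le> norm v * (1/2)" using elim by (intro mult_left_mono) auto
    finally have 1: "norm (G (T z v - T x v)) \<le> norm v / 2" by simp
    have "v = G (T z v - T x v) + G (T x v)"
      by (simp add: linear_diff[OF G(1)] G(2))
    then have "norm v \<le> norm (G (T z v - T x v)) + norm (G (T x v))"
      by (metis norm_triangle_ineq)
    with 1 have "norm v \<le> 2 * norm (G (T x v))" by simp
    moreover have "T x v = r x - T x (s z)"
      using assms(3)[OF elim(2)] assms(7)[OF elim(2)] by (simp add: v_def linear_diff)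
    ultimately show ?case by (simp add: v_def)
  qed
  have "isCont (\<lambda>x. 2 * norm (G (r x - T x (s z)))) z"
    using continuous_on_interior[OF assms(6)] assms(2) interior_open[OF assms(1)]
    by (intro continuous_intros isCont_o2[OF _ contG] cont) simp
  then have lim: "((\<lambda>x. 2 * norm (G (r x - T x (s z)))) \<longlongrightarrow> 0) (at z)"
    using assms(7)[OF assms(2)] by (simp add: isCont_def linear_0[OF G(1)])
  have "\<forall>\<^sub>F x in at z. 0 \<le> norm (s x - s z)" by simp
  from tendsto_sandwich[OF this bd tendsto_const lim]
  have "((\<lambda>x. norm (s x - s z)) \<longlongrightarrow> 0) (at z)" .
  then have "((\<lambda>x. s x - s z) \<longlongrightarrow> 0) (at z)" by (rule tendsto_norm_zero_cancel)
  then show ?thesis unfolding isCont_def by (rule LIM_zero_cancel)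
qed

text \<open>The increment \<open>v = s x - s z\<close> satisfies
  \<open>v = G (r x - T x (s z)) + G (T z v - T x v)\<close>. The last term is a sum of products of
  two factors vanishing at \<open>z\<close>, so by \<open>has_derivative_zero_scaleR\<close> it does
  not contribute.\<close>

lemma linear_solution_has_derivative:
  fixes T :: "'z::real_normed_vector \<Rightarrow> 'a::euclidean_space \<Rightarrow> 'a"
  assumes "open S" "z \<in> S" "\<And>x. x \<in> S \<Longrightarrow> linear (T x)" "\<And>a. (\<lambda>x. T x a) differentiable (at z)"
    and "isCont s z" "r differentiable (at z)" "\<And>x. x \<in> S \<Longrightarrow> T x (s x) = r x"
    and "linear G" "\<And>v. G (T z v) = v"
  shows "(s has_derivative (\<lambda>v. G (dd r z v - dd (\<lambda>x. T x (s z)) z v))) (at z)"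
proof -
  have blG: "bounded_linear G" using assms(8) linear_conv_bounded_linear by blast
  have 1: "((\<lambda>x. G (r x - T x (s z))) has_derivative (\<lambda>v. G (dd r z v - dd (\<lambda>x. T x (s z)) z v))) (at z)"
    by (intro bounded_linear.has_derivative[OF blG] has_derivative_diff has_derivative_dd assms)
  have 2: "((\<lambda>x. \<Sum>b\<in>Basis. ((s x - s z) \<bullet> b) *\<^sub>R G (T z b - T x b)) has_derivative (\<lambda>v. \<Sum>b\<in>(Basis::'a set). 0)) (at z)"
  proof (rule has_derivative_sum)
    fix b :: 'a
    show "((\<lambda>x. ((s x - s z) \<bullet> b) *\<^sub>R G (T z b - T x b)) has_derivative (\<lambda>v. 0)) (at z)"
    proof (rule has_derivative_zero_scaleR)
      show "isCont (\<lambda>x. (s x - s z) \<bullet> b) z" using assms(5) by (intro continuous_intros)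
      show "((\<lambda>x. G (T z b - T x b)) has_derivative (\<lambda>v. G (0 - dd (\<lambda>x. T x b) z v))) (at z)"
        by (intro bounded_linear.has_derivative[OF blG] has_derivative_diff has_derivative_dd
            has_derivative_const assms)
    qed (simp_all add: linear_0[OF assms(8)])
  qed
  have 3: "((\<lambda>x. s z + (G (r x - T x (s z)) + (\<Sum>b\<in>Basis. ((s x - s z) \<bullet> b) *\<^sub>R G (T z b - T x b))))
     has_derivative (\<lambda>v. 0 + (G (dd r z v - dd (\<lambda>x. T x (s z)) z v) + (\<Sum>b\<in>(Basis::'a set). 0)))) (at z)"
    by (intro has_derivative_add has_derivative_const 1 2)
  then have 3: "((\<lambda>x. s z + (G (r x - T x (s z)) + (\<Sum>b\<in>Basis. ((s x - s z) \<bullet> b) *\<^sub>R G (T z b - T x b))))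
     has_derivative (\<lambda>v. G (dd r z v - dd (\<lambda>x. T x (s z)) z v))) (at z)"
    by simp
  show ?thesis
  proof (rule has_derivative_transform_within_open[OF 3 assms(1,2)])
    fix x assume x: "x \<in> S"
    define v where "v = s x - s z"
    have lin: "linear (\<lambda>v. G (T z v - T x v))"
      using linear_compose[OF linear_compose_sub[OF assms(3)[OF assms(2)] assms(3)[OF x]] assms(8)]
      by (simp add: o_def)
    have "(\<Sum>b\<in>Basis. (v \<bullet> b) *\<^sub>R G (T z b - T x b)) = G (T z v - T x v)"
      using linear_euclidean_expand[OF lin, of v] by simp
    moreover have "r x - T x (s z) = T x v"
      using assms(7)[OF x] linear_diff[OF assms(3)[OF x]] by (simp add: v_def)
    moreover have "G (T x v) + G (T z v - T x v) = v"
      using assms(8,9) by (simp add: linear_diff)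
    ultimately show "s z + (G (r x - T x (s z)) + (\<Sum>b\<in>Basis. ((s x - s z) \<bullet> b) *\<^sub>R G (T z b - T x b))) = s x"
      by (simp add: v_def)
  qed
qed


text \<open>Bootstrapping: a directional derivative of \<open>s\<close> solves a linear equation
  with the same \<open>T\<close>, whose right-hand side contains only \<open>s\<close> itself and
  derivatives of \<open>r\<close> and \<open>T\<close>. One order of \<open>s\<close> thus yields
  the next.\<close>

lemma Ck_on_linear_solution:
  fixes T :: "'z::real_normed_vector \<Rightarrow> 'a::euclidean_space \<Rightarrow> 'a"
  assumes "open S" "\<And>x. x \<in> S \<Longrightarrow> linear (T x)" "\<And>a. smooth_on S (\<lambda>x. T x a)"
    and "\<And>x. x \<in> S \<Longrightarrow> inj (T x)" "Ck_on k S r" "\<And>x. x \<in> S \<Longrightarrow> T x (s x) = r x"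
  shows "Ck_on k S s"
  using assms(5,6)
proof (induction k arbitrary: r s)
  case 0
  have "isCont s x" if "x \<in> S" for x
    by (rule linear_solution_continuous[where T = T and r = r, OF assms(1) that])
      (use 0 assms(2,4) smooth_on_continuous[OF assms(3)] that in auto)
  then show ?case by (simp add: continuous_at_imp_continuous_on)
next
  case (Suc k)
  have r: "r differentiable (at x)" if "x \<in> S" for x using Suc.prems(1) that by simp
  have ct: "isCont s x" if "x \<in> S" for x
    by (rule linear_solution_continuous[where T = T and r = r, OF assms(1) that])
      (use Suc.prems(2) Ck_on_continuous[OF Suc.prems(1)] assms(2,4) smooth_on_continuous[OF assms(3)] that in auto)
  have df: "s differentiable (at x)" if x: "x \<in> S" for x
  proof -
    obtain G where G: "linear G" "\<And>v. G (T x v) = v"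
      using linear_inj_left_inverse[OF assms(2)[OF x] assms(4)[OF x]] by auto
    have "(s has_derivative (\<lambda>v. G (dd r x v - dd (\<lambda>y. T y (s x)) x v))) (at x)"
      by (rule linear_solution_has_derivative[where T = T, OF assms(1) x])
        (use assms(2) ct[OF x] r[OF x] Suc.prems(2) G smooth_on_differentiable[OF assms(3) x] in auto)
    then show ?thesis unfolding differentiable_def by blast
  qed
  have sm: "Ck_on k S s"
    using Suc.IH[of r s] Suc.prems Ck_on_SucD by blast
  have eq: "T x (dd s x v) = dd r x v - (\<Sum>b\<in>Basis. (s x \<bullet> b) *\<^sub>R dd (\<lambda>y. T y b) x v)"
    if x: "x \<in> S" for x v
  proof -
    have "dd r x v = dd (\<lambda>y. T y (s y)) x v"
      by (rule dd_cong[OF assms(1) x]) (use Suc.prems in simp)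
    also have "\<dots> = dd (\<lambda>y. T y (s x)) x v + T x (dd s x v)"
      by (rule dd_family[OF assms(1) x assms(2,3) df[OF x]])
    also have "dd (\<lambda>y. T y (s x)) x v = (\<Sum>b\<in>Basis. (s x \<bullet> b) *\<^sub>R dd (\<lambda>y. T y b) x v)"
      by (rule linear_euclidean_expand[OF linear_dd_family[OF assms(1) x assms(2,3)]])
    finally show ?thesis by simp
  qed
  have "Ck_on k S (\<lambda>x. dd s x v)" for v
  proof (rule Suc.IH[OF _ eq])
    have T: "Ck_on k S (\<lambda>x. dd (\<lambda>y. T y b) x v)" for b
      using smooth_on_dd[OF assms(3)] by (simp add: smooth_on_def)
    have "Ck_on k S (\<lambda>x. (\<Sum>b\<in>Basis. (s x \<bullet> b) *\<^sub>R dd (\<lambda>y. T y b) x v))"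
      by (intro Ck_on_sum[OF assms(1)] Ck_on_bilinear[OF bounded_bilinear_scaleR assms(1)] T
        Ck_on_bounded_linear[OF bounded_linear_inner_left assms(1) sm])
    then have "Ck_on k S (\<lambda>x. - (\<Sum>b\<in>Basis. (s x \<bullet> b) *\<^sub>R dd (\<lambda>y. T y b) x v))"
      by (rule Ck_on_bounded_linear[OF bounded_linear_minus[OF bounded_linear_ident] assms(1)])
    moreover have "Ck_on k S (\<lambda>x. dd r x v)" using Suc.prems(1) by simp
    ultimately have "Ck_on k S (\<lambda>x. dd r x v + - (\<Sum>b\<in>Basis. (s x \<bullet> b) *\<^sub>R dd (\<lambda>y. T y b) x v))"
      by (intro Ck_on_add[OF assms(1)])
    then show "Ck_on k S (\<lambda>x. dd r x v - (\<Sum>b\<in>Basis. (s x \<bullet> b) *\<^sub>R dd (\<lambda>y. T y b) x v))"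
      by simp
  qed
  with df show ?case by simp
qed

lemma smooth_on_linear_solution:
  fixes T :: "'z::real_normed_vector \<Rightarrow> 'a::euclidean_space \<Rightarrow> 'a"
  assumes "open S" "\<And>x. x \<in> S \<Longrightarrow> linear (T x)" "\<And>a. smooth_on S (\<lambda>x. T x a)"
    and "\<And>x. x \<in> S \<Longrightarrow> inj (T x)" "smooth_on S r" "\<And>x. x \<in> S \<Longrightarrow> T x (s x) = r x"
  shows "smooth_on S s"
  unfolding smooth_on_def
proof
  fix k
  show "Ck_on k S s"
    by (rule Ck_on_linear_solution[where T = T and r = r]) (use assms in \<open>auto simp: smooth_on_def\<close>)
qed

section \<open>Symmetry of second derivatives\<close>

lemma has_real_derivative_line:
  fixes f :: "'a::real_normed_vector \<Rightarrow> real"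
  assumes "f differentiable (at (p + s *\<^sub>R v))"
  shows "((\<lambda>s. f (p + s *\<^sub>R v)) has_real_derivative dd f (p + s *\<^sub>R v) v) (at s)"
proof -
  have "((\<lambda>s. p + s *\<^sub>R v) has_derivative (\<lambda>h. h *\<^sub>R v)) (at s)"
    by (auto intro!: derivative_eq_intros)
  from has_derivative_compose[OF this has_derivative_dd[OF assms]]
  have "((\<lambda>s. f (p + s *\<^sub>R v)) has_derivative (\<lambda>h. dd f (p + s *\<^sub>R v) (h *\<^sub>R v))) (at s)" .
  moreover have "dd f (p + s *\<^sub>R v) (h *\<^sub>R v) = dd f (p + s *\<^sub>R v) v * h" for h
    using linear_scale[OF linear_dd[OF assms]] by (simp add: mult.commute)
  ultimately show ?thesis unfolding has_field_derivative_def by (simp add: fun_eq_iff)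
qed

text \<open>Two applications of the mean value theorem, first along \<open>v\<close> and then along
  \<open>w\<close>, write the quotient as a value of the second derivative near \<open>x\<close>.
  The quotient is symmetric in \<open>v\<close> and \<open>w\<close>, so uniqueness of limits gives
  Schwarz's theorem.\<close>

lemma second_difference_tendsto:
  fixes f :: "'a::real_normed_vector \<Rightarrow> real"
  assumes "open S" "x \<in> S" "smooth_on S f"
  shows "((\<lambda>t. (f (x + t *\<^sub>R v + t *\<^sub>R w) - f (x + t *\<^sub>R v) - f (x + t *\<^sub>R w) + f x) / t\<^sup>2)
    \<longlongrightarrow> dd (\<lambda>y. dd f y v) x w) (at_right 0)"
proof (rule tendstoI)
  fix e :: real assume e: "e > 0"
  define g where "g = (\<lambda>y. dd f y v)"
  define G where "G = (\<lambda>y. dd g y w)"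
  have sg: "smooth_on S g" unfolding g_def by (rule smooth_on_dd[OF assms(3)])
  have "continuous_on S G" unfolding G_def by (rule smooth_on_continuous[OF smooth_on_dd[OF sg]])
  then have "isCont G x" using assms continuous_on_eq_continuous_at by blast
  then obtain d1 where d1: "d1 > 0" "\<And>y. dist y x < d1 \<Longrightarrow> dist (G y) (G x) < e"
    using e unfolding continuous_at_eps_delta by metis
  obtain d2 where d2: "d2 > 0" "ball x d2 \<subseteq> S" using assms openE by blast
  \<comment> \<open>Keeps every point \<open>x + a v + b w\<close> of the small parallelogram in
    both balls; the summand 1 avoids division by zero when \<open>v\<close> and \<open>w\<close>
    vanish.\<close>
  define \<eta> where "\<eta> = min d1 d2 / (norm v + norm w + 1)"
  have pos: "norm v + norm w + 1 > 0" by (smt (verit) norm_ge_zero)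
  have \<eta>: "\<eta> > 0" using d1 d2 pos by (simp add: \<eta>_def)
  have near: "dist (x + a *\<^sub>R v + b *\<^sub>R w) x < min d1 d2"
    if "0 \<le> a" "0 \<le> b" "a < \<eta>" "b < \<eta>" for a b
  proof -
    have "dist (x + a *\<^sub>R v + b *\<^sub>R w) x = norm (a *\<^sub>R v + b *\<^sub>R w)" by (simp add: dist_norm)
    also have "\<dots> \<le> a * norm v + b * norm w"
      using norm_triangle_ineq[of "a *\<^sub>R v" "b *\<^sub>R w"] that by simp
    also have "\<dots> \<le> \<eta> * norm v + \<eta> * norm w"
      using that by (intro add_mono mult_right_mono) auto
    also have "\<dots> < \<eta> * (norm v + norm w + 1)" using \<eta> by (simp add: algebra_simps)
    also have "\<dots> = min d1 d2" using pos by (simp add: \<eta>_def)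
    finally show ?thesis .
  qed
  have inS: "x + a *\<^sub>R v + b *\<^sub>R w \<in> S" if "0 \<le> a" "0 \<le> b" "a < \<eta>" "b < \<eta>" for a b
    using near[OF that] d2(2) by (auto simp: dist_commute)
  have "dist ((f (x + t *\<^sub>R v + t *\<^sub>R w) - f (x + t *\<^sub>R v) - f (x + t *\<^sub>R w) + f x) / t\<^sup>2) (G x) < e"
    if t: "0 < t" "t < \<eta>" for t
  proof -
    define \<phi> where "\<phi> s = f ((x + t *\<^sub>R w) + s *\<^sub>R v) - f (x + s *\<^sub>R v)" for s
    have "(\<phi> has_real_derivative (g ((x + t *\<^sub>R w) + s *\<^sub>R v) - g (x + s *\<^sub>R v))) (at s)"
      if "0 \<le> s" "s \<le> t" for s
      unfolding \<phi>_def g_def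
      using inS[of s t] inS[of s 0] that t
      by (intro DERIV_diff has_real_derivative_line smooth_on_differentiable[OF assms(3)])
        (auto simp: algebra_simps)
    from MVT2[OF t(1) this] obtain \<xi> where \<xi>: "0 < \<xi>" "\<xi> < t"
      "\<phi> t - \<phi> 0 = (t - 0) * (g ((x + t *\<^sub>R w) + \<xi> *\<^sub>R v) - g (x + \<xi> *\<^sub>R v))" by auto
    have "((\<lambda>s. g (x + \<xi> *\<^sub>R v + s *\<^sub>R w)) has_real_derivative G (x + \<xi> *\<^sub>R v + s *\<^sub>R w)) (at s)"
      if "0 \<le> s" "s \<le> t" for s
      unfolding G_def using that t \<xi>
      by (intro has_real_derivative_line smooth_on_differentiable[OF sg] inS) auto
    from MVT2[OF t(1) this] obtain \<zeta> where \<zeta>: "0 < \<zeta>" "\<zeta> < t"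
      "g (x + \<xi> *\<^sub>R v + t *\<^sub>R w) - g (x + \<xi> *\<^sub>R v + 0 *\<^sub>R w) = (t - 0) * G (x + \<xi> *\<^sub>R v + \<zeta> *\<^sub>R w)"
      by auto
    have "f (x + t *\<^sub>R v + t *\<^sub>R w) - f (x + t *\<^sub>R v) - f (x + t *\<^sub>R w) + f x = \<phi> t - \<phi> 0"
      by (simp add: \<phi>_def algebra_simps)
    also have "\<dots> = t * (t * G (x + \<xi> *\<^sub>R v + \<zeta> *\<^sub>R w))"
      using \<xi>(3) \<zeta>(3) by (simp add: algebra_simps)
    finally have "(f (x + t *\<^sub>R v + t *\<^sub>R w) - f (x + t *\<^sub>R v) - f (x + t *\<^sub>R w) + f x) / t\<^sup>2 =
        G (x + \<xi> *\<^sub>R v + \<zeta> *\<^sub>R w)"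
      using t by (simp add: power2_eq_square)
    then show ?thesis using d1(2) near[of \<xi> \<zeta>] \<xi> \<zeta> t by auto
  qed
  then have "\<forall>t>0. t < \<eta> \<longrightarrow> dist ((f (x + t *\<^sub>R v + t *\<^sub>R w) - f (x + t *\<^sub>R v)
      - f (x + t *\<^sub>R w) + f x) / t\<^sup>2) (G x) < e"
    by blast
  then have "\<forall>\<^sub>F t in at_right 0. dist ((f (x + t *\<^sub>R v + t *\<^sub>R w) - f (x + t *\<^sub>R v)
      - f (x + t *\<^sub>R w) + f x) / t\<^sup>2) (G x) < e"
    unfolding eventually_at_right_field using \<eta> by (intro exI[of _ \<eta>] conjI)
  then show "\<forall>\<^sub>F t in at_right 0. dist ((f (x + t *\<^sub>R v + t *\<^sub>R w) - f (x + t *\<^sub>R v)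
      - f (x + t *\<^sub>R w) + f x) / t\<^sup>2) (dd (\<lambda>y. dd f y v) x w) < e"
    unfolding G_def g_def .
qed

lemma dd_commute_real:
  fixes f :: "'a::real_normed_vector \<Rightarrow> real"
  assumes "open S" "x \<in> S" "smooth_on S f"
  shows "dd (\<lambda>y. dd f y v) x w = dd (\<lambda>y. dd f y w) x v"
proof -
  have eq: "f (x + t *\<^sub>R w + t *\<^sub>R v) - f (x + t *\<^sub>R w) - f (x + t *\<^sub>R v) + f x =
      f (x + t *\<^sub>R v + t *\<^sub>R w) - f (x + t *\<^sub>R v) - f (x + t *\<^sub>R w) + f x" for t
    by (simp add: algebra_simps)
  show ?thesis
    by (rule tendsto_unique[OF _ second_difference_tendsto[OF assms]
          second_difference_tendsto[where v = w and w = v, OF assms, unfolded eq]]) simp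
qed

lemma dd_commute:
  fixes f :: "'a::real_normed_vector \<Rightarrow> 'b::euclidean_space"
  assumes "open S" "x \<in> S" "smooth_on S f"
  shows "dd (\<lambda>y. dd f y v) x w = dd (\<lambda>y. dd f y w) x v"
proof (rule euclidean_eqI)
  fix b :: 'b
  have inner: "dd (\<lambda>y. h y \<bullet> b) y u = dd h y u \<bullet> b" if "smooth_on S h" "y \<in> S"
    for h :: "'a \<Rightarrow> 'b" and y u
    by (rule dd_eqI, rule has_derivative_inner_left, rule smooth_on_has_derivative) (use that in auto)
  have "dd (\<lambda>y. dd f y v) x w \<bullet> b = dd (\<lambda>y. dd (\<lambda>y. f y \<bullet> b) y v) x w" for v w
    unfolding inner[OF smooth_on_dd[OF assms(3)] assms(2), symmetric]
    by (rule dd_cong[OF assms(1,2)]) (simp add: inner[OF assms(3)])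
  then show "dd (\<lambda>y. dd f y v) x w \<bullet> b = dd (\<lambda>y. dd f y w) x v \<bullet> b"
    using dd_commute_real[OF assms(1,2) smooth_on_inner_left[OF assms(1,3)]] by metis
qed

section \<open>Flat functions, smooth steps and bumps\<close>

definition flat_exp :: "nat \<Rightarrow> real \<Rightarrow> real" where
  "flat_exp n t = (if t > 0 then (1 / t) ^ n * exp (- (1 / t)) else 0)"

lemma flat_exp_tendsto: "(flat_exp n \<longlongrightarrow> 0) (at 0)"
proof -
  have "((\<lambda>t. (inverse t) ^ n / exp (inverse t)) \<longlongrightarrow> (0::real)) (at_right 0)"
    by (rule filterlim_compose[OF tendsto_power_div_exp_0 filterlim_inverse_at_top_right])
  then have "(flat_exp n \<longlongrightarrow> 0) (at_right 0)"
    by (rule Lim_transform_eventually)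
      (auto simp: eventually_at_right_field flat_exp_def exp_minus field_simps intro!: exI[of _ 1])
  moreover have "(flat_exp n \<longlongrightarrow> 0) (at_left 0)"
    by (rule Lim_transform_eventually[OF tendsto_const])
      (auto simp: eventually_at_left_field flat_exp_def intro!: exI[of _ "-1"])
  ultimately show ?thesis by (simp add: filterlim_at_split)
qed

text \<open>The exponent \<open>n\<close> is carried along so that the span of the family is closed
  under differentiation; smoothness then follows by an induction over all \<open>n\<close> at
  once.\<close>

lemma flat_exp_deriv:
  "(flat_exp n has_real_derivative (flat_exp (n + 2) t - real n * flat_exp (n + 1) t)) (at t)"
proof -
  consider "t > 0" | "t = 0" | "t < 0" by linarith
  then show ?thesis
  proof cases
    case 1
    have "((\<lambda>t. (1 / t) ^ n) has_real_derivative - (real n * (1 / t) ^ (n + 1))) (at t)"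
    proof (induction n)
      case (Suc n)
      have "((\<lambda>t. 1 / t) has_real_derivative - ((1 / t) * (1 / t))) (at t)"
        using 1 by (auto intro!: derivative_eq_intros)
      from DERIV_mult[OF this Suc] show ?case
        unfolding power_Suc by (rule DERIV_cong) (simp add: algebra_simps add_divide_distrib)
    qed simp
    moreover have "((\<lambda>t. exp (- (1 / t))) has_real_derivative exp (- (1 / t)) * ((1 / t) * (1 / t))) (at t)"
      using 1 by (auto intro!: derivative_eq_intros)
    ultimately have "((\<lambda>t. (1 / t) ^ n * exp (- (1 / t))) has_real_derivative
      (- (real n * (1 / t) ^ (n + 1)) * exp (- (1 / t)) + exp (- (1 / t)) * ((1 / t) * (1 / t)) * (1 / t) ^ n)) (at t)"
      by (rule DERIV_mult)
    then have "((\<lambda>t. (1 / t) ^ n * exp (- (1 / t))) has_real_derivative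
        (flat_exp (n + 2) t - real n * flat_exp (n + 1) t)) (at t)"
      using 1 by (simp add: flat_exp_def algebra_simps)
    then show ?thesis
      by (rule has_field_derivative_transform_within_open[of _ _ _ "{0<..}"])
        (use 1 in \<open>auto simp: flat_exp_def\<close>)
  next
    case 2
    \<comment> \<open>At 0 the difference quotient of \<open>flat_exp n\<close> is
      \<open>flat_exp (n + 1)\<close>, which tends to 0; the claimed derivative is 0 there
      too.\<close>
    have "((\<lambda>h. (flat_exp n (0 + h) - flat_exp n 0) / h) \<longlongrightarrow> 0) (at 0)"
      by (rule Lim_transform_eventually[OF flat_exp_tendsto[of "n + 1"]])
        (auto simp: flat_exp_def eventually_at_topological field_simps)
    then show ?thesis using 2 by (simp add: DERIV_def flat_exp_def)
  next
    case 3
    have "((\<lambda>t. 0) has_real_derivative (flat_exp (n + 2) t - real n * flat_exp (n + 1) t)) (at t)"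
      using 3 by (simp add: flat_exp_def)
    then show ?thesis
      by (rule has_field_derivative_transform_within_open[of _ _ _ "{..<0}"])
        (use 3 in \<open>auto simp: flat_exp_def\<close>)
  qed
qed

lemma dd_real: "(f has_real_derivative f') (at t) \<Longrightarrow> dd f t v = f' * v"
  unfolding has_field_derivative_def by (rule dd_eqI)

lemma smooth_on_flat_exp: "smooth_on UNIV (flat_exp n)"
proof -
  have "Ck_on k UNIV (flat_exp n)" for k
  proof (induction k arbitrary: n)
    case 0
    have "continuous_on UNIV (flat_exp n)"
      by (intro continuous_at_imp_continuous_on ballI DERIV_isCont[OF flat_exp_deriv])
    then show ?case by simp
  next
    case (Suc k)
    have "flat_exp n differentiable (at t)" for t
      using flat_exp_deriv[of n t] unfolding has_field_derivative_def differentiable_def by blast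
    moreover have "Ck_on k UNIV (\<lambda>t. dd (flat_exp n) t v)" for v
    proof -
      have "Ck_on k UNIV (\<lambda>t. (flat_exp (n + 2) t + (- real n) * flat_exp (n + 1) t) * v)"
        by (intro Ck_on_bilinear[OF bounded_bilinear_mult] Ck_on_add Ck_on_const Suc.IH) auto
      then show ?thesis by (simp add: dd_real[OF flat_exp_deriv])
    qed
    ultimately show ?case by simp
  qed
  then show ?thesis by (simp add: smooth_on_def)
qed

lemma smooth_on_inverse: "smooth_on {t::real. t \<noteq> 0} inverse"
proof -
  have op: "open {t::real. t \<noteq> 0}" by (rule open_Collect_neq) (auto intro: continuous_intros)
  have "Ck_on k {t::real. t \<noteq> 0} inverse" for k
  proof (induction k)
    case 0
    show ?case by (auto intro!: continuous_intros)
  next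
    case (Suc k)
    have d: "(inverse has_real_derivative - (inverse t * inverse t)) (at t)" if "t \<noteq> 0" for t :: real
      using that by (auto intro!: derivative_eq_intros simp: field_simps)
    have "Ck_on k {t::real. t \<noteq> 0} (\<lambda>t. dd inverse t v)" for v
    proof (rule Ck_on_cong[OF op])
      show "Ck_on k {t::real. t \<noteq> 0} (\<lambda>t. (inverse t * inverse t) * - v)"
        by (intro Ck_on_bilinear[OF bounded_bilinear_mult] Ck_on_const Suc.IH op)
      show "(inverse t * inverse t) * - v = dd inverse t v" if "t \<in> {t. t \<noteq> 0}" for t
        using dd_real[OF d, of t v] that by simp
    qed
    then show ?case using d unfolding has_field_derivative_def differentiable_def by auto
  qed
  then show ?thesis by (simp add: smooth_on_def)
qed

lemma smooth_step_exists:
  "\<exists>s::real \<Rightarrow> real. smooth_on UNIV s \<and> (\<forall>t\<le>1. s t = 1) \<and> (\<forall>t\<ge>2. s t = 0)"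
proof -
  \<comment> \<open>One of \<open>2 - t\<close> and \<open>t - 1\<close> is always positive, so
    \<open>d\<close> never vanishes. The step is the first summand divided by \<open>d\<close>: the
    second summand vanishes for \<open>t \<le> 1\<close> and the first for
    \<open>t \<ge> 2\<close>.\<close>
  define d where "d t = flat_exp 0 (2 - t) + flat_exp 0 (t - 1)" for t
  have nn: "flat_exp 0 t \<ge> 0" and p: "t > 0 \<Longrightarrow> flat_exp 0 t > 0" for t
    by (simp_all add: flat_exp_def)
  have d: "d t > 0" for t
    unfolding d_def using nn[of "2 - t"] nn[of "t - 1"] p[of "2 - t"] p[of "t - 1"] by linarith
  have l: "smooth_on UNIV (\<lambda>t::real. 2 - t)" "smooth_on UNIV (\<lambda>t::real. t - 1)"
    by (intro smooth_on_diff smooth_on_const smooth_on_ident open_UNIV)+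
  have m: "smooth_on UNIV (\<lambda>t. flat_exp 0 (2 - t))" "smooth_on UNIV (\<lambda>t. flat_exp 0 (t - 1))"
    using smooth_on_compose[OF smooth_on_flat_exp open_UNIV l(1)]
      smooth_on_compose[OF smooth_on_flat_exp open_UNIV l(2)] by auto
  have "smooth_on UNIV d"
    unfolding d_def by (intro smooth_on_add open_UNIV m)
  then have "smooth_on UNIV (\<lambda>t. inverse (d t))"
    by (rule smooth_on_compose[OF smooth_on_inverse open_UNIV]) (metis d less_irrefl mem_Collect_eq)
  then have "smooth_on UNIV (\<lambda>t. flat_exp 0 (2 - t) * inverse (d t))"
    by (intro smooth_on_mult open_UNIV m)
  moreover have "flat_exp 0 (2 - t) * inverse (d t) = 1" if "t \<le> 1" for t
    using that d[of t] by (auto simp: d_def flat_exp_def)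
  moreover have "flat_exp 0 (2 - t) * inverse (d t) = 0" if "t \<ge> 2" for t
    using that by (auto simp: flat_exp_def)
  ultimately show ?thesis by blast
qed

lemma bump_exists:
  fixes x0 :: "'a::euclidean_space"
  assumes "r > 0"
  shows "\<exists>\<phi>::'a \<Rightarrow> real. smooth_on UNIV \<phi> \<and> (\<forall>x\<in>ball x0 r. \<phi> x = 1) \<and> (\<forall>x. \<phi> x \<noteq> 0 \<longrightarrow> x \<in> cball x0 (2 * r))"
proof -
  obtain s :: "real \<Rightarrow> real" where s: "smooth_on UNIV s" "\<And>t. t \<le> 1 \<Longrightarrow> s t = 1" "\<And>t. t \<ge> 2 \<Longrightarrow> s t = 0"
    using smooth_step_exists by blast
  \<comment> \<open>The squared distance, unlike the distance, is smooth at the centre. Inside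
    radius \<open>r\<close> it is at most 1 after scaling, and outside radius \<open>2 * r\<close>
    it exceeds 4, beyond the end of the step at 2.\<close>
  define q where "q x = ((x - x0) \<bullet> (x - x0)) * (1 / r\<^sup>2)" for x
  have "smooth_on UNIV q"
    unfolding q_def
    by (intro smooth_on_mult smooth_on_bilinear[OF bounded_bilinear_inner] smooth_on_diff
      smooth_on_const smooth_on_ident open_UNIV)
  then have "smooth_on UNIV (\<lambda>x. s (q x))"
    by (rule smooth_on_compose[OF s(1) open_UNIV]) simp
  moreover have q: "q x = (dist x x0 / r)\<^sup>2" for x
    by (simp add: q_def dist_norm power_divide power2_norm_eq_inner)
  have "s (q x) = 1" if "x \<in> ball x0 r" for x
  proof (rule s(2))
    have "dist x x0 / r \<le> 1" using that assms by (simp add: dist_commute)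
    then show "q x \<le> 1" unfolding q using assms by (simp add: power_le_one)
  qed
  moreover have "x \<in> cball x0 (2 * r)" if "s (q x) \<noteq> 0" for x
  proof (rule ccontr)
    assume "x \<notin> cball x0 (2 * r)"
    then have "2 \<le> dist x x0 / r" using assms by (simp add: dist_commute field_simps)
    then have "2\<^sup>2 \<le> q x" unfolding q by (rule power_mono) simp
    then show False using s(3)[of "q x"] that by simp
  qed
  ultimately show ?thesis by blast
qed

section \<open>Atlases\<close>

declare split_paired_All [simp del] split_paired_Ex [simp del]

abbreviation jac :: "('p, 'e::euclidean_space) chart \<Rightarrow> ('p, 'e) chart \<Rightarrow> 'e \<Rightarrow> 'e \<Rightarrow> 'e" where
  "jac c d x \<equiv> frechet_derivative (\<lambda>y. coord d (param c y)) (at x)"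

text \<open>A tangent vector carries one component per chart, so prescribing the component in
  \<open>c\<close> means transporting it by the Jacobians to all charts around \<open>p\<close>. The
  value 0 elsewhere is the convention of \<open>tangent_space\<close>.\<close>

definition tangent_of :: "('p, 'e::euclidean_space) atlas \<Rightarrow> ('p, 'e) chart \<Rightarrow> 'p \<Rightarrow> 'e \<Rightarrow> ('p, 'e) tvec" where
  "tangent_of N c p w = (\<lambda>d. if d \<in> N \<and> p \<in> dom_of d then jac c d (coord c p) w else 0)"

lemma tangent_space_outside: "v \<in> tangent_space N p \<Longrightarrow> \<not> (c \<in> N \<and> p \<in> dom_of c) \<Longrightarrow> v c = 0"
  by (auto simp: tangent_space_def)

lemma smooth_in_chart_iff: "smooth_in_chart c f \<longleftrightarrow> smooth_on (coord c ` dom_of c) (\<lambda>x. f (param c x))"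
  by (simp add: smooth_in_chart_def o_def)

locale atlas_space =
  fixes N :: "('p, 'e::euclidean_space) atlas"
  assumes atlas: "smooth_atlas N"
begin

lemma inj_coord: "c \<in> N \<Longrightarrow> inj_on (coord c) (dom_of c)"
  using atlas by (auto simp: smooth_atlas_def)

lemma open_image: "c \<in> N \<Longrightarrow> open (coord c ` dom_of c)"
  using atlas by (auto simp: smooth_atlas_def)

lemma open_overlap: "c \<in> N \<Longrightarrow> d \<in> N \<Longrightarrow> open (coord c ` (dom_of c \<inter> dom_of d))"
  using atlas by (auto simp: smooth_atlas_def)

lemma smooth_transition:
  "c \<in> N \<Longrightarrow> d \<in> N \<Longrightarrow> smooth_on (coord c ` (dom_of c \<inter> dom_of d)) (\<lambda>x. coord d (param c x))"
  using atlas by (auto simp: smooth_atlas_def o_def)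

lemma param_coord [simp]: "c \<in> N \<Longrightarrow> p \<in> dom_of c \<Longrightarrow> param c (coord c p) = p"
  by (simp add: inj_coord)

lemma param_in: "x \<in> coord c ` A \<Longrightarrow> A \<subseteq> dom_of c \<Longrightarrow> c \<in> N \<Longrightarrow> param c x \<in> A"
  using inj_coord[of c] by (auto simp: subset_iff)

lemma coord_param: "x \<in> coord c ` dom_of c \<Longrightarrow> coord c (param c x) = x"
  by (rule f_inv_into_f)

lemma transition_has_derivative:
  assumes "c \<in> N" "d \<in> N" "p \<in> dom_of c" "p \<in> dom_of d"
  shows "((\<lambda>x. coord d (param c x)) has_derivative jac c d (coord c p)) (at (coord c p))"
  by (rule smooth_on_has_derivative[OF smooth_transition]) (use assms in auto)

lemma linear_jac: "c \<in> N \<Longrightarrow> d \<in> N \<Longrightarrow> p \<in> dom_of c \<Longrightarrow> p \<in> dom_of d \<Longrightarrow> linear (jac c d (coord c p))"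
  by (rule has_derivative_linear[OF transition_has_derivative])

lemma change_chart_has_derivative:
  assumes "c \<in> N" "d \<in> N" "p \<in> dom_of c" "p \<in> dom_of d"
    and "((\<lambda>x. f (param d x)) has_derivative f') (at (coord d p))"
  shows "((\<lambda>x. f (param c x)) has_derivative (\<lambda>v. f' (jac c d (coord c p) v))) (at (coord c p))"
proof (rule has_derivative_transform_within_open[OF _ open_overlap[OF assms(1,2)]])
  have "((\<lambda>x. f (param d x)) has_derivative f') (at (coord d (param c (coord c p))))"
    using assms by simp
  from has_derivative_compose[OF transition_has_derivative[OF assms(1-4)] this]
  show "((\<lambda>x. f (param d (coord d (param c x)))) has_derivative (\<lambda>v. f' (jac c d (coord c p) v))) (at (coord c p))" .
qed (use assms in auto)

lemma jac_jac:
  assumes "c \<in> N" "d \<in> N" "e \<in> N" "p \<in> dom_of c" "p \<in> dom_of d" "p \<in> dom_of e"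
  shows "jac d e (coord d p) (jac c d (coord c p) v) = jac c e (coord c p) v"
  using dd_eqI[OF change_chart_has_derivative[OF assms(1,2,4,5) transition_has_derivative[OF assms(2,3,5,6)]]]
  by metis

lemma jac_self:
  assumes "c \<in> N" "p \<in> dom_of c"
  shows "jac c c (coord c p) v = v"
proof -
  have "jac c c (coord c p) v = dd (\<lambda>x. x) (coord c p) v"
    by (rule dd_cong[OF open_image[OF assms(1)]]) (use assms coord_param in auto)
  then show ?thesis by simp
qed

lemma tangent_change:
  "v \<in> tangent_space N p \<Longrightarrow> c \<in> N \<Longrightarrow> d \<in> N \<Longrightarrow> p \<in> dom_of c \<Longrightarrow> p \<in> dom_of d \<Longrightarrow>
    v d = jac c d (coord c p) (v c)"
  unfolding tangent_space_def o_def by blast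

lemma tangent_spaceI:
  assumes "\<And>d. \<not> (d \<in> N \<and> p \<in> dom_of d) \<Longrightarrow> v d = 0"
    and "\<And>c d. c \<in> N \<Longrightarrow> d \<in> N \<Longrightarrow> p \<in> dom_of c \<Longrightarrow> p \<in> dom_of d \<Longrightarrow> v d = jac c d (coord c p) (v c)"
  shows "v \<in> tangent_space N p"
  using assms unfolding tangent_space_def o_def by blast

lemma tangent_of_in:
  assumes "c \<in> N" "p \<in> dom_of c"
  shows "tangent_of N c p w \<in> tangent_space N p"
  by (rule tangent_spaceI) (use assms jac_jac in \<open>auto simp: tangent_of_def\<close>)

lemma tangent_of_self [simp]: "c \<in> N \<Longrightarrow> p \<in> dom_of c \<Longrightarrow> tangent_of N c p w c = w"
  by (simp add: tangent_of_def jac_self)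

lemma tangent_eqI:
  assumes "v \<in> tangent_space N p" "w \<in> tangent_space N p" "c \<in> N" "p \<in> dom_of c" "v c = w c"
  shows "v = w"
proof
  fix d
  show "v d = w d"
  proof (cases "d \<in> N \<and> p \<in> dom_of d")
    case True
    then show ?thesis using tangent_change[of v p c d] tangent_change[of w p c d] assms by simp
  qed (use assms tangent_space_outside in metis)
qed

lemma tangent_of_eq: "v \<in> tangent_space N p \<Longrightarrow> c \<in> N \<Longrightarrow> p \<in> dom_of c \<Longrightarrow> tangent_of N c p (v c) = v"
  by (rule tangent_eqI[OF tangent_of_in]) auto

lemma tangent_scaleR_add:
  assumes "v \<in> tangent_space N p" "w \<in> tangent_space N p"
  shows "r *\<^sub>R v + s *\<^sub>R w \<in> tangent_space N p"
proof (rule tangent_spaceI)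
  fix c d assume cd: "c \<in> N" "d \<in> N" "p \<in> dom_of c" "p \<in> dom_of d"
  note l = linear_jac[OF cd]
  show "(r *\<^sub>R v + s *\<^sub>R w) d = jac c d (coord c p) ((r *\<^sub>R v + s *\<^sub>R w) c)"
    using tangent_change[OF assms(1) cd] tangent_change[OF assms(2) cd]
    by (simp add: scaleR_fun_def linear_add[OF l] linear_scale[OF l])
next
  fix d assume "\<not> (d \<in> N \<and> p \<in> dom_of d)"
  then show "(r *\<^sub>R v + s *\<^sub>R w) d = 0"
    using tangent_space_outside[OF assms(1), of d] tangent_space_outside[OF assms(2), of d]
    by (simp add: scaleR_fun_def)
qed

lemma tangent_0: "0 \<in> tangent_space N p"
  by (rule tangent_spaceI) (auto simp: linear_0[OF linear_jac])

lemma tangent_add: "v \<in> tangent_space N p \<Longrightarrow> w \<in> tangent_space N p \<Longrightarrow> v + w \<in> tangent_space N p"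
  using tangent_scaleR_add[of v p w 1 1] by simp

lemma tangent_diff: "v \<in> tangent_space N p \<Longrightarrow> w \<in> tangent_space N p \<Longrightarrow> v - w \<in> tangent_space N p"
  using tangent_scaleR_add[of v p w 1 "-1"] by simp

lemma tangent_minus: "v \<in> tangent_space N p \<Longrightarrow> - v \<in> tangent_space N p"
  using tangent_scaleR_add[of v p v "-1" 0] by simp

lemma tangent_scaleR: "v \<in> tangent_space N p \<Longrightarrow> r *\<^sub>R v \<in> tangent_space N p"
  using tangent_scaleR_add[of v p v r 0] by simp

section \<open>Directional derivatives and Lie brackets in a chart\<close>

lemma dir_deriv_eq:
  assumes "c \<in> N" "p \<in> dom_of c" "(\<lambda>x. f (param c x)) differentiable (at (coord c p))"
    and "a \<in> tangent_space N p"
  shows "dir_deriv N f p a = dd (\<lambda>x. f (param c x)) (coord c p) (a c)"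
proof -
  define d where "d = (SOME c. c \<in> N \<and> p \<in> dom_of c)"
  have d: "d \<in> N" "p \<in> dom_of d"
    using someI[of "\<lambda>c. c \<in> N \<and> p \<in> dom_of c" c] assms by (auto simp: d_def)
  \<comment> \<open>The chart \<open>d\<close> chosen inside \<open>dir_deriv\<close> is unknown;
    the chain rule together with the transformation law of \<open>a\<close> replaces it by
    \<open>c\<close>.\<close>
  have "dd (\<lambda>x. f (param d x)) (coord d p) (a d) = dd (\<lambda>x. f (param c x)) (coord c p) (jac d c (coord d p) (a d))"
    by (rule dd_eqI, rule change_chart_has_derivative[OF d(1) assms(1) d(2) assms(2)])
      (rule has_derivative_dd[OF assms(3)])
  also have "jac d c (coord d p) (a d) = a c"
    using tangent_change[OF assms(4) d(1) assms(1) d(2) assms(2)] by simp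
  finally show ?thesis
    by (simp add: dir_deriv_def chart_deriv_def o_def flip: d_def)
qed

lemma smooth_in_chart_differentiable:
  "smooth_in_chart c f \<Longrightarrow> p \<in> dom_of c \<Longrightarrow> (\<lambda>x. f (param c x)) differentiable (at (coord c p))"
  unfolding smooth_in_chart_iff by (rule smooth_on_differentiable) auto

lemma dir_deriv_smooth:
  assumes "c \<in> N" "p \<in> dom_of c" "smooth_in_chart c f" "a \<in> tangent_space N p"
  shows "dir_deriv N f p a = dd (\<lambda>x. f (param c x)) (coord c p) (a c)"
  by (rule dir_deriv_eq[OF assms(1,2) smooth_in_chart_differentiable assms(4)]) (use assms in auto)

lemma vector_field_smooth:
  "vector_field N A \<Longrightarrow> c \<in> N \<Longrightarrow> smooth_on (coord c ` dom_of c) (\<lambda>x. A (param c x) c)"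
  by (simp add: vector_field_def smooth_in_chart_iff)

lemma vector_field_tangent: "vector_field N A \<Longrightarrow> c \<in> N \<Longrightarrow> p \<in> dom_of c \<Longrightarrow> A p \<in> tangent_space N p"
  by (auto simp: vector_field_def points_def)

lemma lie_bracket_chart:
  "c \<in> N \<Longrightarrow> p \<in> dom_of c \<Longrightarrow> lie_bracket N A B p c =
    dd (\<lambda>x. B (param c x) c) (coord c p) (A p c) - dd (\<lambda>x. A (param c x) c) (coord c p) (B p c)"
  by (simp add: lie_bracket_def chart_deriv_def o_def)

text \<open>The transformation law of \<open>A\<close> differentiated once. The first term on the
  right contains second derivatives of the transition map and is the obstruction to
  tensoriality.\<close>

lemma vector_field_change_deriv:
  assumes A: "vector_field N A" and cd: "c \<in> N" "d \<in> N" "p \<in> dom_of c" "p \<in> dom_of d"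
  shows "dd (\<lambda>x. A (param d x) d) (coord d p) (jac c d (coord c p) v) =
    dd (\<lambda>x. jac c d x (A p c)) (coord c p) v + jac c d (coord c p) (dd (\<lambda>x. A (param c x) c) (coord c p) v)"
proof -
  let ?O = "coord c ` (dom_of c \<inter> dom_of d)"
  have O: "open ?O" "coord c p \<in> ?O" using open_overlap cd by auto
  have dA: "(\<lambda>x. A (param c x) c) differentiable (at (coord c p))" if "c \<in> N" "p \<in> dom_of c" for c
    using smooth_on_differentiable[OF vector_field_smooth[OF A that(1)]] that by auto
  have "dd (\<lambda>x. A (param c x) d) (coord c p) v =
      dd (\<lambda>x. A (param d x) d) (coord d p) (jac c d (coord c p) v)"
    by (rule dd_eqI, rule change_chart_has_derivative[OF cd])
      (rule has_derivative_dd[OF dA[OF cd(2,4)]])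
  moreover have "dd (\<lambda>x. A (param c x) d) (coord c p) v = dd (\<lambda>x. jac c d x (A (param c x) c)) (coord c p) v"
  proof (rule dd_cong[OF O])
    fix y assume "y \<in> ?O"
    then obtain q where q: "q \<in> dom_of c" "q \<in> dom_of d" "y = coord c q" by auto
    show "A (param c y) d = jac c d y (A (param c y) c)"
      using tangent_change[OF vector_field_tangent[OF A cd(1) q(1)] cd(1,2) q(1,2)] q cd by simp
  qed
  moreover have "\<dots> = dd (\<lambda>x. jac c d x (A p c)) (coord c p) v + jac c d (coord c p) (dd (\<lambda>x. A (param c x) c) (coord c p) v)"
    using dd_family[OF O, of "jac c d" "\<lambda>x. A (param c x) c" v] smooth_on_linear_dd[OF smooth_transition[OF cd(1,2)]]
      smooth_on_dd[OF smooth_transition[OF cd(1,2)]] dA[OF cd(1,3)] cd by simp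
  ultimately show ?thesis by metis
qed

lemma lie_bracket_tangent:
  assumes A: "vector_field N A" and B: "vector_field N B" and p: "p \<in> points N"
  shows "lie_bracket N A B p \<in> tangent_space N p"
proof (rule tangent_spaceI)
  fix c d assume cd: "c \<in> N" "d \<in> N" "p \<in> dom_of c" "p \<in> dom_of d"
  note l = linear_jac[OF cd]
  \<comment> \<open>The second derivatives of the transition map are symmetric, so the non-tensorial
    terms of the two halves of the bracket cancel.\<close>
  have "dd (\<lambda>x. jac c d x (B p c)) (coord c p) (A p c) = dd (\<lambda>x. jac c d x (A p c)) (coord c p) (B p c)"
    by (rule dd_commute[OF open_overlap[OF cd(1,2)] _ smooth_transition[OF cd(1,2)]]) (use cd in auto)
  then show "lie_bracket N A B p d = jac c d (coord c p) (lie_bracket N A B p c)"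
    using vector_field_change_deriv[OF A cd, of "B p c"] vector_field_change_deriv[OF B cd, of "A p c"]
      tangent_change[OF vector_field_tangent[OF A cd(1,3)] cd] tangent_change[OF vector_field_tangent[OF B cd(1,3)] cd]
    by (simp add: lie_bracket_chart cd linear_diff[OF l])
next
  fix d assume "\<not> (d \<in> N \<and> p \<in> dom_of d)"
  then show "lie_bracket N A B p d = 0" unfolding lie_bracket_def by argo
qed

lemma lie_bracket_vector_field:
  assumes A: "vector_field N A" and B: "vector_field N B"
  shows "vector_field N (lie_bracket N A B)"
  unfolding vector_field_def smooth_in_chart_iff
proof (intro conjI ballI lie_bracket_tangent[OF A B])
  fix c assume c: "c \<in> N"
  note O = open_image[OF c] note a = vector_field_smooth[OF A c] note b = vector_field_smooth[OF B c]
  show "smooth_on (coord c ` dom_of c) (\<lambda>x. lie_bracket N A B (param c x) c)"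
  proof (rule smooth_on_cong[OF O])
    show "smooth_on (coord c ` dom_of c) (\<lambda>x. dd (\<lambda>x. B (param c x) c) x (A (param c x) c)
        - dd (\<lambda>x. A (param c x) c) x (B (param c x) c))"
      by (intro smooth_on_diff smooth_on_dd_moving O a b)
  qed (use c in \<open>auto simp: lie_bracket_chart\<close>)
qed

section \<open>Cutoff functions and extension by zero\<close>

definition cutoff :: "('p, 'e) chart \<Rightarrow> ('p \<Rightarrow> real) \<Rightarrow> bool" where
  "cutoff c f \<longleftrightarrow> smooth_fun N f \<and> (\<exists>Z. (\<forall>d\<in>N. open (coord d ` (dom_of d \<inter> Z))) \<and>
     (\<forall>q\<in>Z. f q = 0) \<and> points N \<subseteq> Z \<union> dom_of c)"

text \<open>A cutoff vanishes on an open \<open>Z\<close> that covers the manifold together with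
  \<open>dom_of c\<close>. The extended function is smooth on each of the two open sets, which
  vanishing merely outside \<open>dom_of c\<close> would not ensure.\<close>

lemma cutoff_extension_smooth:
  assumes f: "cutoff c f" and c: "c \<in> N" "d \<in> N"
    and h: "smooth_on (coord d ` (dom_of d \<inter> dom_of c)) (\<lambda>x. h (param d x))"
  shows "smooth_in_chart d (\<lambda>q. if q \<in> dom_of c then f q *\<^sub>R h q else (0::'b::real_normed_vector))"
proof -
  obtain Z where Z: "open (coord d ` (dom_of d \<inter> Z))" "\<And>q. q \<in> Z \<Longrightarrow> f q = 0" "points N \<subseteq> Z \<union> dom_of c"
    using f c(2) unfolding cutoff_def by blast
  have "smooth_on (coord d ` dom_of d) (\<lambda>x. f (param d x))"
    using f c by (auto simp: cutoff_def smooth_fun_def smooth_in_chart_iff)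
  then have fs: "smooth_on (coord d ` (dom_of d \<inter> dom_of c)) (\<lambda>x. f (param d x))"
    by (rule smooth_on_subset) auto
  have "coord d ` dom_of d \<subseteq> coord d ` (dom_of d \<inter> dom_of c) \<union> coord d ` (dom_of d \<inter> Z)"
    using Z(3) c(2) by (auto simp: points_def)
  moreover have "smooth_on (coord d ` (dom_of d \<inter> dom_of c))
      (\<lambda>x. if param d x \<in> dom_of c then f (param d x) *\<^sub>R h (param d x) else 0)"
  proof (rule smooth_on_cong[OF open_overlap[OF c(2,1)]])
    show "smooth_on (coord d ` (dom_of d \<inter> dom_of c)) (\<lambda>x. f (param d x) *\<^sub>R h (param d x))"
      by (rule smooth_on_scaleR[OF open_overlap[OF c(2,1)] fs h])
    fix x assume "x \<in> coord d ` (dom_of d \<inter> dom_of c)"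
    then have "param d x \<in> dom_of c" using c by auto
    then show "f (param d x) *\<^sub>R h (param d x) =
        (if param d x \<in> dom_of c then f (param d x) *\<^sub>R h (param d x) else 0)" by simp
  qed
  moreover have "smooth_on (coord d ` (dom_of d \<inter> Z))
      (\<lambda>x. if param d x \<in> dom_of c then f (param d x) *\<^sub>R h (param d x) else 0)"
    by (rule smooth_on_cong[where f = "\<lambda>_. 0", OF Z(1)]) (use c Z(2) in auto)
  ultimately show ?thesis
    unfolding smooth_in_chart_iff
    by (rule smooth_on_cover[OF open_overlap[OF c(2,1)] Z(1)])
qed

lemma cutoff_vector_field:
  assumes f: "cutoff c f" and c: "c \<in> N" and h: "smooth_on (coord c ` dom_of c) h"
  shows "vector_field N (\<lambda>p. if p \<in> dom_of c then f p *\<^sub>R tangent_of N c p (h (coord c p)) else 0)"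
    (is "vector_field N ?A")
  unfolding vector_field_def
proof (intro conjI ballI)
  fix p assume "p \<in> points N"
  show "?A p \<in> tangent_space N p"
    using c tangent_scaleR tangent_of_in tangent_0 by simp
next
  fix d assume d: "d \<in> N"
  let ?h = "\<lambda>p. tangent_of N c p (h (coord c p)) d"
  have h': "smooth_on (coord c ` (dom_of c \<inter> dom_of d)) h"
    by (rule smooth_on_subset[OF h]) auto
  have "smooth_on (coord c ` (dom_of c \<inter> dom_of d)) (\<lambda>x. jac c d x (h x))"
    by (rule smooth_on_dd_moving[OF open_overlap[OF c d] smooth_transition[OF c d] h'])
  then have "smooth_on (coord d ` (dom_of d \<inter> dom_of c)) (\<lambda>x. jac c d (coord c (param d x)) (h (coord c (param d x))))"
    by (rule smooth_on_compose[where g = "\<lambda>x. jac c d x (h x)", OF _ open_overlap[OF d c] smooth_transition[OF d c]])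
      (use c d in auto)
  then have "smooth_on (coord d ` (dom_of d \<inter> dom_of c)) (\<lambda>x. ?h (param d x))"
    by (rule smooth_on_cong[OF open_overlap[OF d c], rotated]) (use c d in \<open>auto simp: tangent_of_def\<close>)
  from cutoff_extension_smooth[OF f c d, of ?h, OF this]
  have "smooth_in_chart d (\<lambda>q. if q \<in> dom_of c then f q *\<^sub>R ?h q else 0)" .
  moreover have "(\<lambda>p. ?A p d) = (\<lambda>q. if q \<in> dom_of c then f q *\<^sub>R ?h q else 0)"
    by (auto simp: scaleR_fun_def)
  ultimately show "smooth_in_chart d (\<lambda>p. ?A p d)" by simp
qed

lemma cutoff_smooth_fun:
  assumes f: "cutoff c f" and c: "c \<in> N" and h: "smooth_on (coord c ` dom_of c) h"
  shows "smooth_fun N (\<lambda>p. if p \<in> dom_of c then f p * h (coord c p) else 0)"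
  unfolding smooth_fun_def
proof
  fix d assume d: "d \<in> N"
  have h': "smooth_on (coord c ` (dom_of c \<inter> dom_of d)) h"
    by (rule smooth_on_subset[OF h]) auto
  then have "smooth_on (coord d ` (dom_of d \<inter> dom_of c)) (\<lambda>x. h (coord c (param d x)))"
    by (rule smooth_on_compose[OF _ open_overlap[OF d c] smooth_transition[OF d c]]) (use c d in auto)
  from cutoff_extension_smooth[OF f c d, of "\<lambda>p. h (coord c p)", OF this]
  show "smooth_in_chart d (\<lambda>p. if p \<in> dom_of c then f p * h (coord c p) else 0)"
    unfolding real_scaleR_def .
qed

end

text \<open>The bump lives in the image \<open>K\<close> of a closed ball under the inverse chart.
  \<open>K\<close> is compact, hence closed by the Hausdorff property, so its complement serves as
  the open set on which the cutoff vanishes.\<close>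

lemma (in atlas_space) cutoff_exists:
  assumes H: "Hausdorff_space (manifold_topology N)" and c: "c \<in> N" and p: "p \<in> W" "W \<subseteq> dom_of c"
    and W: "open (coord c ` W)"
  shows "\<exists>f V. cutoff c f \<and> p \<in> V \<and> V \<subseteq> W \<and> open (coord c ` V) \<and> (\<forall>q\<in>V. f q = 1) \<and>
    (\<forall>q. f q \<noteq> 0 \<longrightarrow> q \<in> W)"
proof -
  let ?X = "manifold_topology N"
  have tX: "topspace ?X = points N"
  proof -
    have "openin ?X (points N)"
      unfolding openin_manifold_topology[OF atlas] using open_image
      by (simp add: points_def Int_absorb2 UN_upper)
    then show ?thesis
      using openin_manifold_topology[OF atlas, of "topspace ?X"] openin_subset[of ?X "points N"]
      by auto
  qed
  obtain r where r: "r > 0" "ball (coord c p) r \<subseteq> coord c ` W"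
    using W p openE by blast
  define x0 where "x0 = coord c p"
  \<comment> \<open>Radius \<open>r/3\<close> gives the value 1 near \<open>x0\<close> and a support
    of radius \<open>2 * (r/3)\<close>, still strictly inside the ball of radius
    \<open>r\<close>.\<close>
  obtain \<phi> :: "'e \<Rightarrow> real" where \<phi>: "smooth_on UNIV \<phi>" "\<And>x. x \<in> ball x0 (r/3) \<Longrightarrow> \<phi> x = 1"
    "\<And>x. \<phi> x \<noteq> 0 \<Longrightarrow> x \<in> cball x0 (2 * (r/3))"
    using bump_exists[of "r/3" x0] r by auto
  let ?B = "cball x0 (2 * (r/3))"
  have B: "?B \<subseteq> coord c ` W" using r by (auto simp: x0_def subset_iff)
  define K where "K = param c ` ?B"
  have BU: "?B \<subseteq> coord c ` dom_of c" using B p(2) by auto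
  have "continuous_map (top_of_set (coord c ` dom_of c)) ?X (param c)"
    unfolding continuous_map_def
  proof (intro conjI ballI allI impI)
    show "param c \<in> topspace (top_of_set (coord c ` dom_of c)) \<rightarrow> topspace ?X"
      using c tX by (auto simp: points_def)
    fix U assume "openin ?X U"
    then have U: "open (coord c ` (dom_of c \<inter> U))" using c openin_manifold_topology[OF atlas] by blast
    have "{x \<in> topspace (top_of_set (coord c ` dom_of c)). param c x \<in> U} = coord c ` (dom_of c \<inter> U)"
      using c by auto
    then show "openin (top_of_set (coord c ` dom_of c)) {x \<in> topspace (top_of_set (coord c ` dom_of c)). param c x \<in> U}"
      using U by (auto intro: open_subset)
  qed
  then have "compactin ?X K"
    unfolding K_def by (rule image_compactin[rotated]) (use BU in \<open>simp add: compactin_subtopology\<close>)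
  then have "closedin ?X K" by (rule compactin_imp_closedin[OF H])
  then have "openin ?X (points N - K)" using tX by (metis closedin_def)
  then have Z: "open (coord d ` (dom_of d \<inter> (points N - K)))" if "d \<in> N" for d
    using openin_manifold_topology[OF atlas] that by blast
  define f where "f q = (if q \<in> dom_of c then \<phi> (coord c q) else 0)" for q
  have KW: "K \<subseteq> W"
  proof
    fix q assume "q \<in> K"
    then obtain x where "x \<in> coord c ` W" "q = param c x" using B unfolding K_def by blast
    then show "q \<in> W" using param_in[OF _ p(2) c] by blast
  qed
  have fK: "q \<in> K" if "f q \<noteq> 0" for q
  proof -
    have "q \<in> dom_of c" "coord c q \<in> ?B" using that \<phi>(3) by (auto simp: f_def split: if_splits)
    then show ?thesis unfolding K_def using c by (metis image_eqI param_coord)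
  qed
  have "smooth_in_chart d f" if d: "d \<in> N" for d
  proof -
    let ?A = "coord d ` (dom_of d \<inter> dom_of c)" let ?Z = "coord d ` (dom_of d \<inter> (points N - K))"
    have "dom_of d \<subseteq> (dom_of d \<inter> dom_of c) \<union> (dom_of d \<inter> (points N - K))"
      using d KW p(2) by (auto simp: points_def)
    then have cov: "coord d ` dom_of d \<subseteq> ?A \<union> ?Z" by (metis image_Un image_mono)
    have "smooth_on ?A (\<lambda>x. \<phi> (coord c (param d x)))"
      by (rule smooth_on_compose[OF \<phi>(1) open_overlap[OF d c] smooth_transition[OF d c]]) simp
    then have "smooth_on ?A (\<lambda>x. f (param d x))"
      by (rule smooth_on_cong[OF open_overlap[OF d c], rotated]) (use d in \<open>auto simp: f_def\<close>)
    moreover have "smooth_on ?Z (\<lambda>x. f (param d x))"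
    proof (rule smooth_on_cong[where f = "\<lambda>_. 0", OF Z[OF d]])
      fix x assume "x \<in> ?Z"
      then have "param d x \<notin> K" using d by auto
      then show "0 = f (param d x)" using fK by metis
    qed simp
    ultimately show ?thesis
      unfolding smooth_in_chart_iff
      by (rule smooth_on_cover[OF open_overlap[OF d c] Z[OF d] cov])
  qed
  then have cut: "cutoff c f"
    unfolding cutoff_def smooth_fun_def
  proof (intro conjI ballI exI[of _ "points N - K"])
    show "f q = 0" if "q \<in> points N - K" for q using fK[of q] that by auto
    show "points N \<subseteq> points N - K \<union> dom_of c" using KW p(2) by auto
  qed (use Z in auto)

  have bU: "ball x0 (r/3) \<subseteq> coord c ` dom_of c" and bB: "ball x0 (r/3) \<subseteq> ?B"
    using BU r by (auto simp: subset_iff)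
  let ?V = "param c ` ball x0 (r/3)"
  have 1: "p \<in> ?V"
  proof (rule image_eqI)
    show "p = param c x0" using p c by (auto simp: x0_def)
    show "x0 \<in> ball x0 (r/3)" using r by simp
  qed
  have 2: "?V \<subseteq> W"
    using KW image_mono[OF bB, of "param c"] unfolding K_def by (rule subset_trans[rotated])
  have 3: "coord c ` ?V = ball x0 (r/3)"
  proof -
    have "coord c (param c x) = x" if "x \<in> ball x0 (r/3)" for x
      by (rule coord_param[OF subsetD[OF bU that]])
    then have "(\<lambda>x. coord c (param c x)) ` ball x0 (r/3) = (\<lambda>x. x) ` ball x0 (r/3)"
      by (intro image_cong refl)
    then show ?thesis unfolding image_image by simp
  qed
  have 4: "f q = 1" if q: "q \<in> ?V" for q
  proof -
    obtain x where x: "x \<in> ball x0 (r/3)" "q = param c x" using q by blast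
    then have "x \<in> coord c ` dom_of c" using bU by blast
    then show ?thesis using \<phi>(2)[OF x(1)] coord_param[of x c] x(2) by (simp add: f_def inv_into_into)
  qed
  have 5: "q \<in> W" if "f q \<noteq> 0" for q using fK[OF that] KW by blast
  show ?thesis
  proof (intro exI conjI ballI allI impI)
    show "cutoff c f" by (rule cut)
    show "p \<in> ?V" by (rule 1)
    show "?V \<subseteq> W" by (rule 2)
    show "open (coord c ` ?V)" unfolding 3 by (rule open_ball)
  qed (fact 4 5)+
qed

section \<open>The slit tangent bundle\<close>

locale manifold_space =
  fixes M :: "('m, 'e::euclidean_space) atlas"
  assumes manifold: "smooth_manifold M"

sublocale manifold_space \<subseteq> base: atlas_space M
  by unfold_locales (use manifold in \<open>simp add: smooth_manifold_def\<close>)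

context manifold_space
begin

abbreviation lift :: "('m, 'e) chart \<Rightarrow> (('m, 'e) tpoint, 'e \<times> 'e) chart" where
  "lift c \<equiv> slit_chart M c"

lemma lift_dom: "u \<in> dom_of (lift c) \<longleftrightarrow> u \<in> slit_bundle M \<and> fst u \<in> dom_of c"
  by (cases u) (simp add: slit_chart_def)

lemma lift_dom_subset: "u \<in> dom_of (lift c) \<Longrightarrow> fst u \<in> dom_of c" "u \<in> dom_of (lift c) \<Longrightarrow> u \<in> slit_bundle M"
  by (simp_all add: lift_dom)

lemma lift_coord: "coord (lift c) u = (coord c (fst u), snd u c)"
  by (cases u) (simp add: slit_chart_def)

lemma slit_bundleD:
  "u \<in> slit_bundle M \<Longrightarrow> snd u \<in> tangent_space M (fst u)"
  "u \<in> slit_bundle M \<Longrightarrow> fst u \<in> points M"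
  "u \<in> slit_bundle M \<Longrightarrow> snd u \<noteq> 0"
  by (cases u; simp add: slit_bundle_def tangent_bundle_def)+

lemma slit_bundleI:
  "p \<in> points M \<Longrightarrow> v \<in> tangent_space M p \<Longrightarrow> v \<noteq> 0 \<Longrightarrow> (p, v) \<in> slit_bundle M"
  by (simp add: slit_bundle_def tangent_bundle_def)

lemma slit_bundle_chart: "u \<in> slit_bundle M \<Longrightarrow> \<exists>c\<in>M. u \<in> dom_of (lift c)"
  using slit_bundleD(2) by (auto simp: lift_dom points_def)

lemma in_points: "c \<in> M \<Longrightarrow> p \<in> dom_of c \<Longrightarrow> p \<in> points M"
  by (auto simp: points_def)

lemma lift_point:
  assumes c: "c \<in> M" and x: "x \<in> coord c ` dom_of c" and y: "y \<noteq> 0"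
  defines "u \<equiv> (param c x, tangent_of M c (param c x) y)"
  shows "u \<in> dom_of (lift c)" "coord (lift c) u = (x, y)"
proof -
  have p: "param c x \<in> dom_of c" by (rule base.param_in[OF x _ c]) simp
  have ne: "tangent_of M c (param c x) y \<noteq> 0"
  proof
    assume "tangent_of M c (param c x) y = 0"
    then have "tangent_of M c (param c x) y c = 0" by simp
    then show False using base.tangent_of_self[OF c p, of y] y by simp
  qed
  have "u \<in> slit_bundle M"
    unfolding u_def by (rule slit_bundleI[OF in_points[OF c p] base.tangent_of_in[OF c p] ne])
  then show "u \<in> dom_of (lift c)" using p by (simp add: lift_dom u_def)
  show "coord (lift c) u = (x, y)"
    using base.coord_param[OF x] base.tangent_of_self[OF c p] by (simp add: lift_coord u_def)
qed

lemma snd_component_nonzero: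
  assumes "c \<in> M" "u \<in> dom_of (lift c)"
  shows "snd u c \<noteq> 0"
proof
  assume "snd u c = 0"
  then have "snd u = 0"
    using assms slit_bundleD(1) by (intro base.tangent_eqI[OF _ base.tangent_0]) (auto simp: lift_dom)
  then show False using assms(2) slit_bundleD(3) by (simp add: lift_dom)
qed

text \<open>A nonzero tangent vector has a nonzero component in every chart around its base point,
  so removing the zero section amounts to removing \<open>y = 0\<close>. Regions of the slit bundle
  become products, and their openness is inherited from the base.\<close>

lemma lift_image:
  assumes c: "c \<in> M" and A: "A \<subseteq> dom_of c"
  shows "coord (lift c) ` {u \<in> slit_bundle M. fst u \<in> A} = coord c ` A \<times> (- {0::'e})"
proof (intro set_eqI iffI)
  fix z assume "z \<in> coord (lift c) ` {u \<in> slit_bundle M. fst u \<in> A}"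
  then obtain u where u: "u \<in> slit_bundle M" "fst u \<in> A" "z = coord (lift c) u" by auto
  then have "u \<in> dom_of (lift c)" using A by (auto simp: lift_dom)
  then show "z \<in> coord c ` A \<times> (- {0::'e})"
    using u snd_component_nonzero[OF c] by (simp add: lift_coord)
next
  fix z assume "z \<in> coord c ` A \<times> (- {0::'e})"
  then obtain x y where z: "z = (x, y)" "x \<in> coord c ` A" "y \<noteq> 0" by auto
  then have x: "x \<in> coord c ` dom_of c" using A by auto
  have "param c x \<in> A" by (rule base.param_in[OF z(2) A c])
  then show "z \<in> coord (lift c) ` {u \<in> slit_bundle M. fst u \<in> A}"
    using lift_point[OF c x z(3)] z(1)
    by (intro image_eqI[of _ _ "(param c x, tangent_of M c (param c x) y)"]) (auto simp: lift_dom)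
qed

definition region :: "('m, 'e) chart \<Rightarrow> ('e \<times> 'e) set" where
  "region c = coord c ` dom_of c \<times> (- {0::'e})"

lemma lift_dom_eq: "dom_of (lift c) = {u \<in> slit_bundle M. fst u \<in> dom_of c}"
  by (auto simp: lift_dom)

lemma lift_dom_Int: "dom_of (lift c) \<inter> dom_of (lift d) = {u \<in> slit_bundle M. fst u \<in> dom_of c \<inter> dom_of d}"
  by (auto simp: lift_dom)

lemma lift_region: "c \<in> M \<Longrightarrow> coord (lift c) ` dom_of (lift c) = region c"
  unfolding region_def lift_dom_eq by (rule lift_image) auto

lemma lift_overlap:
  "c \<in> M \<Longrightarrow> coord (lift c) ` (dom_of (lift c) \<inter> dom_of (lift d)) = coord c ` (dom_of c \<inter> dom_of d) \<times> (- {0::'e})"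
  unfolding lift_dom_Int by (rule lift_image) auto

lemma open_region: "c \<in> M \<Longrightarrow> open (region c)"
  unfolding region_def by (intro open_Times base.open_image) auto

lemma regionI: "c \<in> M \<Longrightarrow> u \<in> dom_of (lift c) \<Longrightarrow> coord (lift c) u \<in> region c"
  using lift_region by blast

lemma lift_inj: "c \<in> M \<Longrightarrow> inj_on (coord (lift c)) (dom_of (lift c))"
proof (rule inj_onI)
  fix u w assume c: "c \<in> M" and u: "u \<in> dom_of (lift c)" and w: "w \<in> dom_of (lift c)"
    and eq: "coord (lift c) u = coord (lift c) w"
  have "fst u = fst w"
    using eq u w base.inj_coord[OF c] by (auto simp: lift_coord lift_dom inj_on_def)
  moreover have "snd u = snd w"
    using eq u w slit_bundleD(1)[of u] slit_bundleD(1)[of w] calculation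
    by (intro base.tangent_eqI[of _ "fst u" _ c]) (auto simp: lift_coord lift_dom c)
  ultimately show "u = w" by (simp add: prod_eq_iff)
qed

lemma lift_param:
  assumes "c \<in> M" "x \<in> coord c ` dom_of c" "y \<noteq> 0"
  shows "param (lift c) (x, y) = (param c x, tangent_of M c (param c x) y)"
  using lift_point[OF assms] lift_inj[OF assms(1)] by (metis inv_into_f_f)

lemma lift_transition:
  assumes "c \<in> M" "d \<in> M" "z \<in> coord c ` (dom_of c \<inter> dom_of d) \<times> (- {0::'e})"
  shows "coord (lift d) (param (lift c) z) = (coord d (param c (fst z)), jac c d (fst z) (snd z))"
proof -
  obtain x y where z: "z = (x, y)" "x \<in> coord c ` (dom_of c \<inter> dom_of d)" "y \<noteq> 0" using assms(3) by auto
  then have x: "x \<in> coord c ` dom_of c" by auto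
  have p: "param c x \<in> dom_of c \<inter> dom_of d" by (rule base.param_in[OF z(2) _ assms(1)]) auto
  show ?thesis
    using lift_param[OF assms(1) x z(3)] base.coord_param[OF x] p assms(1,2)
    by (simp add: z(1) lift_coord tangent_of_def)
qed

lemma smooth_jac:
  assumes c: "c \<in> M" and d: "d \<in> M"
  shows "smooth_on (coord c ` (dom_of c \<inter> dom_of d) \<times> (- {0::'e})) (\<lambda>z. jac c d (fst z) a)"
proof (rule smooth_on_compose[where f = fst and g = "\<lambda>x. jac c d x a"])
  show "smooth_on (coord c ` (dom_of c \<inter> dom_of d)) (\<lambda>x. jac c d x a)"
    by (rule smooth_on_dd[OF base.smooth_transition[OF c d]])
  show O: "open (coord c ` (dom_of c \<inter> dom_of d) \<times> (- {0::'e}))"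
    using base.open_overlap[OF c d] by (intro open_Times) auto
  show "smooth_on (coord c ` (dom_of c \<inter> dom_of d) \<times> (- {0::'e})) fst"
    by (rule smooth_on_linear[OF bounded_linear_fst O])
qed auto

lemma linear_jac_fst:
  assumes "c \<in> M" "d \<in> M" "z \<in> coord c ` (dom_of c \<inter> dom_of d) \<times> (- {0::'e})"
  shows "linear (jac c d (fst z))"
  using assms(3) base.linear_jac[OF assms(1,2)] by auto

lemma open_lift_overlap:
  "c \<in> M \<Longrightarrow> d \<in> M \<Longrightarrow> open (coord c ` (dom_of c \<inter> dom_of d) \<times> (- {0::'e}))"
  using base.open_overlap by (intro open_Times) auto

lemma smooth_lift_transition:
  assumes c: "c \<in> M" and d: "d \<in> M"
  shows "smooth_on (coord c ` (dom_of c \<inter> dom_of d) \<times> (- {0::'e})) (\<lambda>z. coord (lift d) (param (lift c) z))"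
proof (rule smooth_on_cong[OF open_lift_overlap[OF c d]])
  let ?S = "coord c ` (dom_of c \<inter> dom_of d) \<times> (- {0::'e})"
  note O = open_lift_overlap[OF c d]
  have 1: "smooth_on ?S (\<lambda>z. coord d (param c (fst z)))"
    by (rule smooth_on_compose[OF base.smooth_transition[OF c d] O smooth_on_linear[OF bounded_linear_fst O]]) auto
  have 2: "smooth_on ?S (\<lambda>z. jac c d (fst z) (snd z))"
    by (rule smooth_on_family[OF O linear_jac_fst[OF c d] smooth_jac[OF c d] smooth_on_linear[OF bounded_linear_snd O]])
  show "smooth_on ?S (\<lambda>z. (coord d (param c (fst z)), jac c d (fst z) (snd z)))"
    by (rule smooth_on_Pair[OF O 1 2])
qed (simp only: lift_transition[OF c d])

lemma slit_atlas_smooth: "smooth_atlas (slit_atlas M)"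
  unfolding smooth_atlas_def slit_atlas_def ball_simps o_def
  using lift_inj open_region lift_region lift_overlap open_lift_overlap smooth_lift_transition by auto

end

sublocale manifold_space \<subseteq> slit: atlas_space "slit_atlas M"
  by unfold_locales (rule slit_atlas_smooth)

section \<open>Projection, vertical lift and \<open>\<pi>\<close>-vector fields in
  coordinates\<close>

context manifold_space
begin

lemma lift_in: "c \<in> M \<Longrightarrow> lift c \<in> slit_atlas M"
  by (simp add: slit_atlas_def)

lemma points_slit: "points (slit_atlas M) = slit_bundle M"
proof
  show "points (slit_atlas M) \<subseteq> slit_bundle M"
    by (auto simp: points_def slit_atlas_def lift_dom)
  show "slit_bundle M \<subseteq> points (slit_atlas M)"
  proof
    fix u assume "u \<in> slit_bundle M"
    then obtain c where "c \<in> M" "u \<in> dom_of (lift c)" using slit_bundle_chart[of u] by blast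
    then show "u \<in> points (slit_atlas M)" using lift_in unfolding points_def by (intro UN_I)
  qed
qed

lemma region_point:
  assumes "c \<in> M" "z \<in> region c"
  shows "param (lift c) z \<in> dom_of (lift c)" "coord (lift c) (param (lift c) z) = z"
    "fst (param (lift c) z) = param c (fst z)" "snd (param (lift c) z) c = snd z"
    "fst (param (lift c) z) \<in> dom_of c" "param (lift c) z \<in> slit_bundle M"
proof -
  obtain x y where z: "z = (x, y)" "x \<in> coord c ` dom_of c" "y \<noteq> 0"
    using assms(2) by (auto simp: region_def)
  have p: "param c x \<in> dom_of c" by (rule base.param_in[OF z(2) _ assms(1)]) simp
  note lp = lift_param[OF assms(1) z(2,3)] lift_point[OF assms(1) z(2,3)]
  show 1: "param (lift c) z \<in> dom_of (lift c)" "coord (lift c) (param (lift c) z) = z"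
    using lp z(1) by simp_all
  show "fst (param (lift c) z) = param c (fst z)" "snd (param (lift c) z) c = snd z"
    using lp z(1) p assms(1) by simp_all
  show "fst (param (lift c) z) \<in> dom_of c" "param (lift c) z \<in> slit_bundle M"
    using 1 by (simp_all add: lift_dom)
qed

lemma lift_param_coord: "c \<in> M \<Longrightarrow> u \<in> dom_of (lift c) \<Longrightarrow> param (lift c) (coord (lift c) u) = u"
  by (rule slit.param_coord[OF lift_in])

lemma jac_lift_fst:
  assumes c: "c \<in> M" and d: "d \<in> M" and u: "u \<in> dom_of (lift c)" "u \<in> dom_of (lift d)"
  shows "fst (jac (lift c) (lift d) (coord (lift c) u) a) = jac c d (coord c (fst u)) (fst a)"
proof -
  let ?S = "coord c ` (dom_of c \<inter> dom_of d) \<times> (- {0::'e})"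
  have z: "coord (lift c) u \<in> ?S" using u lift_overlap[OF c, of d] by blast
  note D = smooth_on_has_derivative[OF smooth_lift_transition[OF c d] z]
  have "fst (jac (lift c) (lift d) (coord (lift c) u) a) =
      dd (\<lambda>z. fst (coord (lift d) (param (lift c) z))) (coord (lift c) u) a"
    by (rule dd_eqI[symmetric, OF has_derivative_fst[OF D]])
  also have "\<dots> = dd (\<lambda>z. coord d (param c (fst z))) (coord (lift c) u) a"
    by (rule dd_cong[OF open_lift_overlap[OF c d] z]) (simp only: lift_transition[OF c d] fst_conv)
  also have "\<dots> = jac c d (coord c (fst u)) (fst a)"
  proof (rule dd_eqI)
    have "((\<lambda>x. coord d (param c x)) has_derivative jac c d (coord c (fst u))) (at (fst (coord (lift c) u)))"
      using base.transition_has_derivative[OF c d] u by (simp add: lift_coord lift_dom)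
    from has_derivative_compose[OF has_derivative_fst[OF has_derivative_ident] this]
    show "((\<lambda>z. coord d (param c (fst z))) has_derivative (\<lambda>a. jac c d (coord c (fst u)) (fst a))) (at (coord (lift c) u))" .
  qed
  finally show ?thesis .
qed

text \<open>The transition map of the bundle is linear in the fibre, so vertical vectors stay
  vertical and transform by the Jacobian of the base. This makes the coordinate expression of the
  vertical lift consistent between charts.\<close>

lemma jac_lift_vertical:
  assumes c: "c \<in> M" and d: "d \<in> M" and u: "u \<in> dom_of (lift c)" "u \<in> dom_of (lift d)"
  shows "jac (lift c) (lift d) (coord (lift c) u) (0, w) = (0, jac c d (coord c (fst u)) w)"
proof -
  let ?S = "coord c ` (dom_of c \<inter> dom_of d) \<times> (- {0::'e})" let ?z = "coord (lift c) u"
  have z: "?z \<in> ?S" using u lift_overlap[OF c, of d] by blast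
  have p: "fst u \<in> dom_of c" "fst u \<in> dom_of d" using u by (simp_all add: lift_dom)
  note D = smooth_on_has_derivative[OF smooth_lift_transition[OF c d] z]
  have "snd (jac (lift c) (lift d) ?z (0, w)) = dd (\<lambda>z. snd (coord (lift d) (param (lift c) z))) ?z (0, w)"
    by (rule dd_eqI[symmetric, OF has_derivative_snd[OF D]])
  also have "\<dots> = dd (\<lambda>z. jac c d (fst z) (snd z)) ?z (0, w)"
    by (rule dd_cong[OF open_lift_overlap[OF c d] z]) (simp only: lift_transition[OF c d] snd_conv)
  also have "\<dots> = dd (\<lambda>z. jac c d (fst z) (snd ?z)) ?z (0, w) + jac c d (fst ?z) (dd snd ?z (0, w))"
    by (rule dd_family[OF open_lift_overlap[OF c d] z linear_jac_fst[OF c d] smooth_jac[OF c d]])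
      (assumption | rule differentiableI[OF bounded_linear_imp_has_derivative[OF bounded_linear_snd]])+
  also have "dd snd ?z (0, w) = w"
    using dd_eqI[OF bounded_linear_imp_has_derivative[OF bounded_linear_snd], of ?z "(0, w)"] by simp
  \<comment> \<open>The Jacobian depends on the base point alone, so a vertical direction does not
    differentiate it.\<close>
  also have "dd (\<lambda>z. jac c d (fst z) (snd ?z)) ?z (0, w) = 0"
  proof -
    have s: "smooth_on (coord c ` (dom_of c \<inter> dom_of d)) (\<lambda>x. jac c d x (snd ?z))"
      by (rule smooth_on_dd[OF base.smooth_transition[OF c d]])
    have "((\<lambda>x. jac c d x (snd ?z)) has_derivative (\<lambda>v. dd (\<lambda>x. jac c d x (snd ?z)) (fst ?z) v)) (at (fst ?z))"
      by (rule smooth_on_has_derivative[OF s]) (use p in \<open>simp add: lift_coord\<close>)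
    from dd_eqI[OF has_derivative_compose[OF has_derivative_fst[OF has_derivative_ident] this], of "(0, w)"]
    show ?thesis
      using linear_0[OF has_derivative_linear[OF \<open>(_ has_derivative _) (at (fst ?z))\<close>]] by simp
  qed
  finally have "snd (jac (lift c) (lift d) ?z (0, w)) = jac c d (coord c (fst u)) w"
    by (simp add: lift_coord[of c u])
  moreover have "fst (jac (lift c) (lift d) ?z (0, w)) = 0"
    unfolding jac_lift_fst[OF c d u] using linear_0[OF base.linear_jac[OF c d p]] by simp
  ultimately show ?thesis by (intro prod_eqI) simp_all
qed

lemma rho_eq:
  assumes "c \<in> M" "u \<in> dom_of (lift c)" "a \<in> tangent_space (slit_atlas M) u"
  shows "rho M u a c = fst (a (lift c))"
proof -
  let ?z = "coord (lift c) u"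
  have z: "?z \<in> region c" by (rule regionI[OF assms(1,2)])
  have eq: "fst z = coord c (fst (param (lift c) z))" if "z \<in> region c" for z
    using region_point(2)[OF assms(1) that] by (metis lift_coord fst_conv)
  have D: "((\<lambda>z. coord c (fst (param (lift c) z))) has_derivative fst) (at ?z)"
    by (rule has_derivative_transform_within_open[OF bounded_linear_imp_has_derivative[OF bounded_linear_fst]
          open_region[OF assms(1)] z eq])
  have "dir_deriv (slit_atlas M) (\<lambda>w. coord c (fst w)) u a = dd (\<lambda>z. coord c (fst (param (lift c) z))) ?z (a (lift c))"
    by (rule slit.dir_deriv_eq[OF lift_in[OF assms(1)] assms(2) _ assms(3)])
      (use D in \<open>auto simp: differentiable_def\<close>)
  then show ?thesis
    using dd_eqI[OF D] assms by (simp add: rho_def differential_def o_def lift_dom)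
qed

lemma rho_tangent:
  assumes u: "u \<in> slit_bundle M" and a: "a \<in> tangent_space (slit_atlas M) u"
  shows "rho M u a \<in> tangent_space M (fst u)"
proof (rule base.tangent_spaceI)
  fix c d assume cd: "c \<in> M" "d \<in> M" "fst u \<in> dom_of c" "fst u \<in> dom_of d"
  have U: "u \<in> dom_of (lift c)" "u \<in> dom_of (lift d)" using u cd by (simp_all add: lift_dom)
  show "rho M u a d = jac c d (coord c (fst u)) (rho M u a c)"
    using slit.tangent_change[OF a lift_in[OF cd(1)] lift_in[OF cd(2)] U] rho_eq[OF cd(1) U(1) a]
      rho_eq[OF cd(2) U(2) a] jac_lift_fst[OF cd(1,2) U] by simp
qed (auto simp: rho_def differential_def)

lemma vlift_eq:
  assumes "c \<in> M" "u \<in> dom_of (lift c)"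
  shows "vlift M u v (lift c) = (0, v c)"
proof -
  have "((\<lambda>t. (coord c (fst u), snd u c + t *\<^sub>R v c)) has_vector_derivative (0, v c)) (at 0)"
    by (auto intro!: derivative_eq_intros)
  moreover have "(snd u + t *\<^sub>R v) c = snd u c + t *\<^sub>R v c" for t by (simp add: scaleR_fun_def)
  ultimately show ?thesis
    using assms lift_in[OF assms(1)]
    by (simp add: vlift_def velocity_def o_def lift_coord vector_derivative_at del: plus_fun_apply)
qed

lemma vlift_tangent:
  assumes u: "u \<in> slit_bundle M" and v: "v \<in> tangent_space M (fst u)"
  shows "vlift M u v \<in> tangent_space (slit_atlas M) u"
proof (rule slit.tangent_spaceI)
  fix c' d' assume cd': "c' \<in> slit_atlas M" "d' \<in> slit_atlas M" "u \<in> dom_of c'" "u \<in> dom_of d'"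
  then obtain c d where cd: "c \<in> M" "d \<in> M" "c' = lift c" "d' = lift d" by (auto simp: slit_atlas_def)
  have p: "fst u \<in> dom_of c" "fst u \<in> dom_of d" using cd cd' by (simp_all add: lift_dom)
  show "vlift M u v d' = jac c' d' (coord c' u) (vlift M u v c')"
    using vlift_eq[OF cd(1)] vlift_eq[OF cd(2)] cd' base.tangent_change[OF v cd(1,2) p]
    by (simp add: cd(3,4) jac_lift_vertical[OF cd(1,2)])
qed (auto simp: vlift_def velocity_def)

definition piloc :: "('m, 'e) chart \<Rightarrow> ('m, 'e) pifield \<Rightarrow> 'e \<times> 'e \<Rightarrow> 'e" where
  "piloc c X z = X (param (lift c) z) c"

lemma piloc_coord: "c \<in> M \<Longrightarrow> u \<in> dom_of (lift c) \<Longrightarrow> piloc c X (coord (lift c) u) = X u c"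
  by (simp add: piloc_def lift_param_coord)

lemma pi_vector_fieldI:
  assumes "\<And>u. u \<in> slit_bundle M \<Longrightarrow> X u \<in> tangent_space M (fst u)"
    and "\<And>c. c \<in> M \<Longrightarrow> smooth_on (region c) (piloc c X)"
  shows "pi_vector_field M X"
  using assms by (auto simp: pi_vector_field_def smooth_in_chart_iff lift_region piloc_def[abs_def])

lemma pi_tangent: "pi_vector_field M X \<Longrightarrow> u \<in> slit_bundle M \<Longrightarrow> X u \<in> tangent_space M (fst u)"
  by (simp add: pi_vector_field_def)

lemma pi_smooth: "pi_vector_field M X \<Longrightarrow> c \<in> M \<Longrightarrow> smooth_on (region c) (piloc c X)"
  using lift_region by (simp add: pi_vector_field_def smooth_in_chart_iff piloc_def[abs_def])

lemma piloc_add: "piloc c (X + Y) = (\<lambda>z. piloc c X z + piloc c Y z)"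
  and piloc_diff: "piloc c (X - Y) = (\<lambda>z. piloc c X z - piloc c Y z)"
  and piloc_minus: "piloc c (- X) = (\<lambda>z. - piloc c X z)"
  by (simp_all add: piloc_def fun_eq_iff)

lemma pi_add: "pi_vector_field M X \<Longrightarrow> pi_vector_field M Y \<Longrightarrow> pi_vector_field M (X + Y)"
  by (intro pi_vector_fieldI) (simp_all add: base.tangent_add pi_tangent piloc_add smooth_on_add open_region pi_smooth)

lemma pi_diff: "pi_vector_field M X \<Longrightarrow> pi_vector_field M Y \<Longrightarrow> pi_vector_field M (X - Y)"
  by (intro pi_vector_fieldI) (simp_all add: base.tangent_diff pi_tangent piloc_diff smooth_on_diff open_region pi_smooth)

lemma pi_minus: "pi_vector_field M X \<Longrightarrow> pi_vector_field M (- X)"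
  by (intro pi_vector_fieldI) (simp_all add: base.tangent_minus pi_tangent piloc_minus smooth_on_minus open_region pi_smooth)

lemma pi_scaleR:
  assumes f: "smooth_fun (slit_atlas M) f" and X: "pi_vector_field M X"
  shows "pi_vector_field M (\<lambda>u. f u *\<^sub>R X u)"
proof (rule pi_vector_fieldI)
  show "f u *\<^sub>R X u \<in> tangent_space M (fst u)" if "u \<in> slit_bundle M" for u
    by (rule base.tangent_scaleR[OF pi_tangent[OF X that]])
  fix c assume c: "c \<in> M"
  have fs: "smooth_on (region c) (\<lambda>z. f (param (lift c) z))"
    using f lift_in[OF c] unfolding smooth_fun_def smooth_in_chart_iff lift_region[OF c, symmetric] by blast
  have "piloc c (\<lambda>u. f u *\<^sub>R X u) = (\<lambda>z. f (param (lift c) z) *\<^sub>R piloc c X z)"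
    by (simp add: piloc_def scaleR_fun_def fun_eq_iff)
  then show "smooth_on (region c) (piloc c (\<lambda>u. f u *\<^sub>R X u))"
    using smooth_on_scaleR[OF open_region[OF c] fs pi_smooth[OF X c]] by simp
qed

lemma pi_eta: "pi_vector_field M eta"
proof (rule pi_vector_fieldI)
  show "eta u \<in> tangent_space M (fst u)" if "u \<in> slit_bundle M" for u
    using slit_bundleD(1)[OF that] by (simp add: eta_def)
  fix c assume c: "c \<in> M"
  show "smooth_on (region c) (piloc c eta)"
    by (rule smooth_on_cong[OF open_region[OF c] _ smooth_on_linear[OF bounded_linear_snd open_region[OF c]]])
      (simp add: piloc_def eta_def region_point(4)[OF c])
qed

end

section \<open>Extension of local objects and coefficients of a connection\<close>

context manifold_space
begin

text \<open>Charts of the slit bundle are full preimages of charts of the base, so a cutoff may be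
  constant along the fibres. Accordingly all later neighbourhoods have the form
  \<open>over c V\<close>.\<close>

lemma cutoff_lift:
  assumes c: "c \<in> M" and f: "base.cutoff c f"
  shows "slit.cutoff (lift c) (\<lambda>u. f (fst u))"
proof -
  obtain Z where Z: "\<And>d. d \<in> M \<Longrightarrow> open (coord d ` (dom_of d \<inter> Z))" "\<And>q. q \<in> Z \<Longrightarrow> f q = 0"
      "points M \<subseteq> Z \<union> dom_of c"
    and fs: "\<And>d. d \<in> M \<Longrightarrow> smooth_on (coord d ` dom_of d) (\<lambda>x. f (param d x))"
    using f unfolding base.cutoff_def smooth_fun_def smooth_in_chart_iff by blast
  show ?thesis
    unfolding slit.cutoff_def smooth_fun_def
  proof (intro conjI ballI exI[of _ "{u \<in> slit_bundle M. fst u \<in> Z}"])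
    fix d' assume "d' \<in> slit_atlas M"
    then obtain d where d: "d \<in> M" "d' = lift d" unfolding slit_atlas_def by blast
    have "smooth_on (region d) (\<lambda>z. f (param d (fst z)))"
      by (rule smooth_on_compose[OF fs[OF d(1)] open_region[OF d(1)] smooth_on_linear[OF bounded_linear_fst open_region[OF d(1)]]])
        (auto simp: region_def)
    then have "smooth_on (region d) (\<lambda>z. f (fst (param (lift d) z)))"
      by (rule smooth_on_cong[OF open_region[OF d(1)], rotated]) (simp only: region_point(3)[OF d(1)])
    then show "smooth_in_chart d' (\<lambda>u. f (fst u))"
      unfolding smooth_in_chart_iff d(2) lift_region[OF d(1)] .
    have "dom_of (lift d) \<inter> {u \<in> slit_bundle M. fst u \<in> Z} = {u \<in> slit_bundle M. fst u \<in> dom_of d \<inter> Z}"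
      by (auto simp: lift_dom)
    then show "open (coord d' ` (dom_of d' \<inter> {u \<in> slit_bundle M. fst u \<in> Z}))"
      unfolding d(2) using lift_image[OF d(1), of "dom_of d \<inter> Z"] Z(1)[OF d(1)] by (simp add: open_Times open_Compl)
  next
    show "f (fst u) = 0" if "u \<in> {u \<in> slit_bundle M. fst u \<in> Z}" for u using that Z(2) by simp
    show "points (slit_atlas M) \<subseteq> {u \<in> slit_bundle M. fst u \<in> Z} \<union> dom_of (lift c)"
      unfolding points_slit
    proof
      fix u assume u: "u \<in> slit_bundle M"
      then have "fst u \<in> Z \<union> dom_of c" using Z(3) slit_bundleD(2)[OF u] by auto
      then show "u \<in> {u \<in> slit_bundle M. fst u \<in> Z} \<union> dom_of (lift c)" using u by (simp add: lift_dom)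
    qed
  qed
qed

definition extend_pi :: "('m, 'e) chart \<Rightarrow> ('m \<Rightarrow> real) \<Rightarrow> ('e \<times> 'e \<Rightarrow> 'e) \<Rightarrow> ('m, 'e) pifield" where
  "extend_pi c f h u = (if u \<in> dom_of (lift c) then f (fst u) *\<^sub>R tangent_of M c (fst u) (h (coord (lift c) u)) else 0)"

lemma extend_pi_in_chart: "c \<in> M \<Longrightarrow> u \<in> dom_of (lift c) \<Longrightarrow> extend_pi c f h u c = f (fst u) *\<^sub>R h (coord (lift c) u)"
  by (simp add: extend_pi_def scaleR_fun_def lift_dom)

lemma pi_extend:
  assumes c: "c \<in> M" and f: "base.cutoff c f" and h: "smooth_on (region c) h"
  shows "pi_vector_field M (extend_pi c f h)"
  unfolding pi_vector_field_def
proof (intro conjI ballI)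
  show "extend_pi c f h u \<in> tangent_space M (fst u)" if "u \<in> slit_bundle M" for u
    unfolding extend_pi_def using base.tangent_0 base.tangent_scaleR base.tangent_of_in[OF c]
    by (simp add: lift_dom)
  fix d assume d: "d \<in> M"
  let ?h = "\<lambda>u. tangent_of M c (fst u) (h (coord (lift c) u)) d"
  let ?S = "coord c ` (dom_of c \<inter> dom_of d) \<times> (- {0::'e})"
  let ?R = "coord d ` (dom_of d \<inter> dom_of c) \<times> (- {0::'e})"
  note O = open_lift_overlap[OF c d] note O' = open_lift_overlap[OF d c]
  have hS: "smooth_on ?S h" by (rule smooth_on_subset[OF h]) (auto simp: region_def)
  have 1: "smooth_on ?S (\<lambda>z. jac c d (fst z) (h z))"
    by (rule smooth_on_family[OF O linear_jac_fst[OF c d] smooth_jac[OF c d] hS])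
  have "smooth_on ?R (\<lambda>z. jac c d (fst (coord (lift c) (param (lift d) z))) (h (coord (lift c) (param (lift d) z))))"
  proof (rule smooth_on_compose[where g = "\<lambda>z. jac c d (fst z) (h z)", OF 1 O' smooth_lift_transition[OF d c]])
    fix z assume "z \<in> ?R"
    then have "param (lift d) z \<in> dom_of (lift d) \<inter> dom_of (lift c)"
      unfolding lift_overlap[OF d, symmetric]
      by (rule slit.param_in) (use lift_in[OF d] in auto)
    then show "coord (lift c) (param (lift d) z) \<in> ?S"
      unfolding lift_overlap[OF c, symmetric] by blast
  qed
  then have "smooth_on ?R (\<lambda>z. ?h (param (lift d) z))"
  proof (rule smooth_on_cong[OF O', rotated])
    fix z assume "z \<in> ?R"
    then have "param (lift d) z \<in> dom_of (lift d) \<inter> dom_of (lift c)"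
      unfolding lift_overlap[OF d, symmetric]
      by (rule slit.param_in) (use lift_in[OF d] in auto)
    then show "jac c d (fst (coord (lift c) (param (lift d) z))) (h (coord (lift c) (param (lift d) z))) = ?h (param (lift d) z)"
      using d by (simp add: tangent_of_def lift_coord[of c "param (lift d) z"] lift_dom)
  qed
  then have sm: "smooth_on (coord (lift d) ` (dom_of (lift d) \<inter> dom_of (lift c))) (\<lambda>z. ?h (param (lift d) z))"
    unfolding lift_overlap[OF d] .
  from slit.cutoff_extension_smooth[OF cutoff_lift[OF c f] lift_in[OF c] lift_in[OF d] sm]
  have "smooth_in_chart (lift d) (\<lambda>u. if u \<in> dom_of (lift c) then f (fst u) *\<^sub>R ?h u else 0)" .
  moreover have "(\<lambda>u. extend_pi c f h u d) = (\<lambda>u. if u \<in> dom_of (lift c) then f (fst u) *\<^sub>R ?h u else 0)"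
    by (auto simp: extend_pi_def scaleR_fun_def)
  ultimately show "smooth_in_chart (lift d) (\<lambda>u. extend_pi c f h u d)" by (simp only:)
qed

definition extend_fun :: "('m, 'e) chart \<Rightarrow> ('m \<Rightarrow> real) \<Rightarrow> ('e \<times> 'e \<Rightarrow> real) \<Rightarrow> ('m, 'e) tpoint \<Rightarrow> real" where
  "extend_fun c f h u = (if u \<in> dom_of (lift c) then f (fst u) * h (coord (lift c) u) else 0)"

lemma smooth_extend_fun:
  assumes c: "c \<in> M" and f: "base.cutoff c f" and h: "smooth_on (region c) h"
  shows "smooth_fun (slit_atlas M) (extend_fun c f h)"
  unfolding extend_fun_def[abs_def]
  by (rule slit.cutoff_smooth_fun[OF cutoff_lift[OF c f] lift_in[OF c]]) (use h lift_region[OF c] in simp)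

definition extend_vec :: "('m, 'e) chart \<Rightarrow> ('m \<Rightarrow> real) \<Rightarrow> 'e \<times> 'e \<Rightarrow> ('m, 'e) tpoint \<Rightarrow> ('m, 'e) ttvec" where
  "extend_vec c f a u = (if u \<in> dom_of (lift c) then f (fst u) *\<^sub>R tangent_of (slit_atlas M) (lift c) u a else 0)"

lemma extend_vec_field:
  assumes c: "c \<in> M" and f: "base.cutoff c f"
  shows "vector_field (slit_atlas M) (extend_vec c f a)"
  unfolding extend_vec_def[abs_def]
  by (rule slit.cutoff_vector_field[OF cutoff_lift[OF c f] lift_in[OF c], of "\<lambda>_. a"]) simp

lemma extend_vec_in_chart:
  "c \<in> M \<Longrightarrow> u \<in> dom_of (lift c) \<Longrightarrow> extend_vec c f a u (lift c) = f (fst u) *\<^sub>R a"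
  using slit.tangent_of_self[OF lift_in] by (simp add: extend_vec_def scaleR_fun_def)

definition nbhd :: "('m, 'e) chart \<Rightarrow> 'm \<Rightarrow> 'm set \<Rightarrow> bool" where
  "nbhd c p V \<longleftrightarrow> p \<in> V \<and> V \<subseteq> dom_of c \<and> open (coord c ` V)"

lemma nbhd_dom: "c \<in> M \<Longrightarrow> p \<in> dom_of c \<Longrightarrow> nbhd c p (dom_of c)"
  using base.open_image by (simp add: nbhd_def)

lemma nbhd_Int:
  assumes "c \<in> M" "nbhd c p V" "nbhd c p W"
  shows "nbhd c p (V \<inter> W)"
proof -
  have "coord c ` (V \<inter> W) = coord c ` V \<inter> coord c ` W"
    using assms base.inj_coord[OF assms(1)] unfolding nbhd_def by (intro inj_on_image_Int[of _ "dom_of c"]) auto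
  then show ?thesis using assms by (auto simp: nbhd_def)
qed

lemma cutoff_obtain:
  assumes c: "c \<in> M" and W: "nbhd c p W"
  obtains f V where "base.cutoff c f" "nbhd c p V" "V \<subseteq> W" "\<And>q. q \<in> V \<Longrightarrow> f q = 1" "\<And>q. q \<notin> W \<Longrightarrow> f q = 0"
proof -
  have H: "Hausdorff_space (manifold_topology M)" using manifold by (simp add: smooth_manifold_def)
  obtain f V where fV: "base.cutoff c f" "p \<in> V" "V \<subseteq> W" "open (coord c ` V)" "\<forall>q\<in>V. f q = 1"
      "\<forall>q. f q \<noteq> 0 \<longrightarrow> q \<in> W"
    using base.cutoff_exists[OF H c, of p W] W unfolding nbhd_def by blast
  show thesis
    by (rule that[of f V]) (use fV W in \<open>auto simp: nbhd_def\<close>)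
qed

definition over :: "('m, 'e) chart \<Rightarrow> 'm set \<Rightarrow> ('e \<times> 'e) set" where
  "over c V = coord c ` V \<times> (- {0})"

lemma over_open: "nbhd c p V \<Longrightarrow> open (over c V)"
  unfolding over_def nbhd_def by (intro open_Times) auto

lemma over_region: "nbhd c p V \<Longrightarrow> over c V \<subseteq> region c"
  unfolding over_def region_def nbhd_def by auto

lemma over_coord:
  assumes "c \<in> M" "nbhd c p V" "u \<in> dom_of (lift c)" "fst u \<in> V"
  shows "coord (lift c) u \<in> over c V"
  using assms snd_component_nonzero[OF assms(1,3)] by (simp add: lift_coord[of c u] over_def)

lemma over_param:
  assumes "c \<in> M" "nbhd c p V" "z \<in> over c V"
  shows "fst (param (lift c) z) \<in> V"
proof -
  have z: "z \<in> region c" using assms over_region by blast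
  have "fst z \<in> coord c ` V" using assms(3) by (auto simp: over_def)
  from base.param_in[OF this _ assms(1)] show ?thesis
    using region_point(3)[OF assms(1) z] assms(2) by (simp add: nbhd_def)
qed

end

section \<open>Locality and coefficients of a linear connection\<close>

locale pi_connection = manifold_space M for M :: "('m, 'e::euclidean_space) atlas" +
  fixes D :: "('m, 'e) pi_conn"
  assumes connection: "linear_connection M D"
begin

lemma conn_cong:
  assumes "u \<in> slit_bundle M" "a \<in> tangent_space (slit_atlas M) u" "pi_vector_field M Y" "pi_vector_field M Y'"
    and "\<And>w. w \<in> slit_bundle M \<Longrightarrow> Y w = Y' w"
  shows "D u a Y = D u a Y'"
  using conjunct1[OF connection[unfolded linear_connection_def]] assms by blast

lemma conn_tangent:
  "u \<in> slit_bundle M \<Longrightarrow> a \<in> tangent_space (slit_atlas M) u \<Longrightarrow> pi_vector_field M Y \<Longrightarrow> D u a Y \<in> tangent_space M (fst u)"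
  using connection unfolding linear_connection_def by blast

lemma conn_linear:
  "u \<in> slit_bundle M \<Longrightarrow> a \<in> tangent_space (slit_atlas M) u \<Longrightarrow> b \<in> tangent_space (slit_atlas M) u \<Longrightarrow>
    pi_vector_field M Y \<Longrightarrow> D u (r *\<^sub>R a + s *\<^sub>R b) Y = r *\<^sub>R D u a Y + s *\<^sub>R D u b Y"
  using connection unfolding linear_connection_def by blast

lemma conn_add:
  "u \<in> slit_bundle M \<Longrightarrow> a \<in> tangent_space (slit_atlas M) u \<Longrightarrow> pi_vector_field M Y \<Longrightarrow> pi_vector_field M Z \<Longrightarrow>
    D u a (Y + Z) = D u a Y + D u a Z"
  using connection unfolding linear_connection_def by blast

lemma conn_leibniz:
  "u \<in> slit_bundle M \<Longrightarrow> a \<in> tangent_space (slit_atlas M) u \<Longrightarrow> smooth_fun (slit_atlas M) f \<Longrightarrow> pi_vector_field M Y \<Longrightarrow>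
    D u a (\<lambda>w. f w *\<^sub>R Y w) = dir_deriv (slit_atlas M) f u a *\<^sub>R Y u + f u *\<^sub>R D u a Y"
  using connection unfolding linear_connection_def by blast

lemma cov_pi: "vector_field (slit_atlas M) A \<Longrightarrow> pi_vector_field M Y \<Longrightarrow> pi_vector_field M (cov D A Y)"
  using connection unfolding linear_connection_def by blast

lemma dir_deriv_const:
  assumes "u \<in> dom_of (lift c)" "c \<in> M" "a \<in> tangent_space (slit_atlas M) u"
  shows "dir_deriv (slit_atlas M) (\<lambda>_. k) u a = 0"
  using slit.dir_deriv_eq[OF lift_in[OF assms(2)] assms(1) _ assms(3), of "\<lambda>_. k"] by simp

lemma smooth_fun_const: "smooth_fun (slit_atlas M) (\<lambda>_. k)"
  by (simp add: smooth_fun_def smooth_in_chart_iff)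

lemma conn_scaleR_const:
  assumes "u \<in> slit_bundle M" "a \<in> tangent_space (slit_atlas M) u" "pi_vector_field M Y"
  shows "D u a (\<lambda>w. k *\<^sub>R Y w) = k *\<^sub>R D u a Y"
proof -
  obtain c where c: "c \<in> M" "u \<in> dom_of (lift c)" using slit_bundle_chart[OF assms(1)] by blast
  show ?thesis
    using conn_leibniz[OF assms(1,2) smooth_fun_const[of k] assms(3)] dir_deriv_const[OF c(2,1) assms(2), of k] by simp
qed

text \<open>The difference \<open>G\<close> of the fields vanishes over \<open>W\<close> and the
  cutoff \<open>F\<close> vanishes off \<open>W\<close>, so \<open>F * G\<close> is zero everywhere.
  The Leibniz rule at \<open>u\<close>, where \<open>F\<close> is 1 and \<open>G\<close> is 0, then
  yields a vanishing derivative of \<open>G\<close>.\<close>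

lemma conn_local:
  assumes u: "u \<in> slit_bundle M" and a: "a \<in> tangent_space (slit_atlas M) u"
    and Y: "pi_vector_field M Y" "pi_vector_field M Y'" and c: "c \<in> M" and W: "nbhd c (fst u) W"
    and eq: "\<And>w. w \<in> slit_bundle M \<Longrightarrow> fst w \<in> W \<Longrightarrow> Y w = Y' w"
  shows "D u a Y = D u a Y'"
proof -
  obtain f V where f: "base.cutoff c f" "nbhd c (fst u) V" "V \<subseteq> W" "\<And>q. q \<in> V \<Longrightarrow> f q = 1" "\<And>q. q \<notin> W \<Longrightarrow> f q = 0"
    using cutoff_obtain[OF c W] by blast
  define F where "F w = f (fst w)" for w :: "('m, 'e) tpoint"
  have F: "smooth_fun (slit_atlas M) F"
    using cutoff_lift[OF c f(1)] by (simp add: slit.cutoff_def F_def[abs_def])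
  define G where "G = Y + (\<lambda>w. (-1) *\<^sub>R Y' w)"
  have sc: "pi_vector_field M (\<lambda>w. (-1) *\<^sub>R Y' w)" by (rule pi_scaleR[OF smooth_fun_const Y(2)])
  have G: "pi_vector_field M G" unfolding G_def by (rule pi_add[OF Y(1) sc])
  have G0: "G w = 0" if "w \<in> slit_bundle M" "fst w \<in> W" for w using eq[OF that] by (simp add: G_def)
  have uW: "fst u \<in> W" "fst u \<in> V" using f(2,3) by (auto simp: nbhd_def)
  have "D u a (\<lambda>w. F w *\<^sub>R G w) = D u a (\<lambda>w. 0 *\<^sub>R G w)"
  proof (rule conn_cong[OF u a pi_scaleR[OF F G] pi_scaleR[OF smooth_fun_const G]])
    show "F w *\<^sub>R G w = 0 *\<^sub>R G w" if w: "w \<in> slit_bundle M" for w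
    proof (cases "fst w \<in> W")
      case True then show ?thesis using G0[OF w] by simp
    next
      case False then show ?thesis using f(5) by (simp add: F_def)
    qed
  qed
  also have "\<dots> = 0" using conn_scaleR_const[OF u a G, of 0] by simp
  finally have "D u a (\<lambda>w. F w *\<^sub>R G w) = 0" .
  moreover have "D u a (\<lambda>w. F w *\<^sub>R G w) = D u a G"
    using conn_leibniz[OF u a F G] G0[OF u uW(1)] f(4)[OF uW(2)] by (simp add: F_def)
  moreover have "D u a G = D u a Y + (-1) *\<^sub>R D u a Y'"
    unfolding G_def conn_add[OF u a Y(1) sc] conn_scaleR_const[OF u a Y(2)] ..
  ultimately show ?thesis by simp
qed

lemma conn_local_chart:
  assumes u: "u \<in> slit_bundle M" and a: "a \<in> tangent_space (slit_atlas M) u"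
    and Y: "pi_vector_field M Y" "pi_vector_field M Y'" and c: "c \<in> M" and W: "nbhd c (fst u) W"
    and eq: "\<And>z. z \<in> over c W \<Longrightarrow> piloc c Y z = piloc c Y' z"
  shows "D u a Y = D u a Y'"
proof (rule conn_local[OF u a Y c W])
  fix w assume w: "w \<in> slit_bundle M" "fst w \<in> W"
  then have wc: "fst w \<in> dom_of c" "w \<in> dom_of (lift c)" using W by (auto simp: nbhd_def lift_dom)
  show "Y w = Y' w"
    by (rule base.tangent_eqI[OF pi_tangent[OF Y(1) w(1)] pi_tangent[OF Y(2) w(1)] c wc(1)])
      (use eq[OF over_coord[OF c W wc(2) w(2)]] in \<open>simp add: piloc_coord[OF c wc(2)]\<close>)
qed

definition const_near :: "('m, 'e) chart \<Rightarrow> 'm \<Rightarrow> 'e \<Rightarrow> ('m, 'e) pifield \<Rightarrow> bool" where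
  "const_near c p w Y \<longleftrightarrow> pi_vector_field M Y \<and> (\<exists>W. nbhd c p W \<and> (\<forall>z\<in>over c W. piloc c Y z = w))"

text \<open>A connection only acts on global fields, so the field with constant coordinates \<open>w\<close> has to be extended;
  by locality the choice of the extension does not matter.\<close>

definition coef :: "('m, 'e) chart \<Rightarrow> 'e \<times> 'e \<Rightarrow> 'e \<times> 'e \<Rightarrow> 'e \<Rightarrow> 'e" where
  "coef c z a w = D (param (lift c) z) (tangent_of (slit_atlas M) (lift c) (param (lift c) z) a)
     (SOME Y. const_near c (fst (param (lift c) z)) w Y) c"

lemma const_near_exists:
  assumes c: "c \<in> M" and p: "p \<in> dom_of c"
  obtains f V where "base.cutoff c f" "nbhd c p V" "\<And>q. q \<in> V \<Longrightarrow> f q = 1"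
    "\<And>w q. q \<in> V \<Longrightarrow> const_near c q w (extend_pi c f (\<lambda>_. w))"
proof -
  obtain f V where f: "base.cutoff c f" "nbhd c p V" "V \<subseteq> dom_of c" "\<And>q. q \<in> V \<Longrightarrow> f q = 1"
    using cutoff_obtain[OF c nbhd_dom[OF c p]] by metis
  have "const_near c q w (extend_pi c f (\<lambda>_. w))" if q: "q \<in> V" for q w
    unfolding const_near_def
  proof (intro conjI exI[of _ V] ballI)
    show "pi_vector_field M (extend_pi c f (\<lambda>_. w))" by (rule pi_extend[OF c f(1) smooth_on_const])
    show "nbhd c q V" using f(2) q by (simp add: nbhd_def)
    fix z assume z: "z \<in> over c V"
    then have r: "z \<in> region c" using over_region[OF f(2)] by blast
    show "piloc c (extend_pi c f (\<lambda>_. w)) z = w"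
      using extend_pi_in_chart[OF c region_point(1)[OF c r]] f(4)[OF over_param[OF c f(2) z]] by (simp add: piloc_def)
  qed
  then show thesis using that f by blast
qed

lemma coef_eq:
  assumes c: "c \<in> M" and u: "u \<in> dom_of (lift c)" and a: "a \<in> tangent_space (slit_atlas M) u"
    and Y: "const_near c (fst u) w Y"
  shows "coef c (coord (lift c) u) (a (lift c)) w = D u a Y c"
proof -
  have us: "u \<in> slit_bundle M" using u by (simp add: lift_dom)
  let ?Y = "SOME Y. const_near c (fst u) w Y"
  have Y': "const_near c (fst u) w ?Y" by (rule someI[of _ Y], rule Y)
  obtain W W' where W: "nbhd c (fst u) W" "\<forall>z\<in>over c W. piloc c Y z = w" "nbhd c (fst u) W'" "\<forall>z\<in>over c W'. piloc c ?Y z = w"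
    using Y Y' unfolding const_near_def by blast
  have "D u a ?Y = D u a Y"
  proof (rule conn_local_chart[OF us a _ _ c nbhd_Int[OF c W(1,3)]])
    show "pi_vector_field M ?Y" "pi_vector_field M Y" using Y Y' by (simp_all add: const_near_def)
    show "piloc c ?Y z = piloc c Y z" if "z \<in> over c (W \<inter> W')" for z
    proof -
      have "z \<in> over c W" "z \<in> over c W'" using that by (auto simp: over_def)
      then show ?thesis using W(2,4) by simp
    qed
  qed
  then show ?thesis
    unfolding coef_def lift_param_coord[OF c u] slit.tangent_of_eq[OF a lift_in[OF c] u] by simp
qed

lemma point_setup:
  assumes c: "c \<in> M" and z: "z \<in> region c"
  obtains u where "u = param (lift c) z" "u \<in> dom_of (lift c)" "u \<in> slit_bundle M" "coord (lift c) u = z" "fst u \<in> dom_of c"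
  using region_point[OF c z] by blast

lemma coef_linear_vec:
  assumes c: "c \<in> M" and z: "z \<in> region c"
  shows "linear (\<lambda>a. coef c z a w)"
proof -
  obtain u where u: "u \<in> dom_of (lift c)" "u \<in> slit_bundle M" "coord (lift c) u = z" "fst u \<in> dom_of c"
    using point_setup[OF c z] by blast
  obtain f V where "nbhd c (fst u) V" and fV: "\<And>w q. q \<in> V \<Longrightarrow> const_near c q w (extend_pi c f (\<lambda>_. w))"
    using const_near_exists[OF c u(4)] by metis
  then have Y: "const_near c (fst u) w (extend_pi c f (\<lambda>_. w))" by (simp add: nbhd_def)
  let ?t = "tangent_of (slit_atlas M) (lift c) u" let ?Y = "extend_pi c f (\<lambda>_. w)"
  have Yp: "pi_vector_field M ?Y" using Y by (simp add: const_near_def)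
  have t: "?t a \<in> tangent_space (slit_atlas M) u" "?t a (lift c) = a" for a
    using slit.tangent_of_in[OF lift_in[OF c] u(1)] slit.tangent_of_self[OF lift_in[OF c] u(1)] by simp_all
  have C: "coef c z a w = D u (?t a) ?Y c" for a
    using coef_eq[OF c u(1) t(1) Y] t(2) u(3) by simp
  have lin: "r *\<^sub>R ?t a + s *\<^sub>R ?t b = ?t (r *\<^sub>R a + s *\<^sub>R b)" for r s a b
    by (rule slit.tangent_eqI[OF slit.tangent_scaleR_add[OF t(1) t(1)] t(1) lift_in[OF c] u(1)])
      (simp add: t(2) scaleR_fun_def)
  have "coef c z (r *\<^sub>R a + s *\<^sub>R b) w = r *\<^sub>R coef c z a w + s *\<^sub>R coef c z b w" for r s a b
    unfolding C lin[symmetric] conn_linear[OF u(2) t(1) t(1) Yp] by (simp add: scaleR_fun_def)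
  from this[of 1 _ 1] this[of _ _ 0] show ?thesis by (intro linearI) simp_all
qed

lemma coef_linear_arg:
  assumes c: "c \<in> M" and z: "z \<in> region c"
  shows "linear (\<lambda>w. coef c z a w)"
proof -
  obtain u where u: "u \<in> dom_of (lift c)" "u \<in> slit_bundle M" "coord (lift c) u = z" "fst u \<in> dom_of c"
    using point_setup[OF c z] by blast
  obtain f V where V: "nbhd c (fst u) V" and fV: "\<And>w q. q \<in> V \<Longrightarrow> const_near c q w (extend_pi c f (\<lambda>_. w))"
    using const_near_exists[OF c u(4)] by metis
  then have Y: "const_near c (fst u) w (extend_pi c f (\<lambda>_. w))" for w by (simp add: nbhd_def)
  let ?t = "tangent_of (slit_atlas M) (lift c) u a" let ?Y = "\<lambda>w. extend_pi c f (\<lambda>_. w)"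
  have Yp: "pi_vector_field M (?Y w)" for w using Y by (simp add: const_near_def)
  have t: "?t \<in> tangent_space (slit_atlas M) u" "?t (lift c) = a"
    using slit.tangent_of_in[OF lift_in[OF c] u(1)] slit.tangent_of_self[OF lift_in[OF c] u(1)] by simp_all
  have C: "coef c z a w = D u ?t (?Y w) c" for w
    using coef_eq[OF c u(1) t(1) Y] t(2) u(3) by simp
  have "D u ?t (?Y (v + w)) = D u ?t (?Y v + ?Y w)" for v w
  proof (rule conn_local_chart[OF u(2) t(1) Yp pi_add[OF Yp Yp] c V])
    show "piloc c (?Y (v + w)) x = piloc c (?Y v + ?Y w) x" if x: "x \<in> over c V" for x
    proof -
      have r: "x \<in> region c" using over_region[OF V] x by blast
      show ?thesis
        unfolding piloc_add by (simp add: piloc_def extend_pi_in_chart[OF c region_point(1)[OF c r]] scaleR_add_right)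
    qed
  qed
  then have 1: "coef c z a (v + w) = coef c z a v + coef c z a w" for v w
    unfolding C using conn_add[OF u(2) t(1) Yp Yp] by simp
  have "D u ?t (?Y (r *\<^sub>R w)) = D u ?t (\<lambda>x. r *\<^sub>R ?Y w x)" for r w
  proof (rule conn_local_chart[OF u(2) t(1) Yp pi_scaleR[OF smooth_fun_const Yp] c V])
    show "piloc c (?Y (r *\<^sub>R w)) x = piloc c (\<lambda>x. r *\<^sub>R ?Y w x) x" if x: "x \<in> over c V" for x
    proof -
      have r: "x \<in> region c" using over_region[OF V] x by blast
      show ?thesis
        by (simp add: piloc_def scaleR_fun_def extend_pi_in_chart[OF c region_point(1)[OF c r]])
    qed
  qed
  then have 2: "coef c z a (r *\<^sub>R w) = r *\<^sub>R coef c z a w" for r w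
    unfolding C using conn_scaleR_const[OF u(2) t(1) Yp] by (simp add: scaleR_fun_def)
  show ?thesis by (rule linearI[OF 1 2])
qed

text \<open>Locally the coefficient is a component of \<open>cov D A Y\<close> for global fields
  \<open>A\<close> and \<open>Y\<close> with constant coordinates near the point, and a connection
  sends smooth fields to smooth fields.\<close>

lemma coef_smooth:
  assumes c: "c \<in> M"
  shows "smooth_on (region c) (\<lambda>z. coef c z a w)"
proof (rule smooth_on_local)
  fix z assume z: "z \<in> region c"
  obtain u where u: "u \<in> dom_of (lift c)" "u \<in> slit_bundle M" "coord (lift c) u = z" "fst u \<in> dom_of c"
    using point_setup[OF c z] by blast
  obtain f V where f: "base.cutoff c f" and V: "nbhd c (fst u) V" and f1: "\<And>q. q \<in> V \<Longrightarrow> f q = 1"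
    and fV: "\<And>w q. q \<in> V \<Longrightarrow> const_near c q w (extend_pi c f (\<lambda>_. w))"
    using const_near_exists[OF c u(4)] by metis
  let ?A = "extend_vec c f a" let ?Y = "extend_pi c f (\<lambda>_. w)"
  have Y: "pi_vector_field M ?Y" by (rule pi_extend[OF c f smooth_on_const])
  have "smooth_on (over c V) (piloc c (cov D ?A ?Y))"
    by (rule smooth_on_subset[OF pi_smooth[OF cov_pi[OF extend_vec_field[OF c f] Y] c] over_region[OF V]])
  then have "smooth_on (over c V) (\<lambda>z. coef c z a w)"
  proof (rule smooth_on_cong[OF over_open[OF V], rotated])
    fix x assume x: "x \<in> over c V"
    then have r: "x \<in> region c" using over_region[OF V] by blast
    note rp = region_point[OF c r] and V' = over_param[OF c V x]
    have At: "?A (param (lift c) x) \<in> tangent_space (slit_atlas M) (param (lift c) x)"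
      by (rule slit.vector_field_tangent[OF extend_vec_field[OF c f] lift_in[OF c] rp(1)])
    have "coef c x a w = D (param (lift c) x) (?A (param (lift c) x)) ?Y c"
      using coef_eq[OF c rp(1) At fV[OF V']] extend_vec_in_chart[OF c rp(1)] f1[OF V'] rp(2) by simp
    then show "piloc c (cov D ?A ?Y) x = coef c x a w" by (simp add: piloc_def cov_def)
  qed
  moreover have "z \<in> over c V"
    using over_coord[OF c V u(1)] V u(3) by (simp add: nbhd_def)
  ultimately show "\<exists>A. open A \<and> z \<in> A \<and> smooth_on A (\<lambda>z. coef c z a w)"
    using over_open[OF V] by blast
qed

lemma conn_sum:
  assumes "u \<in> slit_bundle M" "a \<in> tangent_space (slit_atlas M) u" "finite I"
    and "\<And>i. i \<in> I \<Longrightarrow> pi_vector_field M (Y i)"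
  shows "pi_vector_field M (\<Sum>i\<in>I. Y i) \<and> D u a (\<Sum>i\<in>I. Y i) = (\<Sum>i\<in>I. D u a (Y i))"
  using assms(3,4)
proof (induction I rule: finite_induct)
  case empty
  \<comment> \<open>The empty sum is written as 0 times \<open>eta\<close>, so that the rule for
    constant factors gives its derivative.\<close>
  have z: "pi_vector_field M (\<lambda>w. 0 *\<^sub>R eta w)" by (rule pi_scaleR[OF smooth_fun_const pi_eta])
  have e: "(\<lambda>w. 0 *\<^sub>R eta w) = (0 :: ('m, 'e) pifield)" by (auto simp: fun_eq_iff)
  show ?case
    using z conn_scaleR_const[OF assms(1,2) pi_eta, of 0] unfolding e sum.empty by (simp only: scaleR_zero_left)
next
  case (insert i I)
  then have 1: "pi_vector_field M (\<Sum>i\<in>I. Y i)" "pi_vector_field M (Y i)"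
    and 2: "D u a (\<Sum>i\<in>I. Y i) = (\<Sum>i\<in>I. D u a (Y i))" by auto
  show ?case
    unfolding sum.insert[OF insert(1,2)] conn_add[OF assms(1,2) 1(2,1)] 2
    using pi_add[OF 1(2,1)] by (simp only:)
qed

text \<open>Near \<open>u\<close> the field is a combination of fields with constant coordinates,
  whose coefficients are the coordinates of \<open>Y\<close>. The Leibniz rule differentiates the
  latter and \<open>coef\<close> accounts for the former.\<close>

theorem conn_chart:
  assumes c: "c \<in> M" and u: "u \<in> dom_of (lift c)" and a: "a \<in> tangent_space (slit_atlas M) u"
    and Y: "pi_vector_field M Y"
  shows "D u a Y c = dd (piloc c Y) (coord (lift c) u) (a (lift c)) + coef c (coord (lift c) u) (a (lift c)) (Y u c)"
proof -
  have us: "u \<in> slit_bundle M" "fst u \<in> dom_of c" using u by (simp_all add: lift_dom)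
  let ?z = "coord (lift c) u" let ?a = "a (lift c)"
  have zr: "?z \<in> region c" by (rule regionI[OF c u])
  obtain f V where f: "base.cutoff c f" and V: "nbhd c (fst u) V" and f1: "\<And>q. q \<in> V \<Longrightarrow> f q = 1"
    and fV: "\<And>w q. q \<in> V \<Longrightarrow> const_near c q w (extend_pi c f (\<lambda>_. w))"
    using const_near_exists[OF c us(2)] by metis
  have uV: "fst u \<in> V" using V by (simp add: nbhd_def)
  have zV: "?z \<in> over c V" by (rule over_coord[OF c V u uV])
  define h where "h b = extend_fun c f (\<lambda>z. piloc c Y z \<bullet> b)" for b
  define E where "E b = extend_pi c f (\<lambda>_. b)" for b
  have sb: "smooth_on (region c) (\<lambda>z. piloc c Y z \<bullet> b)" for b
    by (rule smooth_on_inner_left[OF open_region[OF c] pi_smooth[OF Y c]])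
  have hs: "smooth_fun (slit_atlas M) (h b)" for b
    unfolding h_def by (rule smooth_extend_fun[OF c f sb])
  have hval: "h b (param (lift c) x) = piloc c Y x \<bullet> b" if x: "x \<in> over c V" for x b
    using f1[OF over_param[OF c V x]] region_point(1,2)[OF c subsetD[OF over_region[OF V] x]]
    by (simp add: h_def extend_fun_def)
  have Eval: "E b (param (lift c) x) c = b" if x: "x \<in> over c V" for x b
    using f1[OF over_param[OF c V x]] extend_pi_in_chart[OF c region_point(1)[OF c subsetD[OF over_region[OF V] x]]]
    by (simp add: E_def)
  have Ep: "pi_vector_field M (E b)" for b
    unfolding E_def by (rule pi_extend[OF c f smooth_on_const])
  let ?P = "\<lambda>b w. h b w *\<^sub>R E b w"
  have P: "pi_vector_field M (?P b)" for b by (rule pi_scaleR[OF hs Ep])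
  note S = conn_sum[OF us(1) a finite_Basis, of "?P", OF P]
  \<comment> \<open>Both factors of \<open>?P b\<close> carry the cutoff, which is 1 over
    \<open>V\<close>; hence the sum agrees with \<open>Y\<close> there, and locality
    suffices.\<close>
  have "D u a Y = D u a (\<Sum>b\<in>Basis. ?P b)"
  proof (rule conn_local_chart[OF us(1) a Y conjunct1[OF S] c V])
    fix x assume x: "x \<in> over c V"
    have ap: "(\<Sum>b\<in>B. ?P b) w c = (\<Sum>b\<in>B. h b w *\<^sub>R E b w c)" if "finite B" for B w
      using that by (induction B rule: finite_induct) (simp_all add: scaleR_fun_def)
    show "piloc c Y x = piloc c (\<Sum>b\<in>Basis. ?P b) x"
      unfolding piloc_def[of c "\<Sum>b\<in>Basis. ?P b"] ap[OF finite_Basis]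
      by (simp add: hval[OF x] Eval[OF x] euclidean_representation)
  qed
  also have "\<dots> = (\<Sum>b\<in>Basis. dir_deriv (slit_atlas M) (h b) u a *\<^sub>R E b u + h b u *\<^sub>R D u a (E b))"
    unfolding conjunct2[OF S] by (intro sum.cong refl conn_leibniz[OF us(1) a hs Ep])
  finally have 1: "D u a Y c = (\<Sum>b\<in>Basis. dir_deriv (slit_atlas M) (h b) u a *\<^sub>R E b u c + h b u *\<^sub>R D u a (E b) c)"
  proof -
    have ap: "(\<Sum>b\<in>B. F b) c = (\<Sum>b\<in>B. F b c)" if "finite B" for B and F :: "'e \<Rightarrow> ('m, 'e) tvec"
      using that by (induction B rule: finite_induct) simp_all
    assume "D u a Y = (\<Sum>b\<in>Basis. dir_deriv (slit_atlas M) (h b) u a *\<^sub>R E b u + h b u *\<^sub>R D u a (E b))"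
    then show ?thesis by (simp add: ap scaleR_fun_def)
  qed
  have 2: "E b u c = b" "h b u = Y u c \<bullet> b" for b
    using Eval[OF zV, of b] hval[OF zV, of b] by (simp_all add: lift_param_coord[OF c u] piloc_coord[OF c u])
  have 3: "D u a (E b) c = coef c ?z ?a b" for b
    unfolding E_def using coef_eq[OF c u a fV[OF uV]] by simp
  have 4: "dir_deriv (slit_atlas M) (h b) u a = dd (piloc c Y) ?z ?a \<bullet> b" for b
  proof -
    have "dir_deriv (slit_atlas M) (h b) u a = dd (\<lambda>x. h b (param (lift c) x)) ?z ?a"
      by (rule slit.dir_deriv_smooth[OF lift_in[OF c] u _ a]) (use hs lift_in[OF c] in \<open>auto simp: smooth_fun_def\<close>)
    also have "\<dots> = dd (\<lambda>x. piloc c Y x \<bullet> b) ?z ?a"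
      by (rule dd_cong[OF over_open[OF V] zV hval])
    also have "\<dots> = dd (piloc c Y) ?z ?a \<bullet> b"
      by (rule dd_eqI, rule has_derivative_inner_left, rule smooth_on_has_derivative[OF pi_smooth[OF Y c] zr])
    finally show ?thesis .
  qed
  have "coef c ?z ?a (Y u c) = (\<Sum>b\<in>Basis. (Y u c \<bullet> b) *\<^sub>R coef c ?z ?a b)"
    by (rule linear_euclidean_expand[OF coef_linear_arg[OF c zr]])
  then show ?thesis
    unfolding 1 2 3 4 sum.distrib by (simp add: euclidean_representation)
qed

end

section \<open>Torsion and curvature in a chart\<close>

text \<open>Smoothness is required at fixed arguments only; in finite dimension this is enough for
  moving arguments.\<close>

definition smooth_bilinear :: "'z::real_normed_vector set \<Rightarrow> ('z \<Rightarrow> 'a::euclidean_space \<Rightarrow> 'b::euclidean_space \<Rightarrow> 'c::real_normed_vector) \<Rightarrow> bool" where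
  "smooth_bilinear S G \<longleftrightarrow> (\<forall>x\<in>S. \<forall>w. linear (\<lambda>a. G x a w)) \<and> (\<forall>x\<in>S. \<forall>a. linear (\<lambda>w. G x a w)) \<and>
     (\<forall>a w. smooth_on S (\<lambda>x. G x a w))"

lemma smooth_bilinearD:
  assumes "smooth_bilinear S G"
  shows "x \<in> S \<Longrightarrow> linear (\<lambda>a. G x a w)" "x \<in> S \<Longrightarrow> linear (\<lambda>w. G x a w)" "smooth_on S (\<lambda>x. G x a w)"
  using assms unfolding smooth_bilinear_def by blast+

lemma smooth_on_bilinear_family:
  assumes "open S" "smooth_bilinear S G" "smooth_on S f" "smooth_on S g"
  shows "smooth_on S (\<lambda>x. G x (f x) (g x))"
proof (rule smooth_on_family[where T = "\<lambda>x. G x (f x)", OF assms(1) smooth_bilinearD(2)[OF assms(2)] _ assms(4)])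
  show "smooth_on S (\<lambda>x. G x (f x) w)" for w
    by (rule smooth_on_family[where T = "\<lambda>x a. G x a w", OF assms(1) smooth_bilinearD(1)[OF assms(2)] smooth_bilinearD(3)[OF assms(2)] assms(3)])
qed

lemma dd_bilinear_family:
  assumes "open S" "z \<in> S" "smooth_bilinear S G" "smooth_on S f" "smooth_on S g"
  shows "dd (\<lambda>x. G x (f x) (g x)) z v =
    dd (\<lambda>x. G x (f z) (g z)) z v + G z (dd f z v) (g z) + G z (f z) (dd g z v)"
proof -
  note B = smooth_bilinearD[OF assms(3)]
  have s: "smooth_on S (\<lambda>x. G x (f x) w)" for w
    by (rule smooth_on_bilinear_family[OF assms(1,3,4) smooth_on_const])
  have "dd (\<lambda>x. G x (f x) (g x)) z v = dd (\<lambda>x. G x (f x) (g z)) z v + G z (f z) (dd g z v)"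
    by (rule dd_family[where T = "\<lambda>x. G x (f x)", OF assms(1,2) B(2) s smooth_on_differentiable[OF assms(5,2)]])
  also have "dd (\<lambda>x. G x (f x) (g z)) z v = dd (\<lambda>x. G x (f z) (g z)) z v + G z (dd f z v) (g z)"
    by (rule dd_family[where T = "\<lambda>x a. G x a (g z)", OF assms(1,2) B(1,3) smooth_on_differentiable[OF assms(4,2)]])
  finally show ?thesis .
qed

definition smooth_trilinear :: "'z::real_normed_vector set \<Rightarrow> ('z \<Rightarrow> 'a::euclidean_space \<Rightarrow> 'a \<Rightarrow> 'a \<Rightarrow> 'c::real_normed_vector) \<Rightarrow> bool" where
  "smooth_trilinear S t \<longleftrightarrow> (\<forall>x\<in>S. \<forall>b w. linear (\<lambda>a. t x a b w)) \<and> (\<forall>a. smooth_bilinear S (\<lambda>x. t x a))"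

lemma smooth_trilinearD:
  assumes "smooth_trilinear S t"
  shows "x \<in> S \<Longrightarrow> linear (\<lambda>a. t x a b w)" "x \<in> S \<Longrightarrow> linear (\<lambda>b. t x a b w)" "x \<in> S \<Longrightarrow> linear (\<lambda>w. t x a b w)"
    "smooth_on S (\<lambda>x. t x a b w)"
  using assms unfolding smooth_trilinear_def smooth_bilinear_def by blast+

lemma smooth_trilinearI:
  assumes "\<And>x b w. x \<in> S \<Longrightarrow> linear (\<lambda>a. t x a b w)" "\<And>x a w. x \<in> S \<Longrightarrow> linear (\<lambda>b. t x a b w)"
    "\<And>x a b. x \<in> S \<Longrightarrow> linear (\<lambda>w. t x a b w)" "\<And>a b w. smooth_on S (\<lambda>x. t x a b w)"
  shows "smooth_trilinear S t"
  using assms unfolding smooth_trilinear_def smooth_bilinear_def by blast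

lemma smooth_bilinear_moving:
  assumes "open S" "smooth_trilinear S t" "smooth_on S f"
  shows "smooth_bilinear S (\<lambda>x. t x (f x))"
  unfolding smooth_bilinear_def
proof (intro conjI ballI allI)
  note T = smooth_trilinearD[OF assms(2)]
  show "linear (\<lambda>b. t x (f x) b w)" "linear (\<lambda>w. t x (f x) b w)" if "x \<in> S" for x b w
    by (rule T(2)[OF that], rule T(3)[OF that])
  show "smooth_on S (\<lambda>x. t x (f x) a w)" for a w
    by (rule smooth_on_family[where T = "\<lambda>x b. t x b a w", OF assms(1) T(1,4) assms(3)])
qed

lemma smooth_on_trilinear_family:
  assumes "open S" "smooth_trilinear S t" "smooth_on S f" "smooth_on S g" "smooth_on S h"
  shows "smooth_on S (\<lambda>x. t x (f x) (g x) (h x))"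
  by (rule smooth_on_bilinear_family[where G = "\<lambda>x. t x (f x)", OF assms(1) smooth_bilinear_moving[OF assms(1-3)] assms(4,5)])

lemma dd_trilinear_family:
  assumes "open S" "z \<in> S" "smooth_trilinear S t" "smooth_on S f" "smooth_on S g" "smooth_on S h"
  shows "dd (\<lambda>x. t x (f x) (g x) (h x)) z v = dd (\<lambda>x. t x (f z) (g z) (h z)) z v
    + t z (dd f z v) (g z) (h z) + t z (f z) (dd g z v) (h z) + t z (f z) (g z) (dd h z v)"
proof -
  have "dd (\<lambda>x. t x (f x) (g x) (h x)) z v =
      dd (\<lambda>x. t x (f x) (g z) (h z)) z v + t z (f z) (dd g z v) (h z) + t z (f z) (g z) (dd h z v)"
    by (rule dd_bilinear_family[where G = "\<lambda>x. t x (f x)", OF assms(1,2) smooth_bilinear_moving[OF assms(1,3,4)] assms(5,6)])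
  also have "dd (\<lambda>x. t x (f x) (g z) (h z)) z v = dd (\<lambda>x. t x (f z) (g z) (h z)) z v + t z (dd f z v) (g z) (h z)"
    by (rule dd_family[where T = "\<lambda>x a. t x a (g z) (h z)", OF assms(1,2) smooth_trilinearD(1,4)[OF assms(3)]
          smooth_on_differentiable[OF assms(4,2)]])
  finally show ?thesis by simp
qed

lemma dd_add:
  "f differentiable (at x) \<Longrightarrow> g differentiable (at x) \<Longrightarrow> dd (\<lambda>x. f x + g x) x v = dd f x v + dd g x v"
  by (rule dd_eqI[OF has_derivative_add[OF has_derivative_dd has_derivative_dd]])

lemma dd_diff:
  "f differentiable (at x) \<Longrightarrow> g differentiable (at x) \<Longrightarrow> dd (\<lambda>x. f x - g x) x v = dd f x v - dd g x v"
  by (rule dd_eqI[OF has_derivative_diff[OF has_derivative_dd has_derivative_dd]])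

section \<open>Vector fields on the slit bundle in coordinates\<close>

context manifold_space
begin

definition vloc :: "('m, 'e) chart \<Rightarrow> (('m, 'e) tpoint \<Rightarrow> ('m, 'e) ttvec) \<Rightarrow> 'e \<times> 'e \<Rightarrow> 'e \<times> 'e" where
  "vloc c A z = A (param (lift c) z) (lift c)"

lemma vloc_coord: "c \<in> M \<Longrightarrow> u \<in> dom_of (lift c) \<Longrightarrow> vloc c A (coord (lift c) u) = A u (lift c)"
  by (simp add: vloc_def lift_param_coord)

lemma vec_smooth: "vector_field (slit_atlas M) A \<Longrightarrow> c \<in> M \<Longrightarrow> smooth_on (region c) (vloc c A)"
  using slit.vector_field_smooth[OF _ lift_in] lift_region by (simp add: vloc_def[abs_def])

lemma vec_tangent: "vector_field (slit_atlas M) A \<Longrightarrow> u \<in> slit_bundle M \<Longrightarrow> A u \<in> tangent_space (slit_atlas M) u"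
  by (simp add: vector_field_def points_slit)

lemma vec_fieldI:
  assumes "\<And>u. u \<in> slit_bundle M \<Longrightarrow> A u \<in> tangent_space (slit_atlas M) u"
    and "\<And>c. c \<in> M \<Longrightarrow> smooth_on (region c) (vloc c A)"
  shows "vector_field (slit_atlas M) A"
  unfolding vector_field_def points_slit
proof (intro conjI ballI assms(1))
  fix c' assume "c' \<in> slit_atlas M"
  then obtain c where c: "c \<in> M" "c' = lift c" unfolding slit_atlas_def by blast
  show "smooth_in_chart c' (\<lambda>u. A u c')"
    using assms(2)[OF c(1)] unfolding smooth_in_chart_iff c(2) lift_region[OF c(1)] vloc_def[abs_def] .
qed

lemma piloc_rho:
  assumes "vector_field (slit_atlas M) A" "c \<in> M" "z \<in> region c"
  shows "piloc c (rho_f M A) z = fst (vloc c A z)"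
  unfolding piloc_def rho_f_def vloc_def
  by (rule rho_eq[OF assms(2) region_point(1)[OF assms(2,3)] vec_tangent[OF assms(1) region_point(6)[OF assms(2,3)]]])

lemma pi_rho:
  assumes "vector_field (slit_atlas M) A"
  shows "pi_vector_field M (rho_f M A)"
proof (rule pi_vector_fieldI)
  show "rho_f M A u \<in> tangent_space M (fst u)" if "u \<in> slit_bundle M" for u
    unfolding rho_f_def by (rule rho_tangent[OF that vec_tangent[OF assms that]])
  show "smooth_on (region c) (piloc c (rho_f M A))" if c: "c \<in> M" for c
    by (rule smooth_on_cong[OF open_region[OF c] _ smooth_on_fst[OF open_region[OF c] vec_smooth[OF assms c]]])
      (simp add: piloc_rho[OF assms c])
qed

lemma vloc_gamma: "c \<in> M \<Longrightarrow> z \<in> region c \<Longrightarrow> vloc c (gamma_f M X) z = (0, piloc c X z)"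
  unfolding vloc_def gamma_f_def piloc_def by (rule vlift_eq[OF _ region_point(1)])

lemma vec_gamma:
  assumes "pi_vector_field M X"
  shows "vector_field (slit_atlas M) (gamma_f M X)"
proof (rule vec_fieldI)
  show "gamma_f M X u \<in> tangent_space (slit_atlas M) u" if "u \<in> slit_bundle M" for u
    unfolding gamma_f_def by (rule vlift_tangent[OF that pi_tangent[OF assms that]])
  show "smooth_on (region c) (vloc c (gamma_f M X))" if c: "c \<in> M" for c
    by (rule smooth_on_cong[OF open_region[OF c] _ smooth_on_Pair[OF open_region[OF c] smooth_on_const pi_smooth[OF assms c]]])
      (simp add: vloc_gamma[OF c])
qed

lemma lie_chart:
  "c \<in> M \<Longrightarrow> u \<in> dom_of (lift c) \<Longrightarrow> lie_bracket (slit_atlas M) A B u (lift c) =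
    dd (vloc c B) (coord (lift c) u) (A u (lift c)) - dd (vloc c A) (coord (lift c) u) (B u (lift c))"
  unfolding vloc_def[abs_def] by (rule slit.lie_bracket_chart[OF lift_in])

end

section \<open>Coordinate formulas for torsion, curvature and covariant derivatives\<close>

context pi_connection
begin

lemma coef_bilinear: "c \<in> M \<Longrightarrow> smooth_bilinear (region c) (coef c)"
  unfolding smooth_bilinear_def using coef_linear_vec coef_linear_arg coef_smooth by blast

lemma cov_chart:
  assumes "c \<in> M" "u \<in> dom_of (lift c)" "vector_field (slit_atlas M) A" "pi_vector_field M Y"
  shows "cov D A Y u c = dd (piloc c Y) (coord (lift c) u) (A u (lift c)) + coef c (coord (lift c) u) (A u (lift c)) (Y u c)"
  unfolding cov_def
  by (rule conn_chart[OF assms(1,2) vec_tangent[OF assms(3) lift_dom_subset(2)[OF assms(2)]] assms(4)])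

lemma piloc_cov:
  assumes c: "c \<in> M" and z: "z \<in> region c" and A: "vector_field (slit_atlas M) A" and Y: "pi_vector_field M Y"
  shows "piloc c (cov D A Y) z = dd (piloc c Y) z (vloc c A z) + coef c z (vloc c A z) (piloc c Y z)"
  using cov_chart[OF c region_point(1)[OF c z] A Y] region_point(2)[OF c z] by (simp add: piloc_def vloc_def)

text \<open>The derivatives of the base components of \<open>A\<close> and \<open>B\<close> cancel
  against the bracket. What remains depends on the values at \<open>u\<close> alone, so conditions
  on the torsion become algebraic conditions on the coefficients.\<close>

lemma torsion_chart:
  assumes c: "c \<in> M" and u: "u \<in> dom_of (lift c)"
    and A: "vector_field (slit_atlas M) A" and B: "vector_field (slit_atlas M) B"
  shows "torsion M D A B u c = coef c (coord (lift c) u) (A u (lift c)) (fst (B u (lift c)))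
    - coef c (coord (lift c) u) (B u (lift c)) (fst (A u (lift c)))"
proof -
  let ?z = "coord (lift c) u"
  note z = regionI[OF c u]
  have us: "u \<in> slit_bundle M" using u by (simp add: lift_dom)
  have 1: "cov D A (rho_f M B) u c = fst (dd (vloc c B) ?z (A u (lift c))) + coef c ?z (A u (lift c)) (fst (B u (lift c)))"
    if A: "vector_field (slit_atlas M) A" and B: "vector_field (slit_atlas M) B" for A B
  proof -
    have "dd (piloc c (rho_f M B)) ?z v = fst (dd (vloc c B) ?z v)" for v
    proof -
      have "dd (piloc c (rho_f M B)) ?z v = dd (\<lambda>z. fst (vloc c B z)) ?z v"
        by (rule dd_cong[OF open_region[OF c] z piloc_rho[OF B c]])
      also have "\<dots> = fst (dd (vloc c B) ?z v)"
        by (rule dd_eqI[OF has_derivative_fst[OF smooth_on_has_derivative[OF vec_smooth[OF B c] z]]])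
      finally show ?thesis .
    qed
    moreover have "rho_f M B u c = fst (B u (lift c))"
      unfolding rho_f_def by (rule rho_eq[OF c u vec_tangent[OF B us]])
    ultimately show ?thesis unfolding cov_chart[OF c u A pi_rho[OF B]] by simp
  qed
  have "rho_f M (lie_bracket (slit_atlas M) A B) u c = fst (lie_bracket (slit_atlas M) A B u (lift c))"
    unfolding rho_f_def by (rule rho_eq[OF c u vec_tangent[OF slit.lie_bracket_vector_field[OF A B] us]])
  then show ?thesis
    unfolding torsion_def using 1[OF A B] 1[OF B A] by (simp add: lie_chart[OF c u])
qed

lemma second_cov_chart:
  assumes c: "c \<in> M" and u: "u \<in> dom_of (lift c)"
    and A: "vector_field (slit_atlas M) A" and B: "vector_field (slit_atlas M) B" and Z: "pi_vector_field M Z"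
  defines "z \<equiv> coord (lift c) u" and "a \<equiv> A u (lift c)" and "b \<equiv> B u (lift c)" and "w \<equiv> Z u c"
  shows "cov D A (cov D B Z) u c =
    dd (\<lambda>x. dd (piloc c Z) x b) z a + dd (piloc c Z) z (dd (vloc c B) z a)
    + dd (\<lambda>x. coef c x b w) z a + coef c z (dd (vloc c B) z a) w + coef c z b (dd (piloc c Z) z a)
    + coef c z a (dd (piloc c Z) z b) + coef c z a (coef c z b w)"
proof -
  note O = open_region[OF c] and G = coef_bilinear[OF c]
  have z: "z \<in> region c" unfolding z_def by (rule regionI[OF c u])
  note sB = vec_smooth[OF B c] and sZ = pi_smooth[OF Z c]
  have b: "vloc c B z = b" "piloc c Z z = w"
    by (simp_all add: z_def b_def w_def vloc_coord[OF c u] piloc_coord[OF c u])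
  have s1: "smooth_on (region c) (\<lambda>x. dd (piloc c Z) x (vloc c B x))" by (rule smooth_on_dd_moving[OF O sZ sB])
  have s2: "smooth_on (region c) (\<lambda>x. coef c x (vloc c B x) (piloc c Z x))"
    by (rule smooth_on_bilinear_family[OF O G sB sZ])
  have "dd (piloc c (cov D B Z)) z a = dd (\<lambda>x. dd (piloc c Z) x (vloc c B x) + coef c x (vloc c B x) (piloc c Z x)) z a"
    by (rule dd_cong[OF O z piloc_cov[OF c _ B Z]])
  also have "\<dots> = dd (\<lambda>x. dd (piloc c Z) x (vloc c B x)) z a + dd (\<lambda>x. coef c x (vloc c B x) (piloc c Z x)) z a"
    by (rule dd_add[OF smooth_on_differentiable[OF s1 z] smooth_on_differentiable[OF s2 z]])
  also have "dd (\<lambda>x. dd (piloc c Z) x (vloc c B x)) z a = dd (\<lambda>x. dd (piloc c Z) x b) z a + dd (piloc c Z) z (dd (vloc c B) z a)"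
    by (rule dd_family[where T = "\<lambda>x v. dd (piloc c Z) x v" and f = "vloc c B", OF O z smooth_on_linear_dd[OF sZ]
        smooth_on_dd[OF sZ] smooth_on_differentiable[OF sB z], unfolded b])
  also have "dd (\<lambda>x. coef c x (vloc c B x) (piloc c Z x)) z a =
      dd (\<lambda>x. coef c x b w) z a + coef c z (dd (vloc c B) z a) w + coef c z b (dd (piloc c Z) z a)"
    by (rule dd_bilinear_family[where f = "vloc c B" and g = "piloc c Z", OF O z G sB sZ, unfolded b])
  finally have 1: "dd (piloc c (cov D B Z)) z a = dd (\<lambda>x. dd (piloc c Z) x b) z a + dd (piloc c Z) z (dd (vloc c B) z a)
      + (dd (\<lambda>x. coef c x b w) z a + coef c z (dd (vloc c B) z a) w + coef c z b (dd (piloc c Z) z a))" .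
  have "cov D B Z u c = dd (piloc c Z) z b + coef c z b w"
    unfolding z_def b_def w_def by (rule cov_chart[OF c u B Z])
  moreover have "cov D A (cov D B Z) u c = dd (piloc c (cov D B Z)) z a + coef c z a (cov D B Z u c)"
    unfolding z_def a_def by (rule cov_chart[OF c u A cov_pi[OF B Z]])
  ultimately show ?thesis
    unfolding 1 by (simp add: linear_add[OF smooth_bilinearD(2)[OF G z]])
qed

text \<open>On exchanging \<open>A\<close> and \<open>B\<close>, the second derivatives of
  \<open>Z\<close> cancel by symmetry, the mixed terms cancel in pairs, and the derivatives of
  \<open>A\<close> and \<open>B\<close> are absorbed by the bracket. The signs follow the convention
  of \<open>curvature\<close>.\<close>

theorem curvature_chart:
  assumes c: "c \<in> M" and u: "u \<in> dom_of (lift c)"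
    and A: "vector_field (slit_atlas M) A" and B: "vector_field (slit_atlas M) B" and Z: "pi_vector_field M Z"
  defines "z \<equiv> coord (lift c) u" and "a \<equiv> A u (lift c)" and "b \<equiv> B u (lift c)" and "w \<equiv> Z u c"
  shows "curvature M D A B Z u c = dd (\<lambda>x. coef c x a w) z b - dd (\<lambda>x. coef c x b w) z a
    + coef c z b (coef c z a w) - coef c z a (coef c z b w)"
proof -
  note O = open_region[OF c] and G = coef_bilinear[OF c]
  have z: "z \<in> region c" unfolding z_def by (rule regionI[OF c u])
  note sZ = pi_smooth[OF Z c]
  have "cov D (lie_bracket (slit_atlas M) A B) Z u c = dd (piloc c Z) z (dd (vloc c B) z a - dd (vloc c A) z b)
      + coef c z (dd (vloc c B) z a - dd (vloc c A) z b) w"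
    unfolding z_def a_def b_def w_def lie_chart[OF c u, symmetric]
    by (rule cov_chart[OF c u slit.lie_bracket_vector_field[OF A B] Z])
  then have "cov D (lie_bracket (slit_atlas M) A B) Z u c =
      dd (piloc c Z) z (dd (vloc c B) z a) - dd (piloc c Z) z (dd (vloc c A) z b)
      + coef c z (dd (vloc c B) z a) w - coef c z (dd (vloc c A) z b) w"
    by (simp add: linear_diff[OF smooth_on_linear_dd[OF sZ z]] linear_diff[OF smooth_bilinearD(1)[OF G z]])
  moreover have "dd (\<lambda>x. dd (piloc c Z) x b) z a = dd (\<lambda>x. dd (piloc c Z) x a) z b"
    by (rule dd_commute[OF O z sZ])
  ultimately show ?thesis
    unfolding curvature_def
    using second_cov_chart[OF c u A B Z] second_cov_chart[OF c u B A Z]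
    by (simp add: z_def a_def b_def w_def)
qed

lemma curvature_pi:
  assumes "vector_field (slit_atlas M) A" "vector_field (slit_atlas M) B" "pi_vector_field M Z"
  shows "pi_vector_field M (curvature M D A B Z)"
  unfolding curvature_def
  by (intro pi_add pi_minus cov_pi slit.lie_bracket_vector_field assms)

text \<open>The derivatives of the arguments \<open>X\<close>, \<open>Y\<close>, \<open>Z\<close>
  produced by the product rule are exactly those contained in their covariant derivatives. The form
  may stem from another connection than the one differentiating it, as happens in (b).\<close>

lemma cov_form3_chart:
  assumes c: "c \<in> M" and u: "u \<in> dom_of (lift c)" and A: "vector_field (slit_atlas M) A"
    and t: "smooth_trilinear (region c) t"
    and \<omega>: "\<And>X Y Z u. pi_vector_field M X \<Longrightarrow> pi_vector_field M Y \<Longrightarrow> pi_vector_field M Z \<Longrightarrow> u \<in> dom_of (lift c) \<Longrightarrow>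
      \<omega> X Y Z u = t (coord (lift c) u) (X u c) (Y u c) (Z u c)"
    and X: "pi_vector_field M X" and Y: "pi_vector_field M Y" and Z: "pi_vector_field M Z"
  defines "z \<equiv> coord (lift c) u" and "a \<equiv> A u (lift c)"
  shows "cov_form3 M D A \<omega> X Y Z u = dd (\<lambda>x. t x (X u c) (Y u c) (Z u c)) z a
    - t z (coef c z a (X u c)) (Y u c) (Z u c) - t z (X u c) (coef c z a (Y u c)) (Z u c)
    - t z (X u c) (Y u c) (coef c z a (Z u c))"
proof -
  note O = open_region[OF c] and T = smooth_trilinearD[OF t] and ps = pi_smooth[OF _ c]
  have z: "z \<in> region c" unfolding z_def by (rule regionI[OF c u])
  have us: "u \<in> slit_bundle M" using u by (simp add: lift_dom)
  have pl: "piloc c X z = X u c" for X by (simp add: z_def piloc_coord[OF c u])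
  have s: "smooth_on (region c) (\<lambda>x. t x (piloc c X x) (piloc c Y x) (piloc c Z x))"
    by (rule smooth_on_trilinear_family[OF O t ps[OF X] ps[OF Y] ps[OF Z]])
  have eq: "t x (piloc c X x) (piloc c Y x) (piloc c Z x) = \<omega> X Y Z (param (lift c) x)" if "x \<in> region c" for x
    using \<omega>[OF X Y Z region_point(1)[OF c that]] by (simp add: region_point(2)[OF c that] piloc_def)
  have "smooth_on (region c) (\<lambda>x. \<omega> X Y Z (param (lift c) x))"
    by (rule smooth_on_cong[OF O eq s])
  then have "dir_deriv (slit_atlas M) (\<omega> X Y Z) u (A u) = dd (\<lambda>x. \<omega> X Y Z (param (lift c) x)) z a"
    unfolding z_def a_def
    by (intro slit.dir_deriv_smooth[OF lift_in[OF c] u _ vec_tangent[OF A us]])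
      (simp add: smooth_in_chart_iff lift_region[OF c])
  also have "\<dots> = dd (\<lambda>x. t x (piloc c X x) (piloc c Y x) (piloc c Z x)) z a"
    by (rule dd_cong[OF O z eq[symmetric]])
  also have "\<dots> = dd (\<lambda>x. t x (X u c) (Y u c) (Z u c)) z a + t z (dd (piloc c X) z a) (Y u c) (Z u c)
      + t z (X u c) (dd (piloc c Y) z a) (Z u c) + t z (X u c) (Y u c) (dd (piloc c Z) z a)"
    by (rule dd_trilinear_family[where f = "piloc c X" and g = "piloc c Y" and h = "piloc c Z",
        OF O z t ps[OF X] ps[OF Y] ps[OF Z], unfolded pl])
  finally have 1: "dir_deriv (slit_atlas M) (\<omega> X Y Z) u (A u) = \<dots>" .
  have 2: "cov D A V u c = dd (piloc c V) z a + coef c z a (V u c)" if "pi_vector_field M V" for V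
    unfolding z_def a_def by (rule cov_chart[OF c u A that])
  show ?thesis
    unfolding cov_form3_def 1
    using \<omega>[OF cov_pi[OF A X] Y Z u] \<omega>[OF X cov_pi[OF A Y] Z u] \<omega>[OF X Y cov_pi[OF A Z] u]
    unfolding z_def[symmetric] 2[OF X] 2[OF Y] 2[OF Z]
    by (simp add: linear_add[OF T(1)[OF z]] linear_add[OF T(2)[OF z]] linear_add[OF T(3)[OF z]])
qed

lemma cov_tensor3_chart:
  assumes c: "c \<in> M" and u: "u \<in> dom_of (lift c)" and A: "vector_field (slit_atlas M) A"
    and t: "smooth_trilinear (region c) t"
    and \<omega>: "\<And>X Y Z u. pi_vector_field M X \<Longrightarrow> pi_vector_field M Y \<Longrightarrow> pi_vector_field M Z \<Longrightarrow> u \<in> dom_of (lift c) \<Longrightarrow>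
      \<omega> X Y Z u c = t (coord (lift c) u) (X u c) (Y u c) (Z u c)"
    and X: "pi_vector_field M X" and Y: "pi_vector_field M Y" and Z: "pi_vector_field M Z"
    and P: "pi_vector_field M (\<omega> X Y Z)"
  defines "z \<equiv> coord (lift c) u" and "a \<equiv> A u (lift c)"
  shows "cov_tensor3 D A \<omega> X Y Z u c = dd (\<lambda>x. t x (X u c) (Y u c) (Z u c)) z a
    + coef c z a (t z (X u c) (Y u c) (Z u c))
    - t z (coef c z a (X u c)) (Y u c) (Z u c) - t z (X u c) (coef c z a (Y u c)) (Z u c)
    - t z (X u c) (Y u c) (coef c z a (Z u c))"
proof -
  note O = open_region[OF c] and T = smooth_trilinearD[OF t] and ps = pi_smooth[OF _ c]
  have z: "z \<in> region c" unfolding z_def by (rule regionI[OF c u])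
  have pl: "piloc c X z = X u c" for X by (simp add: z_def piloc_coord[OF c u])
  have eq: "piloc c (\<omega> X Y Z) x = t x (piloc c X x) (piloc c Y x) (piloc c Z x)" if "x \<in> region c" for x
    using \<omega>[OF X Y Z region_point(1)[OF c that]] by (simp add: region_point(2)[OF c that] piloc_def)
  have "dd (piloc c (\<omega> X Y Z)) z a = dd (\<lambda>x. t x (piloc c X x) (piloc c Y x) (piloc c Z x)) z a"
    by (rule dd_cong[OF O z eq])
  also have "\<dots> = dd (\<lambda>x. t x (X u c) (Y u c) (Z u c)) z a + t z (dd (piloc c X) z a) (Y u c) (Z u c)
      + t z (X u c) (dd (piloc c Y) z a) (Z u c) + t z (X u c) (Y u c) (dd (piloc c Z) z a)"
    by (rule dd_trilinear_family[where f = "piloc c X" and g = "piloc c Y" and h = "piloc c Z",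
        OF O z t ps[OF X] ps[OF Y] ps[OF Z], unfolded pl])
  finally have 1: "dd (piloc c (\<omega> X Y Z)) z a = \<dots>" .
  have 2: "cov D A V u c = dd (piloc c V) z a + coef c z a (V u c)" if "pi_vector_field M V" for V
    unfolding z_def a_def by (rule cov_chart[OF c u A that])
  show ?thesis
    unfolding cov_tensor3_def
    using \<omega>[OF cov_pi[OF A X] Y Z u] \<omega>[OF X cov_pi[OF A Y] Z u] \<omega>[OF X Y cov_pi[OF A Z] u] \<omega>[OF X Y Z u]
    unfolding z_def[symmetric] 2[OF X] 2[OF Y] 2[OF Z]
    by (simp add: 2[OF P] 1 linear_add[OF T(1)[OF z]] linear_add[OF T(2)[OF z]] linear_add[OF T(3)[OF z]])
qed

end

section \<open>The Finsler metric and the connections in coordinates\<close>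

lemma smooth_bilinear_right:
  "smooth_bilinear S G \<Longrightarrow> x \<in> S \<Longrightarrow> G x a 0 = 0" "smooth_bilinear S G \<Longrightarrow> x \<in> S \<Longrightarrow> G x 0 w = 0"
  using linear_0[OF smooth_bilinearD(1)] linear_0[OF smooth_bilinearD(2)] by auto

lemma smooth_bilinear_dd:
  assumes "open S" "smooth_bilinear S G"
  shows "x \<in> S \<Longrightarrow> linear (\<lambda>a. dd (\<lambda>x. G x a w) x v)" "x \<in> S \<Longrightarrow> linear (\<lambda>w. dd (\<lambda>x. G x a w) x v)"
proof -
  note B = smooth_bilinearD[OF assms(2)]
  show "linear (\<lambda>a. dd (\<lambda>x. G x a w) x v)" if "x \<in> S"
    by (rule linear_dd_family[where T = "\<lambda>x a. G x a w", OF assms(1) that B(1,3)])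
  show "linear (\<lambda>w. dd (\<lambda>x. G x a w) x v)" if "x \<in> S"
    by (rule linear_dd_family[where T = "\<lambda>x w. G x a w", OF assms(1) that B(2,3)])
qed

lemma linear_comp: "linear f \<Longrightarrow> linear g \<Longrightarrow> linear (\<lambda>x. g (f x))"
  using linear_compose[of f g] by (simp add: o_def)

lemma linear_Pair0: "linear (\<lambda>v::'b::real_vector. (0::'a::real_vector, v))" "linear (\<lambda>v::'b. (v, 0::'a))"
  by (auto intro!: linearI)

locale local_finsler =
  fixes S :: "('e::euclidean_space \<times> 'e) set" and E :: "'e \<times> 'e \<Rightarrow> real"
  assumes open_S: "open S" and smooth_E: "smooth_on S E"
    and homogeneous: "\<And>z r. z \<in> S \<Longrightarrow> r > 0 \<Longrightarrow> E (fst z, r *\<^sub>R snd z) = r\<^sup>2 * E z"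
begin

definition g :: "'e \<times> 'e \<Rightarrow> 'e \<Rightarrow> 'e \<Rightarrow> real" where
  "g z v w = dd (\<lambda>x. dd E x (0, w)) z (0, v)"

text \<open>Twice the Cartan tensor, that is, the third fibre derivative of the energy; therefore
  symmetric in all three arguments.\<close>

definition g3 :: "'e \<times> 'e \<Rightarrow> 'e \<Rightarrow> 'e \<Rightarrow> 'e \<Rightarrow> real" where
  "g3 z a v w = dd (\<lambda>x. g x v w) z (0, a)"

text \<open>The mixed second derivative of the energy, once along the base direction
  \<open>X\<close> and once along the fibre direction \<open>w\<close>.\<close>

definition h :: "'e \<times> 'e \<Rightarrow> 'e \<Rightarrow> 'e \<Rightarrow> real" where
  "h z X w = dd (\<lambda>x. dd E x (0, w)) z (X, 0)"

lemma smooth_E1: "smooth_on S (\<lambda>x. dd E x b)"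
  by (rule smooth_on_dd[OF smooth_E])

lemma linear_E1: "z \<in> S \<Longrightarrow> linear (\<lambda>b. dd E z b)"
  by (rule smooth_on_linear_dd[OF smooth_E])

lemma linear_E1_vertical: "z \<in> S \<Longrightarrow> linear (\<lambda>w. dd E z (0, w))"
  by (rule linear_comp[OF linear_Pair0(1) linear_E1])

lemma g_bilinear: "smooth_bilinear S g"
  unfolding smooth_bilinear_def g_def[abs_def]
proof (intro conjI ballI allI)
  show "linear (\<lambda>a. dd (\<lambda>x. dd E x (0, w)) z (0, a))" if "z \<in> S" for z w
    by (rule linear_comp[OF linear_Pair0(1) smooth_on_linear_dd[OF smooth_E1 that]])
  show "linear (\<lambda>w. dd (\<lambda>x. dd E x (0, w)) z (0, a))" if "z \<in> S" for z a
    by (rule linear_dd_family[where T = "\<lambda>x w. dd E x (0, w)", OF open_S that linear_E1_vertical smooth_E1])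
  show "smooth_on S (\<lambda>x. dd (\<lambda>x. dd E x (0, w)) x (0, a))" for a w
    by (rule smooth_on_dd[OF smooth_E1])
qed

lemmas g_smooth = smooth_bilinearD(3)[OF g_bilinear]
lemmas g_linear = smooth_bilinearD(1,2)[OF g_bilinear]

lemma g_sym: "z \<in> S \<Longrightarrow> g z v w = g z w v"
  unfolding g_def by (rule dd_commute[OF open_S _ smooth_E])

lemma g3_trilinear: "smooth_trilinear S g3"
proof (rule smooth_trilinearI)
  show "linear (\<lambda>a. g3 x a b w)" if "x \<in> S" for x b w
    unfolding g3_def by (rule linear_comp[OF linear_Pair0(1) smooth_on_linear_dd[OF g_smooth that]])
  show "linear (\<lambda>b. g3 x a b w)" "linear (\<lambda>w. g3 x a b w)" if "x \<in> S" for x a b w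
    unfolding g3_def by (rule smooth_bilinear_dd[OF open_S g_bilinear that])+
  show "smooth_on S (\<lambda>x. g3 x a b w)" for a b w
    unfolding g3_def by (rule smooth_on_dd[OF g_smooth])
qed

lemmas g3_linear = smooth_trilinearD(1-3)[OF g3_trilinear]
lemmas g3_smooth = smooth_trilinearD(4)[OF g3_trilinear]

lemma g3_swap23: "z \<in> S \<Longrightarrow> g3 z a b c = g3 z a c b"
  unfolding g3_def by (rule dd_cong[OF open_S _ g_sym])

lemma g3_swap12: "z \<in> S \<Longrightarrow> g3 z a b c = g3 z b a c"
  unfolding g3_def g_def by (rule dd_commute[OF open_S _ smooth_E1])

text \<open>Both sides are the derivative at \<open>s = 0\<close> of the energy along
  \<open>(x, (1 + s) y)\<close>. The comparison is made for \<open>s > -1\<close>, where the factor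
  \<open>1 + s\<close> is positive.\<close>

lemma euler1:
  assumes "z \<in> S"
  shows "dd E z (0, snd z) = 2 * E z"
proof -
  have "E differentiable (at (z + 0 *\<^sub>R (0, snd z)))"
    using smooth_on_differentiable[OF smooth_E assms] by (simp flip: zero_prod_def)
  from has_real_derivative_line[OF this]
  have 1: "((\<lambda>s. E (z + s *\<^sub>R (0, snd z))) has_real_derivative dd E z (0, snd z)) (at 0)"
    by (simp flip: zero_prod_def)
  have "((\<lambda>s. (1 + s)\<^sup>2 * E z) has_real_derivative 2 * E z) (at 0)"
    by (auto intro!: derivative_eq_intros)
  then have "((\<lambda>s. E (z + s *\<^sub>R (0, snd z))) has_real_derivative 2 * E z) (at 0)"
  proof (rule has_field_derivative_transform_within_open[of _ _ _ "{-1<..}"])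
    fix s :: real assume "s \<in> {-1<..}"
    moreover have "z + s *\<^sub>R (0, snd z) = (fst z, (1 + s) *\<^sub>R snd z)"
      by (cases z) (simp add: scaleR_add_left)
    ultimately show "(1 + s)\<^sup>2 * E z = E (z + s *\<^sub>R (0, snd z))"
      using homogeneous[OF assms, of "1 + s"] by simp
  qed auto
  with 1 show ?thesis by (rule DERIV_unique)
qed

lemma dd_vertical_part:
  "dd (\<lambda>x::'e \<times> 'e. (0::'e, snd x)) z b = (0, snd b)" "(\<lambda>x::'e \<times> 'e. (0::'e, snd x)) differentiable (at z)"
    "dd snd z b = (snd b :: 'e)" "(snd :: 'e \<times> 'e \<Rightarrow> 'e) differentiable (at z)"
proof -
  have "((\<lambda>x::'e \<times> 'e. (0::'e, snd x)) has_derivative (\<lambda>b. (0, snd b))) (at z)"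
    by (intro has_derivative_Pair has_derivative_const has_derivative_snd has_derivative_ident)
  then show "dd (\<lambda>x::'e \<times> 'e. (0::'e, snd x)) z b = (0, snd b)" "(\<lambda>x::'e \<times> 'e. (0::'e, snd x)) differentiable (at z)"
    by (rule dd_eqI, rule differentiableI)
  have "((snd :: 'e \<times> 'e \<Rightarrow> 'e) has_derivative snd) (at z)"
    by (rule bounded_linear_imp_has_derivative[OF bounded_linear_snd])
  then show "dd snd z b = (snd b :: 'e)" "(snd :: 'e \<times> 'e \<Rightarrow> 'e) differentiable (at z)"
    by (rule dd_eqI, rule differentiableI)
qed

lemma smooth_snd: "smooth_on S snd"
  by (rule smooth_on_linear[OF bounded_linear_snd open_S])

text \<open>The derivative of \<open>euler1\<close> in an arbitrary direction \<open>b\<close>. A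
  vertical \<open>b\<close> gives \<open>g_radial\<close>, a horizontal one gives
  \<open>h_radial\<close>.\<close>

lemma euler2:
  assumes "z \<in> S"
  shows "dd (\<lambda>x. dd E x b) z (0, snd z) + dd E z (0, snd b) = 2 * dd E z b"
proof -
  have "dd (\<lambda>x. dd E x (0, snd x)) z b = dd (\<lambda>x. dd E x (0, snd z)) z b + dd E z (dd (\<lambda>x. (0, snd x)) z b)"
    by (rule dd_family[where T = "\<lambda>x b. dd E x b", OF open_S assms linear_E1 smooth_E1 dd_vertical_part(2)])
  moreover have "dd (\<lambda>x. dd E x (0, snd x)) z b = dd (\<lambda>x. 2 * E x) z b"
    by (rule dd_cong[OF open_S assms euler1])
  moreover have "dd (\<lambda>x. 2 * E x) z b = 2 * dd E z b"
    by (rule dd_eqI[OF has_derivative_mult_right[OF smooth_on_has_derivative[OF smooth_E assms]]])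
  moreover have "dd (\<lambda>x. dd E x (0, snd z)) z b = dd (\<lambda>x. dd E x b) z (0, snd z)"
    by (rule dd_commute[OF open_S assms smooth_E])
  ultimately show ?thesis by (simp add: dd_vertical_part)
qed

lemma g_radial: "z \<in> S \<Longrightarrow> g z (snd z) w = dd E z (0, w)"
  using euler2[of z "(0, w)"] by (simp add: g_def)

lemma h_radial: "z \<in> S \<Longrightarrow> h z X (snd z) = 2 * dd E z (X, 0)"
  using euler2[of z "(X, 0)"] linear_0[OF linear_E1, of z] dd_commute[OF open_S _ smooth_E, of z "(0, snd z)" "(X, 0)"]
  by (simp add: h_def flip: zero_prod_def)

text \<open>The derivative of \<open>g_radial\<close>, with the radial slot frozen in the first
  term. A vertical \<open>b\<close> shows that \<open>g3\<close> annihilates the radial vector, a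
  horizontal one identifies the derivative of \<open>g\<close> with \<open>h\<close>.\<close>

lemma g_radial_deriv:
  assumes "z \<in> S"
  shows "dd (\<lambda>x. g x (snd z) w) z b + g z (snd b) w = dd (\<lambda>x. dd E x (0, w)) z b"
proof -
  have "dd (\<lambda>x. g x (snd x) w) z b = dd (\<lambda>x. g x (snd z) w) z b + g z (dd snd z b) w"
    by (rule dd_family[where T = "\<lambda>x v. g x v w", OF open_S assms g_linear(1) g_smooth dd_vertical_part(4)])
  moreover have "dd (\<lambda>x. g x (snd x) w) z b = dd (\<lambda>x. dd E x (0, w)) z b"
    by (rule dd_cong[OF open_S assms g_radial])
  ultimately show ?thesis by (simp add: dd_vertical_part)
qed

lemma g3_radial: "z \<in> S \<Longrightarrow> g3 z a (snd z) w = 0"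
  using g_radial_deriv[of z w "(0, a)"] by (simp add: g3_def g_def)

lemma h_eq: "z \<in> S \<Longrightarrow> dd (\<lambda>x. g x (snd z) w) z (X, 0) = h z X w"
  using g_radial_deriv[of z w "(X, 0)"] linear_0[OF g_linear(1), of z w] by (simp add: h_def)

lemma dd_neg:
  assumes "smooth_on S f" "z \<in> S"
  shows "dd f z (X, - v) = dd f z (X, 0) - dd f z (0, v)"
  using linear_diff[OF smooth_on_linear_dd[OF assms], of "(X, 0)" "(0, v)"] by simp

end

section \<open>The Berwald coefficients in one chart\<close>

locale local_berwald = local_finsler S E for S :: "('e::euclidean_space \<times> 'e) set" and E +
  fixes G :: "'e \<times> 'e \<Rightarrow> 'e \<times> 'e \<Rightarrow> 'e \<Rightarrow> 'e"
  assumes G: "smooth_bilinear S G"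
    and G_torsion: "\<And>z a b. z \<in> S \<Longrightarrow> G z a (fst b) = G z b (fst a)"
    and G_hat: "\<And>z X Y. z \<in> S \<Longrightarrow> dd (\<lambda>x. G x (X, 0) (snd z)) z (0, Y) = 0"
    and G_energy: "\<And>z X. z \<in> S \<Longrightarrow> dd E z (X, - G z (X, 0) (snd z)) = 0"
begin

definition \<Gamma> :: "'e \<times> 'e \<Rightarrow> 'e \<Rightarrow> 'e \<Rightarrow> 'e" where "\<Gamma> z X Y = G z (X, 0) Y"
text \<open>The coefficients of the nonlinear connection: \<open>(X, - N z X)\<close> is the
  horizontal lift of \<open>X\<close>, and \<open>G_energy\<close> says that the energy is constant
  along it.\<close>

definition N :: "'e \<times> 'e \<Rightarrow> 'e \<Rightarrow> 'e" where "N z X = \<Gamma> z X (snd z)"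
definition P :: "'e \<times> 'e \<Rightarrow> 'e \<Rightarrow> 'e \<Rightarrow> 'e \<Rightarrow> 'e" where "P z X Y Z = dd (\<lambda>x. \<Gamma> x X Z) z (0, Y)"

lemma G_vertical: "z \<in> S \<Longrightarrow> G z (0, v) w = 0"
  using G_torsion[of z "(0, v)" "(w, 0)"] smooth_bilinear_right(1)[OF G] by simp

lemma G_eq: "z \<in> S \<Longrightarrow> G z a w = \<Gamma> z (fst a) w"
  using linear_add[OF smooth_bilinearD(1)[OF G], of z "(fst a, 0)" "(0, snd a)" w] G_vertical
  by (simp add: \<Gamma>_def)

lemma christoffel_bilinear: "smooth_bilinear S \<Gamma>"
  unfolding smooth_bilinear_def \<Gamma>_def
  using smooth_bilinearD[OF G] linear_comp[OF linear_Pair0(2) smooth_bilinearD(1)[OF G]] by auto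

lemmas christoffel_linear = smooth_bilinearD(1,2)[OF christoffel_bilinear]
lemmas christoffel_smooth = smooth_bilinearD(3)[OF christoffel_bilinear]

lemma christoffel_sym: "z \<in> S \<Longrightarrow> \<Gamma> z X Y = \<Gamma> z Y X"
  using G_torsion[of z "(X, 0)" "(Y, 0)"] by (simp add: \<Gamma>_def)

lemma N_smooth: "smooth_on S (\<lambda>x. N x X)"
  unfolding N_def by (rule smooth_on_bilinear_family[OF open_S christoffel_bilinear smooth_on_const smooth_snd])

lemma dd_N: "z \<in> S \<Longrightarrow> dd (\<lambda>x. N x X) z (0, Y) = \<Gamma> z X Y"
  using dd_family[where T = "\<lambda>x w. \<Gamma> x X w", OF open_S _ christoffel_linear(2) christoffel_smooth dd_vertical_part(4), of z "(0, Y)"]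
    G_hat[of z X Y] by (simp add: N_def dd_vertical_part \<Gamma>_def)

lemma P_trilinear: "smooth_trilinear S P"
proof (rule smooth_trilinearI)
  show "linear (\<lambda>a. P x a b w)" "linear (\<lambda>w. P x a b w)" if "x \<in> S" for x a b w
    unfolding P_def by (rule smooth_bilinear_dd[OF open_S christoffel_bilinear that])+
  show "linear (\<lambda>b. P x a b w)" if "x \<in> S" for x a w
    unfolding P_def by (rule linear_comp[OF linear_Pair0(1) smooth_on_linear_dd[OF christoffel_smooth that]])
  show "smooth_on S (\<lambda>x. P x a b w)" for a b w
    unfolding P_def by (rule smooth_on_dd[OF christoffel_smooth])
qed

lemma P_swap13: "z \<in> S \<Longrightarrow> P z X Y Z = P z Z Y X"
  unfolding P_def by (rule dd_cong[OF open_S _ christoffel_sym])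

lemma P_swap23: "z \<in> S \<Longrightarrow> P z X Y Z = P z X Z Y"
proof -
  assume z: "z \<in> S"
  have "P z X Y Z = dd (\<lambda>x. dd (\<lambda>x. N x X) x (0, Z)) z (0, Y)" for Y Z
    unfolding P_def by (rule dd_cong[OF open_S z dd_N[symmetric]])
  then show ?thesis using dd_commute[OF open_S z N_smooth, of X] by simp
qed

lemma P_swap12: "z \<in> S \<Longrightarrow> P z X Y Z = P z Y X Z"
  by (metis P_swap13 P_swap23)

lemma dd_P_swap: "z \<in> S \<Longrightarrow> dd (\<lambda>x. P x Y Z W) z (0, X) = dd (\<lambda>x. P x Y X W) z (0, Z)"
  unfolding P_def by (rule dd_commute[OF open_S _ christoffel_smooth])

lemma P_radial: "z \<in> S \<Longrightarrow> P z X Y (snd z) = 0"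
  unfolding P_def \<Gamma>_def by (rule G_hat)

text \<open>Differentiating \<open>P x X (snd x) Z = 0\<close> vertically along \<open>Y\<close>
  leaves \<open>P z X Y Z\<close> plus a derivative of \<open>P\<close> in direction
  \<open>Y\<close> with the radial vector in the middle slot. \<open>dd_P_swap\<close> exchanges
  that slot with the direction.\<close>

lemma dd_P_radial:
  assumes "z \<in> S"
  shows "dd (\<lambda>x. P x X Y Z) z (0, snd z) = - P z X Y Z"
proof -
  note PT = smooth_trilinearD[OF P_trilinear]
  have "dd (\<lambda>x. P x X (snd x) Z) z (0, Y) = dd (\<lambda>x. P x X (snd z) Z) z (0, Y) + P z X (dd snd z (0, Y)) Z"
    by (rule dd_family[where T = "\<lambda>x b. P x X b Z", OF open_S assms PT(2,4) dd_vertical_part(4)])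
  moreover have "dd (\<lambda>x. P x X (snd x) Z) z (0, Y) = dd (\<lambda>x. 0) z (0, Y)"
    by (rule dd_cong[OF open_S assms]) (metis P_swap23 P_radial)
  ultimately have "dd (\<lambda>x. P x X (snd z) Z) z (0, Y) + P z X Y Z = 0"
    by (simp add: dd_vertical_part)
  then show ?thesis using dd_P_swap[OF assms, of X Y Z "snd z"] by (simp add: eq_neg_iff_add_eq_0)
qed

lemma energy_horizontal: "z \<in> S \<Longrightarrow> dd E z (X, 0) = dd E z (0, N z X)"
  using G_energy[of z X] dd_neg[OF smooth_E, of z X "N z X"] by (simp add: N_def \<Gamma>_def)

text \<open>The vertical derivative of \<open>energy_horizontal\<close>; differentiating
  \<open>N\<close> in the fibre produces \<open>\<Gamma>\<close>.\<close>

lemma h_formula: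
  assumes "z \<in> S"
  shows "h z X Y = g z Y (N z X) + dd E z (0, \<Gamma> z X Y)"
proof -
  have "h z X Y = dd (\<lambda>x. dd E x (X, 0)) z (0, Y)"
    unfolding h_def by (rule dd_commute[OF open_S assms smooth_E])
  also have "\<dots> = dd (\<lambda>x. dd E x (0, N x X)) z (0, Y)"
    by (rule dd_cong[OF open_S assms energy_horizontal])
  also have "\<dots> = dd (\<lambda>x. dd E x (0, N z X)) z (0, Y) + dd E z (0, dd (\<lambda>x. N x X) z (0, Y))"
    by (rule dd_family[where T = "\<lambda>x w. dd E x (0, w)" and f = "\<lambda>x. N x X", OF open_S assms linear_E1_vertical smooth_E1
          smooth_on_differentiable[OF N_smooth assms]])
  finally show ?thesis by (simp add: dd_N[OF assms] g_def)
qed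

text \<open>For radial \<open>X\<close> the symmetry of \<open>\<Gamma>\<close> turns the last term
  of \<open>h_formula\<close> into \<open>N z Y\<close>, and \<open>energy_horizontal\<close>
  removes it. The right-hand side now depends on the energy alone: this is the equation of the
  geodesic spray.\<close>

lemma spray_formula:
  assumes "z \<in> S"
  shows "g z (N z (snd z)) Y = h z (snd z) Y - dd E z (Y, 0)"
  using h_formula[OF assms, of "snd z" Y] energy_horizontal[OF assms, of Y] christoffel_sym[OF assms, of "snd z" Y]
    g_sym[OF assms, of Y "N z (snd z)"] by (simp add: N_def)

lemma h_smooth: "smooth_on S (\<lambda>x. h x X w)"
  unfolding h_def by (rule smooth_on_dd[OF smooth_E1])

lemma h_linear: "x \<in> S \<Longrightarrow> linear (\<lambda>X. h x X w)"
  unfolding h_def by (rule linear_comp[OF linear_Pair0(2) smooth_on_linear_dd[OF smooth_E1]])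

lemma dd_h: "z \<in> S \<Longrightarrow> dd (\<lambda>x. h x X w) z (0, v) = dd (\<lambda>x. g x v w) z (X, 0)"
  unfolding h_def g_def by (rule dd_commute[OF open_S _ smooth_E1])

text \<open>The vertical derivative of \<open>spray_formula\<close>. It expresses \<open>N\<close>
  through the energy and its already determined radial value, in the same form in which the Koszul
  formula yields \<open>Nc\<close>.\<close>

lemma N_formula:
  assumes z: "z \<in> S"
  shows "2 * g z (N z X) Y = h z X Y + dd (\<lambda>x. g x X Y) z (snd z, 0) - g3 z (N z (snd z)) X Y - h z Y X"
proof -
  have sN: "smooth_on S (\<lambda>x. N x (snd x))"
    unfolding N_def by (rule smooth_on_bilinear_family[OF open_S christoffel_bilinear smooth_snd smooth_snd])
  \<comment> \<open>The factor 2 has two sources: \<open>N\<close> has vertical derivative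
    \<open>\<Gamma> z (snd z) X\<close>, which is \<open>N z X\<close> by symmetry, and its argument
    \<open>snd x\<close> also varies.\<close>
  have N2: "dd (\<lambda>x. N x (snd x)) z (0, X) = 2 *\<^sub>R N z X"
  proof -
    have l: "linear (\<lambda>Y. N x Y)" if "x \<in> S" for x unfolding N_def by (rule christoffel_linear(1)[OF that])
    have "dd (\<lambda>x. N x (snd x)) z (0, X) = dd (\<lambda>x. N x (snd z)) z (0, X) + N z (dd snd z (0, X))"
      by (rule dd_family[where T = "\<lambda>x Y. N x Y", OF open_S z l N_smooth dd_vertical_part(4)])
    then show ?thesis
      using christoffel_sym[OF z, of "snd z" X] by (simp add: dd_N[OF z] dd_vertical_part N_def[of z X] scaleR_2)
  qed
  have "dd (\<lambda>x. g x (N x (snd x)) Y) z (0, X) =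
      dd (\<lambda>x. g x (N z (snd z)) Y) z (0, X) + g z (dd (\<lambda>x. N x (snd x)) z (0, X)) Y"
    by (rule dd_family[where T = "\<lambda>x v. g x v Y" and f = "\<lambda>x. N x (snd x)", OF open_S z g_linear(1) g_smooth smooth_on_differentiable[OF sN z]])
  also have "\<dots> = g3 z (N z (snd z)) X Y + 2 * g z (N z X) Y"
    using g3_swap12[OF z, of X "N z (snd z)" Y] by (simp add: N2 linear_scale[OF g_linear(1)[OF z]] g3_def)
  finally have 1: "dd (\<lambda>x. g x (N x (snd x)) Y) z (0, X) = g3 z (N z (snd z)) X Y + 2 * g z (N z X) Y" .
  have sh: "smooth_on S (\<lambda>x. h x (snd x) Y)"
    by (rule smooth_on_family[where T = "\<lambda>x X. h x X Y", OF open_S h_linear h_smooth smooth_snd])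
  have "dd (\<lambda>x. g x (N x (snd x)) Y) z (0, X) = dd (\<lambda>x. h x (snd x) Y - dd E x (Y, 0)) z (0, X)"
    by (rule dd_cong[OF open_S z spray_formula])
  also have "\<dots> = dd (\<lambda>x. h x (snd x) Y) z (0, X) - dd (\<lambda>x. dd E x (Y, 0)) z (0, X)"
    by (rule dd_diff[OF smooth_on_differentiable[OF sh z] smooth_on_differentiable[OF smooth_E1 z]])
  also have "dd (\<lambda>x. h x (snd x) Y) z (0, X) = dd (\<lambda>x. h x (snd z) Y) z (0, X) + h z (dd snd z (0, X)) Y"
    by (rule dd_family[where T = "\<lambda>x X. h x X Y", OF open_S z h_linear h_smooth dd_vertical_part(4)])
  also have "dd (\<lambda>x. dd E x (Y, 0)) z (0, X) = h z Y X"
    unfolding h_def by (rule dd_commute[OF open_S z smooth_E])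
  finally show ?thesis using 1 by (simp add: dd_h[OF z] dd_vertical_part)
qed

text \<open>The Berwald derivative of \<open>g\<close> along the horizontal lift of \<open>X\<close>, the Landsberg tensor up to a factor.\<close>

definition \<sigma> :: "'e \<times> 'e \<Rightarrow> 'e \<Rightarrow> 'e \<Rightarrow> 'e \<Rightarrow> real" where
  "\<sigma> z X Z W = dd (\<lambda>x. g x Z W) z (X, 0) - g3 z (N z X) Z W - g z (\<Gamma> z X Z) W - g z Z (\<Gamma> z X W)"

text \<open>One more vertical derivative of \<open>h_formula\<close>: all resulting terms except the
  derivative of \<open>\<Gamma>\<close> are those subtracted in \<open>\<sigma>\<close>. The
  symmetries of \<open>P\<close> thereby pass to \<open>\<sigma>\<close>.\<close>

lemma landsberg_eq:
  assumes z: "z \<in> S"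
  shows "\<sigma> z X Z W = dd E z (0, P z X W Z)"
proof -
  have s1: "smooth_on S (\<lambda>x. g x Z (N x X))"
    by (rule smooth_on_bilinear_family[OF open_S g_bilinear smooth_on_const N_smooth])
  have s2: "smooth_on S (\<lambda>x. dd E x (0, \<Gamma> x X Z))"
    by (rule smooth_on_family[where T = "\<lambda>x w. dd E x (0, w)", OF open_S linear_E1_vertical smooth_E1 christoffel_smooth])
  have "dd (\<lambda>x. g x W Z) z (X, 0) = dd (\<lambda>x. h x X Z) z (0, W)" by (rule dd_h[OF z, symmetric])
  also have "\<dots> = dd (\<lambda>x. g x Z (N x X) + dd E x (0, \<Gamma> x X Z)) z (0, W)"
    by (rule dd_cong[OF open_S z h_formula])
  also have "\<dots> = dd (\<lambda>x. g x Z (N x X)) z (0, W) + dd (\<lambda>x. dd E x (0, \<Gamma> x X Z)) z (0, W)"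
    by (rule dd_add[OF smooth_on_differentiable[OF s1 z] smooth_on_differentiable[OF s2 z]])
  also have "dd (\<lambda>x. g x Z (N x X)) z (0, W) = dd (\<lambda>x. g x Z (N z X)) z (0, W) + g z Z (dd (\<lambda>x. N x X) z (0, W))"
    by (rule dd_family[where T = "\<lambda>x w. g x Z w" and f = "\<lambda>x. N x X", OF open_S z g_linear(2) g_smooth smooth_on_differentiable[OF N_smooth z]])
  also have "dd (\<lambda>x. dd E x (0, \<Gamma> x X Z)) z (0, W) = dd (\<lambda>x. dd E x (0, \<Gamma> z X Z)) z (0, W) + dd E z (0, dd (\<lambda>x. \<Gamma> x X Z) z (0, W))"
    by (rule dd_family[where T = "\<lambda>x w. dd E x (0, w)" and f = "\<lambda>x. \<Gamma> x X Z", OF open_S z linear_E1_vertical smooth_E1 smooth_on_differentiable[OF christoffel_smooth z]])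
  finally have 1: "dd (\<lambda>x. g x W Z) z (X, 0) = g3 z W Z (N z X) + g z Z (\<Gamma> z X W) + (g z W (\<Gamma> z X Z) + dd E z (0, P z X W Z))"
    by (simp add: dd_N[OF z] g3_def P_def g_def[of z W "\<Gamma> z X Z"])
  have 2: "dd (\<lambda>x. g x W Z) z (X, 0) = dd (\<lambda>x. g x Z W) z (X, 0)" by (rule dd_cong[OF open_S z g_sym])
  have "g3 z W Z (N z X) = g3 z (N z X) Z W" by (metis g3_swap12[OF z] g3_swap23[OF z])
  with 1 2 show ?thesis using g_sym[OF z, of W "\<Gamma> z X Z"] by (simp add: \<sigma>_def)
qed

lemma landsberg_sym: "z \<in> S \<Longrightarrow> \<sigma> z X Z W = \<sigma> z Z X W" "z \<in> S \<Longrightarrow> \<sigma> z X Z W = \<sigma> z X W Z"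
  using P_swap13[of z X W Z] P_swap23[of z X W Z] by (simp_all add: landsberg_eq)

text \<open>A Ricci identity for \<open>g\<close>: apart from the two terms with \<open>P\<close>,
  which come from differentiating \<open>\<Gamma>\<close>, the right-hand side is the Berwald
  derivative of \<open>g3\<close> along the horizontal lift of \<open>X\<close>.\<close>

lemma dd_landsberg:
  assumes z: "z \<in> S"
  shows "dd (\<lambda>x. \<sigma> x X Z W) z (0, Y) = dd (\<lambda>x. g3 x Y Z W) z (X, 0) - dd (\<lambda>x. g3 x Y Z W) z (0, N z X)
    - g3 z (\<Gamma> z X Y) Z W - g3 z Y (\<Gamma> z X Z) W - g3 z Y Z (\<Gamma> z X W) - g z (P z X Y Z) W - g z Z (P z X Y W)"
proof -
  note d = smooth_on_differentiable[OF _ z]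
  have s1: "smooth_on S (\<lambda>x. dd (\<lambda>x. g x Z W) x (X, 0))" by (rule smooth_on_dd[OF g_smooth])
  have s2: "smooth_on S (\<lambda>x. g3 x (N x X) Z W)"
    by (rule smooth_on_trilinear_family[OF open_S g3_trilinear N_smooth smooth_on_const smooth_on_const])
  have s3: "smooth_on S (\<lambda>x. g x (\<Gamma> x X Z) W)"
    by (rule smooth_on_bilinear_family[OF open_S g_bilinear christoffel_smooth smooth_on_const])
  have s4: "smooth_on S (\<lambda>x. g x Z (\<Gamma> x X W))"
    by (rule smooth_on_bilinear_family[OF open_S g_bilinear smooth_on_const christoffel_smooth])
  have "((\<lambda>x. dd (\<lambda>x. g x Z W) x (X, 0) - g3 x (N x X) Z W - g x (\<Gamma> x X Z) W - g x Z (\<Gamma> x X W)) has_derivative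
      (\<lambda>v. dd (\<lambda>x. dd (\<lambda>x. g x Z W) x (X, 0)) z v - dd (\<lambda>x. g3 x (N x X) Z W) z v - dd (\<lambda>x. g x (\<Gamma> x X Z) W) z v
        - dd (\<lambda>x. g x Z (\<Gamma> x X W)) z v)) (at z)"
    by (intro has_derivative_diff has_derivative_dd d[OF s1] d[OF s2] d[OF s3] d[OF s4])
  from dd_eqI[OF this, of "(0, Y)"]
  have 0: "dd (\<lambda>x. \<sigma> x X Z W) z (0, Y) = dd (\<lambda>x. dd (\<lambda>x. g x Z W) x (X, 0)) z (0, Y) - dd (\<lambda>x. g3 x (N x X) Z W) z (0, Y)
      - dd (\<lambda>x. g x (\<Gamma> x X Z) W) z (0, Y) - dd (\<lambda>x. g x Z (\<Gamma> x X W)) z (0, Y)"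
    unfolding \<sigma>_def .
  have 1: "dd (\<lambda>x. dd (\<lambda>x. g x Z W) x (X, 0)) z (0, Y) = dd (\<lambda>x. g3 x Y Z W) z (X, 0)"
    unfolding g3_def by (rule dd_commute[OF open_S z g_smooth])
  have "dd (\<lambda>x. g3 x (N x X) Z W) z (0, Y) = dd (\<lambda>x. g3 x (N z X) Z W) z (0, Y) + g3 z (dd (\<lambda>x. N x X) z (0, Y)) Z W"
    by (rule dd_family[where T = "\<lambda>x a. g3 x a Z W" and f = "\<lambda>x. N x X", OF open_S z g3_linear(1) g3_smooth d[OF N_smooth]])
  moreover have "dd (\<lambda>x. g3 x (N z X) Z W) z (0, Y) = dd (\<lambda>x. g3 x Y Z W) z (0, N z X)"
    unfolding g3_def by (rule dd_commute[OF open_S z g_smooth])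
  ultimately have 2: "dd (\<lambda>x. g3 x (N x X) Z W) z (0, Y) = dd (\<lambda>x. g3 x Y Z W) z (0, N z X) + g3 z (\<Gamma> z X Y) Z W"
    by (simp add: dd_N[OF z])
  have 3: "dd (\<lambda>x. g x (\<Gamma> x X Z) W) z (0, Y) = g3 z Y (\<Gamma> z X Z) W + g z (P z X Y Z) W"
    unfolding g3_def P_def
    by (rule dd_family[where T = "\<lambda>x a. g x a W" and f = "\<lambda>x. \<Gamma> x X Z", OF open_S z g_linear(1) g_smooth d[OF christoffel_smooth]])
  have 4: "dd (\<lambda>x. g x Z (\<Gamma> x X W)) z (0, Y) = g3 z Y Z (\<Gamma> z X W) + g z Z (P z X Y W)"
    unfolding g3_def P_def
    by (rule dd_family[where T = "\<lambda>x a. g x Z a" and f = "\<lambda>x. \<Gamma> x X W", OF open_S z g_linear(2) g_smooth d[OF christoffel_smooth]])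
  show ?thesis unfolding 0 1 2 3 4 by simp
qed

end

section \<open>A metrical connection with symmetric vertical torsion\<close>

locale local_metric = local_finsler S E for S :: "('e::euclidean_space \<times> 'e) set" and E +
  fixes C :: "'e \<times> 'e \<Rightarrow> 'e \<times> 'e \<Rightarrow> 'e \<Rightarrow> 'e"
  assumes C: "smooth_bilinear S C"
    and g_pos: "\<And>z v. z \<in> S \<Longrightarrow> v \<noteq> 0 \<Longrightarrow> g z v v > 0"
    and C_sym: "\<And>z X Y Z. z \<in> S \<Longrightarrow> g z (C z (0, X) Y) Z = g z (C z (0, X) Z) Y"
    and C_metric: "\<And>z a Y Z. z \<in> S \<Longrightarrow> dd (\<lambda>x. g x Y Z) z a = g z (C z a Y) Z + g z Y (C z a Z)"
begin

lemma g_eqI: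
  assumes "z \<in> S" "\<And>Z. g z v Z = g z w Z"
  shows "v = w"
proof (rule ccontr)
  assume "v \<noteq> w"
  then have "g z (v - w) (v - w) > 0" using g_pos[OF assms(1)] by simp
  then show False using assms(2) by (simp add: linear_diff[OF g_linear(1)[OF assms(1)]])
qed

lemma g3_eq: "z \<in> S \<Longrightarrow> g3 z X Y Z = 2 * g z (C z (0, X) Y) Z"
  using C_metric[of z Y Z "(0, X)"] C_sym[of z X Y Z] g_sym[of z Y] by (simp add: g3_def)

lemma C_vertical_radial: "z \<in> S \<Longrightarrow> C z (0, X) (snd z) = 0"
proof (rule g_eqI)
  assume z: "z \<in> S"
  show "g z (C z (0, X) (snd z)) Z = g z 0 Z" for Z
    using g3_eq[OF z, of X "snd z" Z] g3_radial[OF z] linear_0[OF g_linear(1)[OF z]] by simp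
qed

definition Nc :: "'e \<times> 'e \<Rightarrow> 'e \<Rightarrow> 'e" where "Nc z X = C z (X, 0) (snd z)"
text \<open>The horizontal Christoffel symbols of the connection, that is, its coefficients along
  the lift \<open>(X, - Nc z X)\<close>.\<close>

definition F :: "'e \<times> 'e \<Rightarrow> 'e \<Rightarrow> 'e \<Rightarrow> 'e" where "F z X Y = C z (X, - Nc z X) Y"

lemma C_split: "z \<in> S \<Longrightarrow> C z (X, v) w = C z (X, 0) w + C z (0, v) w"
  using linear_add[OF smooth_bilinearD(1)[OF C], of z "(X, 0)" "(0, v)" w] by simp

text \<open>On the radial vector the vertical part of the direction has no effect. The condition
  \<open>v + C z (X, v) (snd z) = 0\<close> for a horizontal vector therefore has the explicit
  solution \<open>- Nc z X\<close>.\<close>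

lemma C_radial: "z \<in> S \<Longrightarrow> C z (X, v) (snd z) = Nc z X"
  using C_split[of z X v "snd z"] C_vertical_radial[of z v] by (simp add: Nc_def)

end

text \<open>A separate locale, because vanishing h-torsion becomes the symmetry of \<open>F\<close>,
  which can be expressed only once the horizontal lift is known.\<close>

locale local_cartan = local_metric S E C for S :: "('e::euclidean_space \<times> 'e) set" and E C +
  assumes F_sym: "\<And>z X Y. z \<in> S \<Longrightarrow> F z X Y = F z Y X"
begin

lemma koszul:
  assumes z: "z \<in> S"
  defines "\<delta> \<equiv> \<lambda>X Y Z. dd (\<lambda>x. g x Y Z) z (X, - Nc z X)"
  shows "2 * g z (F z X Y) Z = \<delta> X Y Z + \<delta> Y X Z - \<delta> Z X Y"
proof -
  have "\<delta> X Y Z = g z (F z X Y) Z + g z (F z X Z) Y" for X Y Z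
    unfolding \<delta>_def F_def C_metric[OF z] using g_sym[OF z, of Y] by simp
  then show ?thesis using F_sym[OF z, of X Y] F_sym[OF z, of X Z] F_sym[OF z, of Y Z] by simp
qed

lemma metric_deriv_split:
  "z \<in> S \<Longrightarrow> dd (\<lambda>x. g x Y Z) z (X, - Nc z X) = dd (\<lambda>x. g x Y Z) z (X, 0) - g3 z (Nc z X) Y Z"
  unfolding g3_def by (rule dd_neg[OF g_smooth])

text \<open>The Koszul formula with radial second argument: \<open>F z X (snd z)\<close> is
  \<open>Nc z X\<close>, and of the three terms with \<open>g3\<close> only the one without a radial
  slot survives.\<close>

lemma Nc_formula:
  assumes z: "z \<in> S"
  shows "2 * g z (Nc z X) Z = h z X Z + dd (\<lambda>x. g x X Z) z (snd z, 0) - g3 z (Nc z (snd z)) X Z - h z Z X"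
proof -
  have s: "dd (\<lambda>x. g x X (snd z)) z b = dd (\<lambda>x. g x (snd z) X) z b" for X b
    by (rule dd_cong[OF open_S z g_sym])
  have r: "g3 z a X (snd z) = 0" for a X using g3_swap23[OF z] g3_radial[OF z] by simp
  have "F z X (snd z) = Nc z X" unfolding F_def by (rule C_radial[OF z])
  then show ?thesis
    using koszul[OF z, of X "snd z" Z] unfolding metric_deriv_split[OF z]
    by (simp add: g3_radial[OF z] h_eq[OF z] s r)
qed

text \<open>For radial \<open>X\<close> the remaining term with \<open>g3\<close> vanishes too, so
  no unknown is left on the right and the result coincides with
  \<open>spray_formula\<close>.\<close>

lemma Nc_spray_formula:
  assumes z: "z \<in> S"
  shows "g z (Nc z (snd z)) Z = h z (snd z) Z - dd E z (Z, 0)"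
  using Nc_formula[OF z, of "snd z" Z] h_eq[OF z, of Z "snd z"] g3_radial[OF z] h_radial[OF z, of Z] by simp

end

section \<open>Comparison of the two connections in one chart\<close>

locale local_berwald_cartan = local_berwald S E G + local_cartan S E C
  for S :: "('e::euclidean_space \<times> 'e) set" and E G C
begin

lemma Nc_eq: "z \<in> S \<Longrightarrow> Nc z X = N z X"
proof (rule g_eqI)
  assume z: "z \<in> S"
  \<comment> \<open>The radial values must be compared first: they enter the formulas for a general
    argument, whose other terms depend on the energy alone.\<close>
  have "Nc z (snd z) = N z (snd z)"
    by (rule g_eqI[OF z]) (simp only: Nc_spray_formula[OF z] spray_formula[OF z])
  then show "g z (Nc z X) Z = g z (N z X) Z" for Z
    using Nc_formula[OF z, of X Z] N_formula[OF z, of X Z] by simp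
qed

text \<open>The lowered contracted hv-curvature of the Cartan connection, as
  \<open>mixed_curvature_radial\<close> shows; here it appears as the difference of the two sets of
  horizontal coefficients.\<close>

definition q :: "'e \<times> 'e \<Rightarrow> 'e \<Rightarrow> 'e \<Rightarrow> 'e \<Rightarrow> real" where
  "q z X Z W = g z (\<Gamma> z X Z - F z X Z) W"

lemma q_eq:
  assumes z: "z \<in> S"
  shows "2 * q z X Z W = - \<sigma> z X Z W"
proof -
  \<comment> \<open>The Cartan connection annihilates \<open>g\<close>, so the Berwald derivative of
    \<open>g\<close> along the lift measures only the difference of the coefficients.\<close>
  have 1: "\<sigma> z X Z W = - q z X Z W - q z X W Z" for X Z W
    using C_metric[OF z, of Z W "(X, - Nc z X)"] metric_deriv_split[OF z, of Z W X] g_sym[OF z, of Z]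
    by (simp add: q_def \<sigma>_def F_def Nc_eq[OF z] linear_diff[OF g_linear(1)[OF z]])
  have 2: "q z X Z W = q z Z X W" for X Z W
    by (simp add: q_def christoffel_sym[OF z, of X] F_sym[OF z, of X])
  show ?thesis
    using 1[of X Z W] 1[of Z X W] 1[of W X Z] 2[of X Z W] 2[of X W Z] 2[of Z W X]
      landsberg_sym(1)[OF z, of X Z W] landsberg_sym(2)[OF z, of W X Z] landsberg_sym[OF z, of X W Z] landsberg_sym(1)[OF z, of W X Z]
      landsberg_sym(2)[OF z, of X Z W] by linarith
qed

text \<open>With \<open>t\<close> equal to half of \<open>g3\<close> and \<open>q\<close> to minus
  half of \<open>\<sigma>\<close>, this is \<open>dd_landsberg\<close> solved for the terms with
  \<open>P\<close>; the two halves account for both factors 2.\<close>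

theorem mixed_curvature_formula:
  assumes z: "z \<in> S"
  defines "t \<equiv> \<lambda>x Y Z W. g x (C x (0, Y) Z) W"
  shows "g z (P z X Y Z) W + g z (P z X Y W) Z =
    2 * (dd (\<lambda>x. t x Y Z W) z (X, - N z X) - t z (\<Gamma> z X Y) Z W - t z Y (\<Gamma> z X Z) W - t z Y Z (\<Gamma> z X W))
    + 2 * dd (\<lambda>x. q x X Z W) z (0, Y)"
proof -
  have t: "t x Y Z W = (1/2) * g3 x Y Z W" if "x \<in> S" for x Y Z W
    using g3_eq[OF that] by (simp add: t_def)
  have "dd (\<lambda>x. t x Y Z W) z (X, - N z X) = dd (\<lambda>x. (1/2) * g3 x Y Z W) z (X, - N z X)"
    by (rule dd_cong[OF open_S z t])
  also have "\<dots> = (1/2) * dd (\<lambda>x. g3 x Y Z W) z (X, - N z X)"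
    by (rule dd_eqI[OF has_derivative_mult_right[OF smooth_on_has_derivative[OF g3_smooth z]]])
  finally have 1: "2 * dd (\<lambda>x. t x Y Z W) z (X, - N z X) = dd (\<lambda>x. g3 x Y Z W) z (X, 0) - dd (\<lambda>x. g3 x Y Z W) z (0, N z X)"
    by (simp add: dd_neg[OF g3_smooth z])
  have s: "smooth_on S (\<lambda>x. \<sigma> x X Z W)"
    by (rule smooth_on_cong[OF open_S, of "\<lambda>x. dd E x (0, P x X W Z)"], simp add: landsberg_eq)
      (rule smooth_on_family[where T = "\<lambda>x w. dd E x (0, w)", OF open_S linear_E1_vertical smooth_E1 smooth_trilinearD(4)[OF P_trilinear]])
  have "dd (\<lambda>x. q x X Z W) z (0, Y) = dd (\<lambda>x. (- 1/2) * \<sigma> x X Z W) z (0, Y)"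
  proof (rule dd_cong[OF open_S z])
    show "q x X Z W = (- 1/2) * \<sigma> x X Z W" if "x \<in> S" for x using q_eq[OF that, of X Z W] by simp
  qed
  also have "\<dots> = (- 1/2) * dd (\<lambda>x. \<sigma> x X Z W) z (0, Y)"
    by (rule dd_eqI[OF has_derivative_mult_right[OF smooth_on_has_derivative[OF s z]]])
  finally have 2: "2 * dd (\<lambda>x. q x X Z W) z (0, Y) = - dd (\<lambda>x. \<sigma> x X Z W) z (0, Y)" by simp
  show ?thesis
    using 1 2 dd_landsberg[OF z, of X Z W Y] g_sym[OF z, of Z "P z X Y W"] by (simp add: t[OF z])
qed

end

section \<open>Finsler manifolds in charts\<close>

context local_berwald_cartan
begin

lemma q_trilinear: "smooth_trilinear S q"
proof (rule smooth_trilinearI)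
  note PT = smooth_trilinearD[OF P_trilinear]
  \<comment> \<open>In this form linearity and smoothness come directly from \<open>P\<close> and
    the differential of the energy.\<close>
  have q: "q x X Z W = (- 1/2) * dd E x (0, P x X W Z)" if "x \<in> S" for x X Z W
    using q_eq[OF that, of X Z W] landsberg_eq[OF that, of X Z W] by simp
  have lin: "linear (\<lambda>v. (- 1/2) * dd E x (0, f v))" if "linear f" "x \<in> S" for f :: "'e \<Rightarrow> 'e" and x
    using linear_compose_scale_right[OF linear_comp[OF that(1) linear_E1_vertical[OF that(2)]], of "- 1/2"]
    by simp
  show "linear (\<lambda>a. q x a b w)" "linear (\<lambda>b. q x a b w)" "linear (\<lambda>w. q x a b w)" if "x \<in> S" for x a b w
    unfolding q[OF that] by (rule lin[OF PT(1)[OF that] that], rule lin[OF PT(3)[OF that] that], rule lin[OF PT(2)[OF that] that])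
  show "smooth_on S (\<lambda>x. q x a b w)" for a b w
  proof (rule smooth_on_cong[OF open_S])
    show "smooth_on S (\<lambda>x. (- 1/2) * dd E x (0, P x a w b))"
      by (rule smooth_on_mult[OF open_S smooth_on_const])
        (rule smooth_on_family[where T = "\<lambda>x w. dd E x (0, w)", OF open_S linear_E1_vertical smooth_E1 PT(4)])
  qed (simp only: q)
qed

lemma t_trilinear: "smooth_trilinear S (\<lambda>x Y Z W. g x (C x (0, Y) Z) W)"
proof (rule smooth_trilinearI)
  note CB = smooth_bilinearD[OF C]
  show "linear (\<lambda>a. g x (C x (0, a) b) w)" "linear (\<lambda>b. g x (C x (0, a) b) w)" "linear (\<lambda>w. g x (C x (0, a) b) w)"
    if "x \<in> S" for x a b w
    by (rule linear_comp[OF linear_comp[OF linear_Pair0(1) CB(1)[OF that]] g_linear(1)[OF that]],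
      rule linear_comp[OF CB(2)[OF that] g_linear(1)[OF that]], rule g_linear(2)[OF that])
  show "smooth_on S (\<lambda>x. g x (C x (0, a) b) w)" for a b w
    by (rule smooth_on_bilinear_family[OF open_S g_bilinear CB(3) smooth_on_const])
qed

text \<open>The left-hand side is the curvature with the radial vector frozen at \<open>z\<close>.
  Letting it move makes the radial values of \<open>C\<close> known functions, namely 0 and
  \<open>N\<close>; the correction costs one coefficient per term.\<close>

lemma mixed_curvature_radial:
  fixes X Z :: 'e
  assumes z: "z \<in> S"
  defines "b \<equiv> (0, Z)" and "a \<equiv> (X, - Nc z X)"
  shows "dd (\<lambda>x. C x a (snd z)) z b - dd (\<lambda>x. C x b (snd z)) z a + C z b (C z a (snd z)) - C z a (C z b (snd z)) =
    \<Gamma> z X Z - F z X Z"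
proof -
  note CB = smooth_bilinearD[OF C]
  have fam: "dd (\<lambda>x. C x k (snd x)) z v = dd (\<lambda>x. C x k (snd z)) z v + C z k (snd v)" for k v
    using dd_family[where T = "\<lambda>x w. C x k w", OF open_S z CB(2,3) dd_vertical_part(4)] by (simp add: dd_vertical_part)
  have "dd (\<lambda>x. C x b (snd x)) z a = dd (\<lambda>x. 0) z a"
    unfolding b_def by (rule dd_cong[OF open_S z C_vertical_radial])
  then have 1: "dd (\<lambda>x. C x b (snd z)) z a = C z b (Nc z X)"
    unfolding fam using linear_neg[OF CB(2)[OF z]] by (simp add: a_def)
  \<comment> \<open>The vertical part of \<open>a\<close> stays frozen at \<open>z\<close>, but by
    \<open>C_radial\<close> it does not influence the radial value, which is \<open>N x X\<close> at
    every point.\<close>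
  have "dd (\<lambda>x. C x a (snd x)) z b = dd (\<lambda>x. N x X) z b"
    unfolding a_def by (rule dd_cong[OF open_S z]) (simp add: C_radial Nc_eq)
  then have 2: "dd (\<lambda>x. C x a (snd z)) z b = \<Gamma> z X Z - F z X Z"
    unfolding fam using dd_N[OF z, of X Z] by (simp add: a_def b_def F_def eq_diff_eq)
  have 3: "C z a (snd z) = Nc z X" "C z b (snd z) = 0" "C z a 0 = 0"
    unfolding a_def b_def using C_radial[OF z] C_vertical_radial[OF z] smooth_bilinear_right(1)[OF C z] by auto
  show ?thesis unfolding 1 2 3 by simp
qed

end

locale finsler_space =
  fixes M :: "('m, 'e::euclidean_space) atlas" and L :: "('m, 'e) tpoint \<Rightarrow> real"
  assumes finsler: "finsler_manifold M L"

sublocale finsler_space \<subseteq> manifold_space M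
  by unfold_locales (use finsler in \<open>simp add: finsler_manifold_def\<close>)

context finsler_space
begin

definition energy :: "('m, 'e) chart \<Rightarrow> 'e \<times> 'e \<Rightarrow> real" where
  "energy c z = (L (param (lift c) z))\<^sup>2 / 2"

lemma L_smooth: "c \<in> M \<Longrightarrow> smooth_on (region c) (\<lambda>z. L (param (lift c) z))"
  using finsler lift_in[of c] lift_region[of c] unfolding finsler_manifold_def smooth_fun_def smooth_in_chart_iff
  by metis

lemma energy_has_derivative:
  assumes "c \<in> M" "z \<in> region c"
  shows "(energy c has_derivative (\<lambda>v. L (param (lift c) z) * dd (\<lambda>z. L (param (lift c) z)) z v)) (at z)"
  unfolding energy_def[abs_def]
  by (auto intro!: derivative_eq_intros smooth_on_has_derivative[OF L_smooth[OF assms(1)] assms(2)] simp: power2_eq_square)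

lemma energy_smooth:
  assumes c: "c \<in> M"
  shows "smooth_on (region c) (energy c)"
proof -
  have "smooth_on (region c) (\<lambda>z. L (param (lift c) z) * L (param (lift c) z) * (1/2))"
    by (intro smooth_on_mult open_region[OF c] L_smooth[OF c] smooth_on_const)
  then show ?thesis by (simp add: energy_def[abs_def] power2_eq_square)
qed

lemma param_lift_eq:
  assumes "c \<in> M" "p \<in> dom_of c" "w \<in> tangent_space M p" "w c \<noteq> 0"
  shows "param (lift c) (coord c p, w c) = (p, w)"
proof -
  have "w \<noteq> 0" using assms(4) by auto
  then have "(p, w) \<in> dom_of (lift c)"
    using slit_bundleI[OF in_points[OF assms(1,2)] assms(3)] assms(2) by (simp add: lift_dom)
  from lift_param_coord[OF assms(1) this] show ?thesis by (simp add: lift_coord[of c "(p, w)"])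
qed

lemma energy_homogeneous:
  assumes c: "c \<in> M" and z: "z \<in> region c" and r: "r > 0"
  shows "energy c (fst z, r *\<^sub>R snd z) = r\<^sup>2 * energy c z"
proof -
  obtain u where u: "u = param (lift c) z" "u \<in> dom_of (lift c)" "u \<in> slit_bundle M" "coord (lift c) u = z" "fst u \<in> dom_of c"
    using region_point[OF c z] by blast
  have sz: "fst z = coord c (fst u)" "r *\<^sub>R snd z = (r *\<^sub>R snd u) c" "snd z \<noteq> 0"
    using u(4) snd_component_nonzero[OF c u(2)] by (auto simp: lift_coord[of c u] scaleR_fun_def)
  have "param (lift c) (fst z, r *\<^sub>R snd z) = (fst u, r *\<^sub>R snd u)"
    unfolding sz(1,2)
    by (rule param_lift_eq[OF c u(5) base.tangent_scaleR[OF slit_bundleD(1)[OF u(3)]]])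
      (use sz r in \<open>simp flip: sz(2)\<close>)
  moreover have "L (fst u, r *\<^sub>R snd u) = r * L u"
    using finsler u(3) r unfolding finsler_manifold_def slit_bundle_def by auto
  ultimately show ?thesis by (simp add: energy_def power_mult_distrib flip: u(1))
qed

lemma local_finsler_energy: "c \<in> M \<Longrightarrow> local_finsler (region c) (energy c)"
  by unfold_locales (use open_region energy_smooth energy_homogeneous in auto)

abbreviation gloc :: "('m, 'e) chart \<Rightarrow> 'e \<times> 'e \<Rightarrow> 'e \<Rightarrow> 'e \<Rightarrow> real" where
  "gloc c \<equiv> local_finsler.g (energy c)"

lemma open_line:
  fixes z v :: "'a::real_normed_vector"
  assumes "open S"
  shows "open {t::real. z + t *\<^sub>R v \<in> S}"
proof -
  have "open ((\<lambda>t::real. z + t *\<^sub>R v) -` S)"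
    by (rule open_vimage[OF assms]) (intro continuous_intros)
  then show ?thesis by (simp add: vimage_def)
qed

lemma finsler_metric_chart:
  assumes c: "c \<in> M" and u: "u \<in> dom_of (lift c)" and v: "v \<in> tangent_space M (fst u)" and w: "w \<in> tangent_space M (fst u)"
  shows "finsler_metric L u v w = gloc c (coord (lift c) u) (v c) (w c)"
proof -
  interpret loc: local_finsler "region c" "energy c" by (rule local_finsler_energy[OF c])
  let ?z = "coord (lift c) u" let ?v = "(0, v c)" let ?w = "(0, w c)"
  have z: "?z \<in> region c" by (rule regionI[OF c u])
  have us: "snd u \<in> tangent_space M (fst u)" "fst u \<in> dom_of c"
    using slit_bundleD(1) lift_dom_subset[OF u] by auto
  \<comment> \<open>The chart sees the bundle only away from the zero section. Since the region is
    open, all small parameters are covered, which is enough for the derivatives at 0.\<close>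
  have val: "(L (fst u, snd u + s *\<^sub>R v + t *\<^sub>R w))\<^sup>2 / 2 = energy c (?z + s *\<^sub>R ?v + t *\<^sub>R ?w)"
    if "?z + s *\<^sub>R ?v + t *\<^sub>R ?w \<in> region c" for s t
  proof -
    have e: "?z + s *\<^sub>R ?v + t *\<^sub>R ?w = (coord c (fst u), (snd u + s *\<^sub>R v + t *\<^sub>R w) c)"
      by (simp add: lift_coord[of c u] scaleR_fun_def)
    have ne: "(snd u + s *\<^sub>R v + t *\<^sub>R w) c \<noteq> 0" using that unfolding e by (simp add: region_def)
    have "snd u + s *\<^sub>R v + t *\<^sub>R w \<in> tangent_space M (fst u)"
      by (intro base.tangent_add base.tangent_scaleR us v w)
    from param_lift_eq[where w = "snd u + s *\<^sub>R v + t *\<^sub>R w", OF c us(2) this ne] show ?thesis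
      unfolding energy_def e by (simp only:)
  qed
  have inner: "deriv (\<lambda>t. (L (fst u, snd u + s *\<^sub>R v + t *\<^sub>R w))\<^sup>2 / 2) 0 = dd (energy c) (?z + s *\<^sub>R ?v) ?w"
    if s: "?z + s *\<^sub>R ?v \<in> region c" for s
  proof (rule DERIV_imp_deriv, rule has_field_derivative_transform_within_open)
    have "energy c differentiable (at (?z + s *\<^sub>R ?v + 0 *\<^sub>R ?w))"
      using smooth_on_differentiable[OF loc.smooth_E s] by (simp flip: zero_prod_def)
    from has_real_derivative_line[OF this]
    show "((\<lambda>t. energy c (?z + s *\<^sub>R ?v + t *\<^sub>R ?w)) has_real_derivative dd (energy c) (?z + s *\<^sub>R ?v) ?w) (at 0)"
      by (simp flip: zero_prod_def)
    show "open {t. ?z + s *\<^sub>R ?v + t *\<^sub>R ?w \<in> region c}" by (rule open_line[OF loc.open_S])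
    show "0 \<in> {t. ?z + s *\<^sub>R ?v + t *\<^sub>R ?w \<in> region c}" using s by (simp flip: zero_prod_def)
    show "energy c (?z + s *\<^sub>R ?v + t *\<^sub>R ?w) = (L (fst u, snd u + s *\<^sub>R v + t *\<^sub>R w))\<^sup>2 / 2"
      if "t \<in> {t. ?z + s *\<^sub>R ?v + t *\<^sub>R ?w \<in> region c}" for t
      using val[of s t] that by simp
  qed
  have "deriv (\<lambda>s. deriv (\<lambda>t. (L (fst u, snd u + s *\<^sub>R v + t *\<^sub>R w))\<^sup>2 / 2) 0) 0 = dd (\<lambda>x. dd (energy c) x ?w) ?z ?v"
  proof (rule DERIV_imp_deriv, rule has_field_derivative_transform_within_open)
    have "(\<lambda>x. dd (energy c) x ?w) differentiable (at (?z + 0 *\<^sub>R ?v))"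
      using smooth_on_differentiable[OF loc.smooth_E1 z] by (simp flip: zero_prod_def)
    from has_real_derivative_line[OF this]
    show "((\<lambda>s. dd (energy c) (?z + s *\<^sub>R ?v) ?w) has_real_derivative dd (\<lambda>x. dd (energy c) x ?w) ?z ?v) (at 0)"
      by (simp flip: zero_prod_def)
    show "open {s. ?z + s *\<^sub>R ?v \<in> region c}" by (rule open_line[OF loc.open_S])
    show "0 \<in> {s. ?z + s *\<^sub>R ?v \<in> region c}" using z by (simp flip: zero_prod_def)
    show "dd (energy c) (?z + s *\<^sub>R ?v) ?w = deriv (\<lambda>t. (L (fst u, snd u + s *\<^sub>R v + t *\<^sub>R w))\<^sup>2 / 2) 0"
      if "s \<in> {s. ?z + s *\<^sub>R ?v \<in> region c}" for s
      using inner[of s] that by simp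
  qed
  then show ?thesis by (simp add: finsler_metric_def loc.g_def)
qed

lemma metric_f_chart:
  "c \<in> M \<Longrightarrow> u \<in> dom_of (lift c) \<Longrightarrow> pi_vector_field M X \<Longrightarrow> pi_vector_field M Y \<Longrightarrow>
    metric_f L X Y u = gloc c (coord (lift c) u) (X u c) (Y u c)"
  unfolding metric_f_def by (intro finsler_metric_chart pi_tangent) (simp_all add: lift_dom)

lemma gloc_pos:
  assumes c: "c \<in> M" and z: "z \<in> region c" and v: "v \<noteq> 0"
  shows "gloc c z v v > 0"
proof -
  obtain u where u: "u \<in> dom_of (lift c)" "u \<in> slit_bundle M" "coord (lift c) u = z" "fst u \<in> dom_of c"
    using region_point[OF c z] by blast
  let ?t = "tangent_of M c (fst u) v"
  have t: "?t \<in> tangent_space M (fst u)" "?t c = v"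
    using base.tangent_of_in[OF c u(4)] base.tangent_of_self[OF c u(4)] by auto
  then have "?t \<noteq> 0" using v by auto
  then have "0 < finsler_metric L u ?t ?t" using finsler u(2) t(1) unfolding finsler_manifold_def by blast
  then show ?thesis using finsler_metric_chart[OF c u(1) t(1) t(1)] t(2) u(3) by simp
qed

end

section \<open>Global fields with prescribed values at a point\<close>

context manifold_space
begin

text \<open>Together with its companions for vector fields and tangent vectors, this turns
  conditions quantified over global fields into identities between coefficients at a point.\<close>

lemma pi_with_value:
  assumes c: "c \<in> M" and u: "u \<in> dom_of (lift c)"
  obtains X where "pi_vector_field M X" "X u c = v"
proof -
  obtain f V where f: "base.cutoff c f" "nbhd c (fst u) V" "\<And>q. q \<in> V \<Longrightarrow> f q = 1"
    using cutoff_obtain[OF c nbhd_dom[OF c lift_dom_subset(1)[OF u]]] by metis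
  have "f (fst u) = 1" using f(2,3) by (simp add: nbhd_def)
  then show thesis
    using that[OF pi_extend[OF c f(1) smooth_on_const[of _ v]]] extend_pi_in_chart[OF c u, of f "\<lambda>_. v"] by simp
qed

lemma vec_with_value:
  assumes c: "c \<in> M" and u: "u \<in> dom_of (lift c)"
  obtains A where "vector_field (slit_atlas M) A" "A u (lift c) = a"
proof -
  obtain f V where f: "base.cutoff c f" "nbhd c (fst u) V" "\<And>q. q \<in> V \<Longrightarrow> f q = 1"
    using cutoff_obtain[OF c nbhd_dom[OF c lift_dom_subset(1)[OF u]]] by metis
  have "f (fst u) = 1" using f(2,3) by (simp add: nbhd_def)
  then show thesis
    using that[OF extend_vec_field[OF c f(1), of a]] extend_vec_in_chart[OF c u, of f a] by simp
qed

lemma tangent_with_value: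
  assumes c: "c \<in> M" and u: "u \<in> dom_of (lift c)"
  obtains b where "b \<in> tangent_space (slit_atlas M) u" "b (lift c) = a"
  using that slit.tangent_of_in[OF lift_in[OF c] u] slit.tangent_of_self[OF lift_in[OF c] u] by metis

lemma piloc_eta: "c \<in> M \<Longrightarrow> z \<in> region c \<Longrightarrow> piloc c eta z = snd z"
  unfolding piloc_def eta_def by (rule region_point(4))

end

context pi_connection
begin

lemma conn_map_chart:
  assumes c: "c \<in> M" and u: "u \<in> dom_of (lift c)" and a: "a \<in> tangent_space (slit_atlas M) u"
  shows "conn_map D u a c = snd (a (lift c)) + coef c (coord (lift c) u) (a (lift c)) (snd u c)"
proof -
  have "dd (piloc c eta) (coord (lift c) u) v = dd snd (coord (lift c) u) v" for v
    by (rule dd_cong[OF open_region[OF c] regionI[OF c u] piloc_eta[OF c]])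
  moreover have "dd snd (coord (lift c) u) v = snd v" for v :: "'e \<times> 'e"
    by (rule dd_eqI[OF bounded_linear_imp_has_derivative[OF bounded_linear_snd]])
  ultimately show ?thesis
    unfolding conn_map_def conn_chart[OF c u a pi_eta] by (simp add: eta_def)
qed

lemma torsion_pi:
  "vector_field (slit_atlas M) A \<Longrightarrow> vector_field (slit_atlas M) B \<Longrightarrow> pi_vector_field M (torsion M D A B)"
  unfolding torsion_def by (intro pi_diff cov_pi pi_rho slit.lie_bracket_vector_field)

end

section \<open>The horizontal lift of a regular connection\<close>

locale regular_pi_connection = manifold_space M for M :: "('m, 'e::euclidean_space) atlas" +
  fixes D :: "('m, 'e) pi_conn"
  assumes regular: "regular_connection M D"

sublocale regular_pi_connection \<subseteq> pi_connection M D
  by unfold_locales (use regular in \<open>simp add: regular_connection_def\<close>)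

context regular_pi_connection
begin

lemma beta_properties:
  assumes u: "u \<in> slit_bundle M" and v: "v \<in> tangent_space M (fst u)"
  shows "beta M D u v \<in> tangent_space (slit_atlas M) u" "conn_map D u (beta M D u v) = 0" "rho M u (beta M D u v) = v"
proof -
  obtain c where c: "c \<in> M" "u \<in> dom_of (lift c)" using slit_bundle_chart[OF u] by blast
  \<comment> \<open>Any vector with base component \<open>v c\<close> would do: removing its
    vertical part makes it horizontal without changing its projection.\<close>
  obtain a where a: "a \<in> tangent_space (slit_atlas M) u" "a (lift c) = (v c, 0)"
    using tangent_with_value[OF c] by blast
  obtain y k where yk: "y \<in> vertical M u" "k \<in> horizontal M D u" "a = y + k"
    using regular u a(1) unfolding regular_connection_def by blast
  have y: "y \<in> tangent_space (slit_atlas M) u" "rho M u y = 0" using yk(1) by (auto simp: vertical_def)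
  have k: "k \<in> tangent_space (slit_atlas M) u" using yk(2) by (simp add: horizontal_def)
  have "fst (y (lift c)) = 0" using rho_eq[OF c y(1)] y(2) by simp
  moreover have "a (lift c) = y (lift c) + k (lift c)" using yk(3) by simp
  ultimately have "fst (k (lift c)) = v c" using a(2) by (metis add_0 fst_add fst_conv)
  then have "rho M u k c = v c" using rho_eq[OF c k] by simp
  then have "rho M u k = v"
    using base.tangent_eqI[OF rho_tangent[OF u k] v c(1)] lift_dom_subset(1)[OF c(2)] by blast
  then have im: "v \<in> rho M u ` horizontal M D u" using yk(2) by blast
  then show "rho M u (beta M D u v) = v" unfolding beta_def by (rule f_inv_into_f)
  have "beta M D u v \<in> horizontal M D u" unfolding beta_def by (rule inv_into_into[OF im])
  then show "beta M D u v \<in> tangent_space (slit_atlas M) u" "conn_map D u (beta M D u v) = 0"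
    by (auto simp: horizontal_def)
qed

lemma beta_chart:
  assumes c: "c \<in> M" and u: "u \<in> dom_of (lift c)" and v: "v \<in> tangent_space M (fst u)"
  shows "fst (beta M D u v (lift c)) = v c"
    "snd (beta M D u v (lift c)) + coef c (coord (lift c) u) (beta M D u v (lift c)) (snd u c) = 0"
proof -
  note b = beta_properties[OF lift_dom_subset(2)[OF u] v]
  show "fst (beta M D u v (lift c)) = v c" using rho_eq[OF c u b(1)] b(3) by simp
  show "snd (beta M D u v (lift c)) + coef c (coord (lift c) u) (beta M D u v (lift c)) (snd u c) = 0"
    using conn_map_chart[OF c u b(1)] b(2) by simp
qed

text \<open>A solution \<open>n\<close> would give a vector that is vertical and horizontal at once.
  This makes the equation for the vertical component of the lift uniquely solvable.\<close>

lemma vertical_injective: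
  assumes c: "c \<in> M" and z: "z \<in> region c" and n: "n + coef c z (0, n) (snd z) = 0"
  shows "n = 0"
proof -
  obtain u where u: "u \<in> dom_of (lift c)" "u \<in> slit_bundle M" "coord (lift c) u = z" "fst u \<in> dom_of c"
    using region_point[OF c z] by blast
  have us: "snd u c = snd z" using u(3) by (auto simp: lift_coord[of c u])
  obtain a where a: "a \<in> tangent_space (slit_atlas M) u" "a (lift c) = (0, n)"
    using tangent_with_value[OF c u(1)] by blast
  have "rho M u a = 0"
    using rho_eq[OF c u(1) a(1)] a(2)
    by (intro base.tangent_eqI[OF rho_tangent[OF u(2) a(1)] base.tangent_0 c u(4)]) simp
  moreover have "conn_map D u a = 0"
    using conn_map_chart[OF c u(1) a(1)] a(2) n us u(3) conn_tangent[OF u(2) a(1) pi_eta]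
    unfolding conn_map_def by (intro base.tangent_eqI[OF _ base.tangent_0 c u(4)]) simp_all
  ultimately have "a \<in> vertical M u \<inter> horizontal M D u" using a(1) by (simp add: vertical_def horizontal_def)
  then have "a = 0" using regular u(2) unfolding regular_connection_def by blast
  then have "a (lift c) = 0" by simp
  then show ?thesis unfolding a(2) by (simp add: zero_prod_def)
qed

text \<open>The vertical component of the lift solves a linear equation with smooth coefficients and
  injective operator, hence depends smoothly on the point. The chart formulas for torsion and
  curvature presuppose this.\<close>

lemma vec_beta:
  assumes X: "pi_vector_field M X"
  shows "vector_field (slit_atlas M) (beta_f M D X)"
proof (rule vec_fieldI)
  show "beta_f M D X u \<in> tangent_space (slit_atlas M) u" if "u \<in> slit_bundle M" for u
    unfolding beta_f_def by (rule beta_properties(1)[OF that pi_tangent[OF X that]])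
  fix c assume c: "c \<in> M"
  note O = open_region[OF c] and B = smooth_bilinearD[OF coef_bilinear[OF c]]
  have ss: "smooth_on (region c) (snd :: 'e \<times> 'e \<Rightarrow> 'e)" by (rule smooth_on_linear[OF bounded_linear_snd O])
  let ?v = "vloc c (beta_f M D X)"
  have val: "fst (?v z) = piloc c X z" "snd (?v z) + coef c z (?v z) (snd z) = 0" if z: "z \<in> region c" for z
    using beta_chart[OF c region_point(1)[OF c z] pi_tangent[OF X region_point(6)[OF c z]]]
    by (simp_all add: vloc_def beta_f_def piloc_def region_point[OF c z])
  \<comment> \<open>Splitting off the known base component leaves a linear equation for the vertical
    component alone.\<close>
  have eqn: "snd (?v z) + coef c z (0, snd (?v z)) (snd z) = - coef c z (piloc c X z, 0) (snd z)" if z: "z \<in> region c" for z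
  proof -
    have "?v z = (piloc c X z, 0) + (0, snd (?v z))" using val(1)[OF z] by (simp add: prod_eq_iff)
    then have "coef c z (?v z) (snd z) = coef c z (piloc c X z, 0) (snd z) + coef c z (0, snd (?v z)) (snd z)"
      using linear_add[OF B(1)[OF z]] by metis
    then show ?thesis using val(2)[OF z] by (simp add: eq_neg_iff_add_eq_0 add_ac)
  qed
  have sm: "smooth_on (region c) (\<lambda>z. snd (?v z))"
  proof (rule smooth_on_linear_solution[where T = "\<lambda>z n. n + coef c z (0, n) (snd z)", OF O _ _ _ _ eqn])
    show lin: "linear (\<lambda>n. n + coef c z (0, n) (snd z))" if "z \<in> region c" for z
      by (rule linear_compose_add[OF linear_ident linear_comp[OF linear_Pair0(1) B(1)[OF that]]])
    show "smooth_on (region c) (\<lambda>z. n + coef c z (0, n) (snd z))" for n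
      by (rule smooth_on_add[OF O smooth_on_const smooth_on_bilinear_family[OF O coef_bilinear[OF c] smooth_on_const ss]])
    show "inj (\<lambda>n. n + coef c z (0, n) (snd z))" if "z \<in> region c" for z
      unfolding linear_injective_0[OF lin[OF that]] using vertical_injective[OF c that] by blast
    show "smooth_on (region c) (\<lambda>z. - coef c z (piloc c X z, 0) (snd z))"
      by (rule smooth_on_minus[OF O smooth_on_bilinear_family[OF O coef_bilinear[OF c]
        smooth_on_Pair[OF O pi_smooth[OF X c] smooth_on_const] ss]])
  qed
  show "smooth_on (region c) ?v"
  proof (rule smooth_on_cong[OF O])
    show "smooth_on (region c) (\<lambda>z. (piloc c X z, snd (?v z)))"
      by (rule smooth_on_Pair[OF O pi_smooth[OF X c] sm])
  qed (simp add: prod_eq_iff val(1))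
qed

lemma hv_curv_pi:
  "pi_vector_field M X \<Longrightarrow> pi_vector_field M Y \<Longrightarrow> pi_vector_field M Z \<Longrightarrow> pi_vector_field M (hv_curv M D X Y Z)"
  unfolding hv_curv_def by (intro curvature_pi vec_beta vec_gamma)

lemma gamma_chart: "c \<in> M \<Longrightarrow> u \<in> dom_of (lift c) \<Longrightarrow> gamma_f M X u (lift c) = (0, X u c)"
  unfolding gamma_f_def by (rule vlift_eq)

end

section \<open>The Berwald and the Cartan connection\<close>

context pi_connection
begin

lemma coef_split:
  "c \<in> M \<Longrightarrow> z \<in> region c \<Longrightarrow> coef c z a w = coef c z (fst a, 0) w + coef c z (0, snd a) w"
  using linear_add[OF smooth_bilinearD(1)[OF coef_bilinear], of c z "(fst a, 0)" "(0, snd a)" w] by simp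

end

section \<open>The conditions on the Berwald connection in a chart\<close>

locale berwald_space = finsler_space M L for M :: "('m, 'e::euclidean_space) atlas" and L +
  fixes D :: "('m, 'e) pi_conn"
  assumes berwald: "berwald_connection M L D"

sublocale berwald_space \<subseteq> regular_pi_connection M D
  by unfold_locales (use berwald in \<open>simp add: berwald_connection_def\<close>)

context berwald_space
begin

lemma coef_torsion:
  assumes c: "c \<in> M" and z: "z \<in> region c"
  shows "coef c z a (fst b) = coef c z b (fst a)"
proof -
  obtain u where u: "u \<in> dom_of (lift c)" "u \<in> slit_bundle M" "coord (lift c) u = z"
    using region_point[OF c z] by blast
  obtain A where A: "vector_field (slit_atlas M) A" "A u (lift c) = a" using vec_with_value[OF c u(1)] by blast
  obtain B where B: "vector_field (slit_atlas M) B" "B u (lift c) = b" using vec_with_value[OF c u(1)] by blast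
  have "torsion M D A B u = 0"
    using berwald A(1) B(1) u(2) unfolding berwald_connection_def by blast
  then show ?thesis using torsion_chart[OF c u(1) A(1) B(1)] A(2) B(2) u(3) by simp
qed

lemma coef_vertical: "c \<in> M \<Longrightarrow> z \<in> region c \<Longrightarrow> coef c z (0, v) w = 0"
  using coef_torsion[of c z "(0, v)" "(w, 0)"] smooth_bilinear_right(1)[OF coef_bilinear] by simp

lemma beta_coords:
  assumes c: "c \<in> M" and u: "u \<in> dom_of (lift c)" and v: "v \<in> tangent_space M (fst u)"
  shows "beta M D u v (lift c) = (v c, - coef c (coord (lift c) u) (v c, 0) (snd u c))"
proof -
  have "coef c (coord (lift c) u) (beta M D u v (lift c)) (snd u c) = coef c (coord (lift c) u) (v c, 0) (snd u c)"
    using coef_split[OF c regionI[OF c u], of "beta M D u v (lift c)"] coef_vertical[OF c regionI[OF c u]]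
      beta_chart(1)[OF c u v] by simp
  then show ?thesis
    using beta_chart[OF c u v] by (simp add: prod_eq_iff eq_neg_iff_add_eq_0)
qed

text \<open>The coefficients vanish in vertical directions. Of the four terms of
  \<open>curvature_chart\<close> only the first survives, and in it only the base component of the
  lift matters.\<close>

lemma hv_curv_coords:
  assumes c: "c \<in> M" and u: "u \<in> dom_of (lift c)"
    and X: "pi_vector_field M X" and Y: "pi_vector_field M Y" and Z: "pi_vector_field M Z"
  shows "hv_curv M D X Y Z u c = dd (\<lambda>x. coef c x (X u c, 0) (Z u c)) (coord (lift c) u) (0, Y u c)"
proof -
  let ?z = "coord (lift c) u" let ?a = "beta_f M D X u (lift c)" let ?b = "gamma_f M Y u (lift c)"
  have z: "?z \<in> region c" by (rule regionI[OF c u])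
  have a: "fst ?a = X u c"
    unfolding beta_f_def by (rule beta_chart(1)[OF c u pi_tangent[OF X lift_dom_subset(2)[OF u]]])
  have b: "?b = (0, Y u c)" by (rule gamma_chart[OF c u])
  have 1: "dd (\<lambda>x. coef c x ?a (Z u c)) ?z ?b = dd (\<lambda>x. coef c x (X u c, 0) (Z u c)) ?z ?b"
    by (rule dd_cong[OF open_region[OF c] z]) (use coef_split[OF c, of _ ?a] coef_vertical[OF c] a in simp)
  have 2: "dd (\<lambda>x. coef c x ?b (Z u c)) ?z ?a = dd (\<lambda>x. 0) ?z ?a"
    by (rule dd_cong[OF open_region[OF c] z]) (use b coef_vertical[OF c] in simp)
  show ?thesis
    unfolding hv_curv_def curvature_chart[OF c u vec_beta[OF X] vec_gamma[OF Y] Z] 1 2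
    using smooth_bilinear_right(1)[OF coef_bilinear[OF c] z] by (simp add: b coef_vertical[OF c z])
qed

lemma local_berwald_coef:
  assumes c: "c \<in> M"
  shows "local_berwald (region c) (energy c) (coef c)"
proof -
  interpret loc: local_finsler "region c" "energy c" by (rule local_finsler_energy[OF c])
  show ?thesis
  proof unfold_locales
    show "smooth_bilinear (region c) (coef c)" by (rule coef_bilinear[OF c])
    show "coef c z a (fst b) = coef c z b (fst a)" if "z \<in> region c" for z a b by (rule coef_torsion[OF c that])
  next
    fix z X assume z: "z \<in> region c"
    obtain u where u: "u \<in> dom_of (lift c)" "u \<in> slit_bundle M" "coord (lift c) u = z" "u = param (lift c) z"
      using region_point[OF c z] by blast
    have uz: "snd u c = snd z" using u(3) by (auto simp: lift_coord[of c u])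
    obtain X' where X': "pi_vector_field M X'" "X' u c = X" using pi_with_value[OF c u(1)] by blast
    show "dd (\<lambda>x. coef c x (X, 0) (snd z)) z (0, Y) = 0" for Y
    proof -
      obtain Y' where Y': "pi_vector_field M Y'" "Y' u c = Y" using pi_with_value[OF c u(1)] by blast
      have "hv_curv M D X' Y' eta u = 0"
        using berwald X'(1) Y'(1) u(2) unfolding berwald_connection_def hv_curv_hat_def by blast
      then show ?thesis
        using hv_curv_coords[OF c u(1) X'(1) Y'(1) pi_eta] X'(2) Y'(2) u(3) uz by (simp add: eta_def)
    qed
    note t = pi_tangent[OF X'(1) u(2)]
    note b = beta_properties[OF u(2) t]
    \<comment> \<open>The defining condition uses lifts of projections; applied to a lift it returns
      that lift, because \<open>rho\<close> inverts \<open>beta\<close>.\<close>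
    have "dir_deriv (slit_atlas M) L u (beta M D u (rho M u (beta M D u (X' u)))) = 0"
      using berwald u(2) b(1) unfolding berwald_connection_def by blast
    then have "dir_deriv (slit_atlas M) L u (beta M D u (X' u)) = 0" by (simp add: b(3))
    moreover have "smooth_in_chart (lift c) L"
      using finsler lift_in[OF c] unfolding finsler_manifold_def smooth_fun_def by metis
    ultimately have "dd (\<lambda>x. L (param (lift c) x)) z (beta M D u (X' u) (lift c)) = 0"
      using slit.dir_deriv_smooth[OF lift_in[OF c] u(1) _ b(1), of L] u(3) by simp
    \<comment> \<open>The differential of the energy is \<open>L\<close> times that of
      \<open>L\<close>, so constancy along the lift passes from \<open>L\<close> to the
      energy.\<close>
    then show "dd (energy c) z (X, - coef c z (X, 0) (snd z)) = 0"
      unfolding dd_eqI[OF energy_has_derivative[OF c z]] beta_coords[OF c u(1) t] u(3) uz X'(2) by simp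
  qed
qed

end

section \<open>The conditions on the Cartan connection in a chart\<close>

locale cartan_space = finsler_space M L for M :: "('m, 'e::euclidean_space) atlas" and L +
  fixes D :: "('m, 'e) pi_conn"
  assumes cartan: "cartan_connection M L D"

sublocale cartan_space \<subseteq> regular_pi_connection M D
  by unfold_locales (use cartan in \<open>simp add: cartan_connection_def\<close>)

context cartan_space
begin

lemma hv_torsion_pi: "pi_vector_field M X \<Longrightarrow> pi_vector_field M Y \<Longrightarrow> pi_vector_field M (hv_torsion M D X Y)"
  unfolding hv_torsion_def by (intro torsion_pi vec_beta vec_gamma)

lemma beta_fst:
  assumes "c \<in> M" "u \<in> dom_of (lift c)" "pi_vector_field M X"
  shows "fst (beta_f M D X u (lift c)) = X u c"
  unfolding beta_f_def by (rule beta_chart(1)[OF assms(1,2) pi_tangent[OF assms(3) lift_dom_subset(2)[OF assms(2)]]])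

lemma hv_torsion_coords:
  assumes c: "c \<in> M" and u: "u \<in> dom_of (lift c)" and X: "pi_vector_field M X" and Y: "pi_vector_field M Y"
  shows "hv_torsion M D X Y u c = coef c (coord (lift c) u) (0, X u c) (Y u c)"
  unfolding hv_torsion_def torsion_chart[OF c u vec_gamma[OF X] vec_beta[OF Y]] gamma_chart[OF c u] beta_fst[OF c u Y]
  using smooth_bilinear_right(1)[OF coef_bilinear[OF c] regionI[OF c u]] by simp

lemma local_metric_coef:
  assumes c: "c \<in> M"
  shows "local_metric (region c) (energy c) (coef c)"
proof -
  interpret loc: local_finsler "region c" "energy c" by (rule local_finsler_energy[OF c])
  show ?thesis
  proof unfold_locales
    show "smooth_bilinear (region c) (coef c)" by (rule coef_bilinear[OF c])
    show "0 < loc.g z v v" if "z \<in> region c" "v \<noteq> 0" for z v by (rule gloc_pos[OF c that])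
  next
    fix z Y Z assume z: "z \<in> region c"
    obtain u where u: "u \<in> dom_of (lift c)" "u \<in> slit_bundle M" "coord (lift c) u = z" "u = param (lift c) z"
      using region_point[OF c z] by blast
    obtain Y' where Y': "pi_vector_field M Y'" "Y' u c = Y" using pi_with_value[OF c u(1)] by blast
    obtain Z' where Z': "pi_vector_field M Z'" "Z' u c = Z" using pi_with_value[OF c u(1)] by blast
    show "loc.g z (coef c z (0, X) Y) Z = loc.g z (coef c z (0, X) Z) Y" for X
    proof -
      obtain X' where X': "pi_vector_field M X'" "X' u c = X" using pi_with_value[OF c u(1)] by blast
      have "metric_f L (hv_torsion M D X' Y') Z' u = metric_f L (hv_torsion M D X' Z') Y' u"
        using cartan X'(1) Y'(1) Z'(1) u(2) unfolding cartan_connection_def by blast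
      then show ?thesis
        using metric_f_chart[OF c u(1) hv_torsion_pi[OF X'(1) Y'(1)] Z'(1)] metric_f_chart[OF c u(1) hv_torsion_pi[OF X'(1) Z'(1)] Y'(1)]
          hv_torsion_coords[OF c u(1) X'(1) Y'(1)] hv_torsion_coords[OF c u(1) X'(1) Z'(1)]
        by (simp add: X'(2) Y'(2) Z'(2) u(3))
    qed
    show "dd (\<lambda>x. loc.g x Y Z) z a = loc.g z (coef c z a Y) Z + loc.g z Y (coef c z a Z)" for a
    proof -
      obtain a' where a': "a' \<in> tangent_space (slit_atlas M) u" "a' (lift c) = a"
        using tangent_with_value[OF c u(1)] by blast
      note sY = pi_smooth[OF Y'(1) c] and sZ = pi_smooth[OF Z'(1) c]
      have pl: "piloc c Y' z = Y" "piloc c Z' z = Z"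
        using piloc_coord[OF c u(1), of Y'] piloc_coord[OF c u(1), of Z'] Y'(2) Z'(2) u(3) by simp_all
      have eq: "loc.g x (piloc c Y' x) (piloc c Z' x) = metric_f L Y' Z' (param (lift c) x)" if "x \<in> region c" for x
        using metric_f_chart[OF c region_point(1)[OF c that] Y'(1) Z'(1)] region_point(2)[OF c that] by (simp add: piloc_def)
      have s: "smooth_on (region c) (\<lambda>x. loc.g x (piloc c Y' x) (piloc c Z' x))"
        by (rule smooth_on_bilinear_family[OF loc.open_S loc.g_bilinear sY sZ])
      have "smooth_on (region c) (\<lambda>x. metric_f L Y' Z' (param (lift c) x))"
        by (rule smooth_on_cong[OF loc.open_S eq s])
      then have "dir_deriv (slit_atlas M) (metric_f L Y' Z') u a' = dd (\<lambda>x. metric_f L Y' Z' (param (lift c) x)) z a"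
        using slit.dir_deriv_smooth[OF lift_in[OF c] u(1) _ a'(1), of "metric_f L Y' Z'"] a'(2) u(3)
        by (simp add: smooth_in_chart_iff lift_region[OF c])
      also have "\<dots> = dd (\<lambda>x. loc.g x (piloc c Y' x) (piloc c Z' x)) z a"
        by (rule dd_cong[OF loc.open_S z eq[symmetric]])
      also have "\<dots> = dd (\<lambda>x. loc.g x Y Z) z a + loc.g z (dd (piloc c Y') z a) Z + loc.g z Y (dd (piloc c Z') z a)"
        by (rule dd_bilinear_family[where f = "piloc c Y'" and g = "piloc c Z'", OF loc.open_S z loc.g_bilinear sY sZ, unfolded pl])
      finally have 1: "dir_deriv (slit_atlas M) (metric_f L Y' Z') u a' = \<dots>" .
      have D: "D u a' V c = dd (piloc c V) z a + coef c z a (V u c)" if "pi_vector_field M V" for V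
        using conn_chart[OF c u(1) a'(1) that] a'(2) u(3) by simp
      have "dir_deriv (slit_atlas M) (metric_f L Y' Z') u a' - finsler_metric L u (D u a' Y') (Z' u)
          - finsler_metric L u (Y' u) (D u a' Z') = 0"
        using cartan a'(1) Y'(1) Z'(1) u(2) unfolding cartan_connection_def metrical_def by blast
      \<comment> \<open>The derivatives of the extended fields occur both in the product rule and in
        the covariant derivatives; they cancel and leave the condition on the coefficients.\<close>
      then have "dd (\<lambda>x. loc.g x Y Z) z a + loc.g z (dd (piloc c Y') z a) Z + loc.g z Y (dd (piloc c Z') z a)
          - loc.g z (dd (piloc c Y') z a + coef c z a Y) Z - loc.g z Y (dd (piloc c Z') z a + coef c z a Z) = 0"
        unfolding 1
        using finsler_metric_chart[OF c u(1) conn_tangent[OF u(2) a'(1) Y'(1)] pi_tangent[OF Z'(1) u(2)]]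
          finsler_metric_chart[OF c u(1) pi_tangent[OF Y'(1) u(2)] conn_tangent[OF u(2) a'(1) Z'(1)]]
        by (simp add: D[OF Y'(1)] D[OF Z'(1)] Y'(2) Z'(2) u(3))
      then show ?thesis
        by (simp add: linear_add[OF loc.g_linear(1)[OF z]] linear_add[OF loc.g_linear(2)[OF z]])
    qed
  qed
qed

lemma beta_coords:
  assumes c: "c \<in> M" and u: "u \<in> dom_of (lift c)" and X: "pi_vector_field M X"
  shows "beta_f M D X u (lift c) = (X u c, - local_metric.Nc (coef c) (coord (lift c) u) (X u c))"
proof -
  interpret loc: local_metric "region c" "energy c" "coef c" by (rule local_metric_coef[OF c])
  let ?b = "beta_f M D X u (lift c)" let ?z = "coord (lift c) u"
  have z: "?z \<in> region c" by (rule regionI[OF c u])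
  have "snd ?b + coef c ?z ?b (snd ?z) = 0"
    using beta_chart(2)[OF c u pi_tangent[OF X lift_dom_subset(2)[OF u]]] by (simp add: beta_f_def lift_coord[of c u])
  moreover have "coef c ?z ?b (snd ?z) = loc.Nc ?z (X u c)"
    using loc.C_radial[OF z, of "fst ?b" "snd ?b", unfolded prod.collapse] unfolding beta_fst[OF c u X] .
  ultimately show ?thesis
    using beta_fst[OF c u X] by (simp add: prod_eq_iff eq_neg_iff_add_eq_0)
qed

lemma local_cartan_coef:
  assumes c: "c \<in> M"
  shows "local_cartan (region c) (energy c) (coef c)"
proof -
  interpret loc: local_metric "region c" "energy c" "coef c" by (rule local_metric_coef[OF c])
  show ?thesis
  proof unfold_locales
    fix z X Y assume z: "z \<in> region c"
    obtain u where u: "u \<in> dom_of (lift c)" "u \<in> slit_bundle M" "coord (lift c) u = z"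
      using region_point[OF c z] by blast
    obtain X' where X': "pi_vector_field M X'" "X' u c = X" using pi_with_value[OF c u(1)] by blast
    obtain Y' where Y': "pi_vector_field M Y'" "Y' u c = Y" using pi_with_value[OF c u(1)] by blast
    have "torsion M D (beta_f M D X') (beta_f M D Y') u = 0"
      using cartan X'(1) Y'(1) u(2) unfolding cartan_connection_def h_torsion_def by blast
    then show "loc.F z X Y = loc.F z Y X"
      using torsion_chart[OF c u(1) vec_beta[OF X'(1)] vec_beta[OF Y'(1)]]
      unfolding beta_coords[OF c u(1) X'(1)] beta_coords[OF c u(1) Y'(1)] X'(2) Y'(2) u(3) loc.F_def by simp
  qed
qed

end

section \<open>The six statements at one point of the slit bundle\<close>

theorem theorem4p5:
  fixes M :: "('m, 'e::euclidean_space) atlas"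
    and L :: "('m, 'e) tpoint \<Rightarrow> real"
    and CC D :: "('m, 'e) pi_conn"
    and X Y Z W :: "('m, 'e) pifield"
  assumes "finsler_manifold M L"
    and "cartan_connection M L CC"
    and "berwald_connection M L D"
    and "pi_vector_field M X" "pi_vector_field M Y" "pi_vector_field M Z" "pi_vector_field M W"
  shows "\<forall>u\<in>slit_bundle M.
      hv_curv_hat M D X Y u = 0 \<and>
      hv_curv_form M L D X Y Z W u + hv_curv_form M L D X Y W Z u =
        2 * cov_form3 M D (beta_f M CC X) (hv_torsion_form M L CC) Y Z W u +
        2 * cov_form3 M D (gamma_f M Y) (hv_curv_hat_form M L CC) X Z W u \<and>
      hv_curv M D X Y Z u = hv_curv M D Z Y X u \<and>
      cov_tensor3 D (gamma_f M X) (hv_curv M D) Y Z W u =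
        cov_tensor3 D (gamma_f M Z) (hv_curv M D) Y X W u \<and>
      (hv_curv M D X Y Z u = hv_curv M D Y X Z u \<and>
       hv_curv M D X Y Z u = hv_curv M D X Z Y u \<and>
       hv_curv M D X Y Z u = hv_curv M D Z Y X u \<and>
       hv_curv M D X Y Z u = hv_curv M D Y Z X u \<and>
       hv_curv M D X Y Z u = hv_curv M D Z X Y u) \<and>
      cov_tensor3 D (gamma_f M eta) (hv_curv M D) X Y Z u = - hv_curv M D X Y Z u"
proof
  fix u assume us: "u \<in> slit_bundle M"
  interpret finsler_space M L by unfold_locales (rule assms(1))
  interpret D: berwald_space M L D by unfold_locales (rule assms(3))
  interpret C: cartan_space M L CC by unfold_locales (rule assms(2))
  note X = assms(4) and Y = assms(5) and Z = assms(6) and W = assms(7)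
  obtain c where c: "c \<in> M" and u: "u \<in> dom_of (lift c)" using slit_bundle_chart[OF us] by blast
  let ?z = "coord (lift c) u"
  have z: "?z \<in> region c" by (rule regionI[OF c u])
  have uz: "snd u c = snd ?z" by (simp add: lift_coord[of c u])
  interpret loc: local_berwald_cartan "region c" "energy c" "D.coef c" "C.coef c"
    by (intro local_berwald_cartan.intro D.local_berwald_coef[OF c] C.local_cartan_coef[OF c])
  have curv: "hv_curv M D X Y Z u c = loc.P (coord (lift c) u) (X u c) (Y u c) (Z u c)"
    if "pi_vector_field M X" "pi_vector_field M Y" "pi_vector_field M Z" "u \<in> dom_of (lift c)" for X Y Z u
    using D.hv_curv_coords[OF c that(4,1,2,3)] by (simp add: loc.P_def loc.\<Gamma>_def)
  \<comment> \<open>Tangent vectors that agree in one chart are equal, so the symmetries of the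
    local \<open>P\<close> transfer to the curvature.\<close>
  have eqI: "hv_curv M D X Y Z u = hv_curv M D X' Y' Z' u"
    if "pi_vector_field M X" "pi_vector_field M Y" "pi_vector_field M Z"
      "pi_vector_field M X'" "pi_vector_field M Y'" "pi_vector_field M Z'"
      "loc.P ?z (X u c) (Y u c) (Z u c) = loc.P ?z (X' u c) (Y' u c) (Z' u c)" for X Y Z X' Y' Z'
    by (rule base.tangent_eqI[OF pi_tangent[OF D.hv_curv_pi[OF that(1-3)] us] pi_tangent[OF D.hv_curv_pi[OF that(4-6)] us]
          c lift_dom_subset(1)[OF u]])
      (use curv that u in simp)
  note s12 = loc.P_swap12[OF z] and s13 = loc.P_swap13[OF z] and s23 = loc.P_swap23[OF z]
  have sym: "hv_curv M D X Y Z u = hv_curv M D Y X Z u" "hv_curv M D X Y Z u = hv_curv M D X Z Y u"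
      "hv_curv M D X Y Z u = hv_curv M D Z Y X u" "hv_curv M D X Y Z u = hv_curv M D Y Z X u"
      "hv_curv M D X Y Z u = hv_curv M D Z X Y u"
    by (rule eqI[OF X Y Z Y X Z s12] eqI[OF X Y Z X Z Y s23] eqI[OF X Y Z Z Y X s13]
        eqI[OF X Y Z Y Z X trans[OF s12 s23]] eqI[OF X Y Z Z X Y trans[OF s13 s23]])+
  have hat: "hv_curv_hat M D X Y u = 0"
    using assms(3) X Y us unfolding berwald_connection_def by blast
  \<comment> \<open>Vertical covariant differentiation is plain differentiation, since the Berwald
    coefficients vanish in vertical directions and remove every correction term.\<close>
  have tensor: "cov_tensor3 D (gamma_f M A) (hv_curv M D) X Y Z u c =
      dd (\<lambda>x. loc.P x (X u c) (Y u c) (Z u c)) ?z (0, A u c)"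
    if "pi_vector_field M A" "pi_vector_field M X" "pi_vector_field M Y" "pi_vector_field M Z" for A X Y Z
  proof -
    let ?G = "D.coef c ?z (gamma_f M A u (lift c))"
    have "cov_tensor3 D (gamma_f M A) (hv_curv M D) X Y Z u c =
      dd (\<lambda>x. loc.P x (X u c) (Y u c) (Z u c)) ?z (gamma_f M A u (lift c)) + ?G (loc.P ?z (X u c) (Y u c) (Z u c))
      - loc.P ?z (?G (X u c)) (Y u c) (Z u c) - loc.P ?z (X u c) (?G (Y u c)) (Z u c) - loc.P ?z (X u c) (Y u c) (?G (Z u c))"
      by (rule D.cov_tensor3_chart[where \<omega> = "hv_curv M D" and t = loc.P, OF c u vec_gamma[OF that(1)] loc.P_trilinear
            curv that(2-4) D.hv_curv_pi[OF that(2-4)]])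
    then show ?thesis
    using linear_0[OF smooth_trilinearD(1)[OF loc.P_trilinear z]] linear_0[OF smooth_trilinearD(2)[OF loc.P_trilinear z]]
      linear_0[OF smooth_trilinearD(3)[OF loc.P_trilinear z]]
    by (simp add: D.gamma_chart[OF c u] loc.G_vertical[OF z])
  qed
  have tensor_pi: "pi_vector_field M (cov_tensor3 D (gamma_f M A) (hv_curv M D) X Y Z)"
    if "pi_vector_field M A" "pi_vector_field M X" "pi_vector_field M Y" "pi_vector_field M Z" for A X Y Z
    unfolding cov_tensor3_def by (intro pi_diff D.cov_pi D.hv_curv_pi vec_gamma that)
  have d: "cov_tensor3 D (gamma_f M X) (hv_curv M D) Y Z W u = cov_tensor3 D (gamma_f M Z) (hv_curv M D) Y X W u"
    by (rule base.tangent_eqI[OF pi_tangent[OF tensor_pi[OF X Y Z W] us] pi_tangent[OF tensor_pi[OF Z Y X W] us]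
          c lift_dom_subset(1)[OF u]])
      (simp only: tensor X Y Z W loc.dd_P_swap[OF z, of "Y u c" "Z u c" "W u c"])
  have f: "cov_tensor3 D (gamma_f M eta) (hv_curv M D) X Y Z u = - hv_curv M D X Y Z u"
  proof (rule base.tangent_eqI[OF pi_tangent[OF tensor_pi[OF pi_eta X Y Z] us]
        base.tangent_minus[OF pi_tangent[OF D.hv_curv_pi[OF X Y Z] us]] c lift_dom_subset(1)[OF u]])
    show "cov_tensor3 D (gamma_f M eta) (hv_curv M D) X Y Z u c = (- hv_curv M D X Y Z u) c"
      using tensor[OF pi_eta X Y Z] loc.dd_P_radial[OF z] curv[OF X Y Z u] by (simp add: eta_def uz)
  qed
  have torsion_form: "hv_torsion_form M L CC X Y Z u = loc.g (coord (lift c) u) (C.coef c (coord (lift c) u) (0, X u c) (Y u c)) (Z u c)"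
    if "pi_vector_field M X" "pi_vector_field M Y" "pi_vector_field M Z" "u \<in> dom_of (lift c)" for X Y Z u
    unfolding hv_torsion_form_def metric_f_chart[OF c that(4) C.hv_torsion_pi[OF that(1,2)] that(3)]
      C.hv_torsion_coords[OF c that(4,1,2)] ..
  have curv_hat_form: "hv_curv_hat_form M L CC X Y Z u = loc.q (coord (lift c) u) (X u c) (Y u c) (Z u c)"
    if X: "pi_vector_field M X" and Y: "pi_vector_field M Y" and Z: "pi_vector_field M Z" and u: "u \<in> dom_of (lift c)" for X Y Z u
  proof -
    have uz: "snd u c = snd (coord (lift c) u)" by (simp add: lift_coord[of c u])
    have "hv_curv M CC X Y eta u c = loc.\<Gamma> (coord (lift c) u) (X u c) (Y u c) - loc.F (coord (lift c) u) (X u c) (Y u c)"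
      unfolding hv_curv_def C.curvature_chart[OF c u C.vec_beta[OF X] vec_gamma[OF Y] pi_eta]
        C.beta_coords[OF c u X] C.gamma_chart[OF c u] eta_def uz
      by (rule loc.mixed_curvature_radial[OF regionI[OF c u]])
    then show ?thesis
      unfolding hv_curv_hat_form_def hv_curv_hat_def metric_f_chart[OF c u C.hv_curv_pi[OF X Y pi_eta] Z] loc.q_def by simp
  qed
  have form: "hv_curv_form M L D X Y Z W u = loc.g ?z (loc.P ?z (X u c) (Y u c) (Z u c)) (W u c)"
    if "pi_vector_field M X" "pi_vector_field M Y" "pi_vector_field M Z" "pi_vector_field M W" for X Y Z W
    unfolding hv_curv_form_def metric_f_chart[OF c u D.hv_curv_pi[OF that(1-3)] that(4)] curv[OF that(1-3) u] ..
  \<comment> \<open>The field to differentiate along is the Cartan lift, while the derivative is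
    that of Berwald. Equality of \<open>Nc\<close> and \<open>N\<close> gives the direction, and
    \<open>loc.G_eq\<close> reduces the coefficients to \<open>\<Gamma>\<close>.\<close>
  have 1: "cov_form3 M D (beta_f M CC X) (hv_torsion_form M L CC) Y Z W u =
      dd (\<lambda>x. loc.g x (C.coef c x (0, Y u c) (Z u c)) (W u c)) ?z (X u c, - loc.N ?z (X u c))
      - loc.g ?z (C.coef c ?z (0, loc.\<Gamma> ?z (X u c) (Y u c)) (Z u c)) (W u c)
      - loc.g ?z (C.coef c ?z (0, Y u c) (loc.\<Gamma> ?z (X u c) (Z u c))) (W u c)
      - loc.g ?z (C.coef c ?z (0, Y u c) (Z u c)) (loc.\<Gamma> ?z (X u c) (W u c))"
  proof -
    let ?b = "beta_f M CC X u (lift c)"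
    have "cov_form3 M D (beta_f M CC X) (hv_torsion_form M L CC) Y Z W u =
      dd (\<lambda>x. loc.g x (C.coef c x (0, Y u c) (Z u c)) (W u c)) ?z ?b
      - loc.g ?z (C.coef c ?z (0, D.coef c ?z ?b (Y u c)) (Z u c)) (W u c)
      - loc.g ?z (C.coef c ?z (0, Y u c) (D.coef c ?z ?b (Z u c))) (W u c)
      - loc.g ?z (C.coef c ?z (0, Y u c) (Z u c)) (D.coef c ?z ?b (W u c))"
      by (rule D.cov_form3_chart[where \<omega> = "hv_torsion_form M L CC" and t = "\<lambda>x Y Z W. loc.g x (C.coef c x (0, Y) Z) W",
            OF c u C.vec_beta[OF X] loc.t_trilinear torsion_form Y Z W])
    then show ?thesis
      unfolding C.beta_coords[OF c u X] loc.Nc_eq[OF z] loc.G_eq[OF z] fst_conv .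
  qed
  have 2: "cov_form3 M D (gamma_f M Y) (hv_curv_hat_form M L CC) X Z W u =
      dd (\<lambda>x. loc.q x (X u c) (Z u c) (W u c)) ?z (0, Y u c)"
  proof -
    let ?G = "D.coef c ?z (gamma_f M Y u (lift c))"
    have "cov_form3 M D (gamma_f M Y) (hv_curv_hat_form M L CC) X Z W u =
      dd (\<lambda>x. loc.q x (X u c) (Z u c) (W u c)) ?z (gamma_f M Y u (lift c))
      - loc.q ?z (?G (X u c)) (Z u c) (W u c) - loc.q ?z (X u c) (?G (Z u c)) (W u c) - loc.q ?z (X u c) (Z u c) (?G (W u c))"
      by (rule D.cov_form3_chart[where \<omega> = "hv_curv_hat_form M L CC" and t = loc.q,
            OF c u vec_gamma[OF Y] loc.q_trilinear curv_hat_form X Z W])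
    then show ?thesis
    using linear_0[OF smooth_trilinearD(1)[OF loc.q_trilinear z]] linear_0[OF smooth_trilinearD(2)[OF loc.q_trilinear z]]
      linear_0[OF smooth_trilinearD(3)[OF loc.q_trilinear z]]
    by (simp add: D.gamma_chart[OF c u] loc.G_vertical[OF z])
  qed
  have b: "hv_curv_form M L D X Y Z W u + hv_curv_form M L D X Y W Z u =
        2 * cov_form3 M D (beta_f M CC X) (hv_torsion_form M L CC) Y Z W u +
        2 * cov_form3 M D (gamma_f M Y) (hv_curv_hat_form M L CC) X Z W u"
    \<comment> \<open>Once every term is written in the chart, (b) is literally the local identity
      at \<open>?z\<close>.\<close>
    unfolding form[OF X Y Z W] form[OF X Y W Z] 1 2 by (rule loc.mixed_curvature_formula[OF z])
  show "hv_curv_hat M D X Y u = 0 \<and>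
      hv_curv_form M L D X Y Z W u + hv_curv_form M L D X Y W Z u =
        2 * cov_form3 M D (beta_f M CC X) (hv_torsion_form M L CC) Y Z W u +
        2 * cov_form3 M D (gamma_f M Y) (hv_curv_hat_form M L CC) X Z W u \<and>
      hv_curv M D X Y Z u = hv_curv M D Z Y X u \<and>
      cov_tensor3 D (gamma_f M X) (hv_curv M D) Y Z W u =
        cov_tensor3 D (gamma_f M Z) (hv_curv M D) Y X W u \<and>
      (hv_curv M D X Y Z u = hv_curv M D Y X Z u \<and>
       hv_curv M D X Y Z u = hv_curv M D X Z Y u \<and>
       hv_curv M D X Y Z u = hv_curv M D Z Y X u \<and>
       hv_curv M D X Y Z u = hv_curv M D Y Z X u \<and>
       hv_curv M D X Y Z u = hv_curv M D Z X Y u) \<and>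
      cov_tensor3 D (gamma_f M eta) (hv_curv M D) X Y Z u = - hv_curv M D X Y Z u"
    by (intro conjI hat b sym d f)
qed

end
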